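(* Let $\kappa$ be a finite field of characteristic $p\neq 2$, fix $c,d\in\kappa^\times$, and define $$\Pi_1(u,T) = c(T^2+u^p)^2 + du, \qquad \Pi_2(u,T) = 1 + 4\Pi_1(u,T) \quad \in \kappa[u][T].$$ Then there exist infinitely many closed points $u_0 \in \mathbf{A}^1_\kappa$ such that $\Pi_1(u_0,T)$ and $\Pi_2(u_0,T)$ are both irreducible in $\kappa_0[T]$, where $\kappa_0 = \kappa(u_0)$ is the residue field of $u_0$ and $\Pi_j(u_0,T)$ denotes the image of $\Pi_j$ under $\kappa[u]\to\kappa_0$. *)

theory Defs
  imports "HOL-Algebra.Algebra"
begin

definition alg_char :: "('a, 'b) ring_scheme \<Rightarrow> nat" where
  "alg_char R = (if \<exists>n::nat. n > 0 \<and> [n] \<cdot>\<^bsub>R\<^esub> \<one>\<^bsub>R\<^esub> = \<zero>\<^bsub>R\<^esub>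
                 then (LEAST n::nat. n > 0 \<and> [n] \<cdot>\<^bsub>R\<^esub> \<one>\<^bsub>R\<^esub> = \<zero>\<^bsub>R\<^esub>) else 0)"

text \<open>Pi1(u,T) = c (T^2 + u^p)^2 + d u, as an element of (kappa[u])[T].
  Polynomials are HOL-Algebra coefficient lists (leading coefficient first);
  u = X over K, T = X over K[u].\<close>
definition Pi1 :: "('a, 'b) ring_scheme \<Rightarrow> nat \<Rightarrow> 'a \<Rightarrow> 'a \<Rightarrow> 'a list list" where
  "Pi1 K p c d =
     (let P = poly_ring K; PT = poly_ring P;
          C = ring.poly_of_const P; u = X\<^bsub>K\<^esub>; T = X\<^bsub>P\<^esub>
      in (C (ring.poly_of_const K c) \<otimes>\<^bsub>PT\<^esub>
            ((T [^]\<^bsub>PT\<^esub> (2::nat) \<oplus>\<^bsub>PT\<^esub> C (u [^]\<^bsub>P\<^esub> p)) [^]\<^bsub>PT\<^esub> (2::nat)))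
         \<oplus>\<^bsub>PT\<^esub> C (ring.poly_of_const K d \<otimes>\<^bsub>P\<^esub> u))"

definition Pi2 :: "('a, 'b) ring_scheme \<Rightarrow> nat \<Rightarrow> 'a \<Rightarrow> 'a \<Rightarrow> 'a list list" where
  "Pi2 K p c d = (let PT = poly_ring (poly_ring K)
                  in \<one>\<^bsub>PT\<^esub> \<oplus>\<^bsub>PT\<^esub> ([(4::nat)] \<cdot>\<^bsub>PT\<^esub> Pi1 K p c d))"

text \<open>Residue field kappa(u0) = kappa[u]/(f) of the closed point given by the
  monic irreducible f, and the image of a polynomial in (kappa[u])[T] in kappa(u0)[T]
  (coefficientwise reduction, then normalization).\<close>
abbreviation residue_field :: "('a, 'b) ring_scheme \<Rightarrow> 'a list \<Rightarrow> 'a list set ring" where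
  "residue_field K f \<equiv> Rupt\<^bsub>K\<^esub> (carrier K) f"

definition specialize :: "('a, 'b) ring_scheme \<Rightarrow> 'a list \<Rightarrow> 'a list list \<Rightarrow> 'a list set list" where
  "specialize K f Q =
     ring.normalize (residue_field K f)
       (map (\<lambda>q. (PIdl\<^bsub>poly_ring K\<^esub> f) +>\<^bsub>poly_ring K\<^esub> q) Q)"

definition closed_point :: "('a, 'b) ring_scheme \<Rightarrow> 'a list \<Rightarrow> bool" where
  "closed_point K f \<longleftrightarrow> f \<in> carrier (poly_ring K) \<and> pirreducible\<^bsub>K\<^esub> (carrier K) f
                        \<and> lead_coeff f = \<one>\<^bsub>K\<^esub>"

end

theory Submission
  imports "HOL-Computational_Algebra.Polynomial_FPS" Defs
begin

text \<open>
  Over a field, \<open>c (T\<^sup>2 + a)\<^sup>2 + k\<close> is irreducible as soon as \<open>- c k\<close> and \<open>c (c a\<^sup>2 + k)\<close> are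
  nonsquares. At the closed point of \<open>x\<close> this leaves four polynomials in \<open>x\<close>, namely
  \<open>- c d x\<close> and \<open>c (c x\<^bsup>2p\<^esup> + d x)\<close> from \<open>\<Pi>\<^sub>1\<close>, and \<open>- 4c (4d x + 1)\<close> and
  \<open>4c (4c x\<^bsup>2p\<^esup> + 4d x + 1)\<close> from \<open>\<Pi>\<^sub>2\<close>, which must be nonsquares simultaneously. For every nonempty
  subset of them some root occurs in their product with odd multiplicity, the two polynomials of
  degree \<open>2p\<close> having simple roots because their derivative is a nonzero constant.

  Simultaneous nonsquares come from L-functions. Monic polynomials over the field with \<open>q\<close> elements
  correspond to Frobenius-stable multisets of points of the algebraic closure, and a polynomial
  \<open>A\<close> defines a quadratic symbol on them by the product of its values. Exchanging the
  roots of both polynomials (quadratic reciprocity) turns the symbol into a nontrivial character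
  modulo \<open>A\<close>, so the L-function of each nonempty subset of the four polynomials is
  a polynomial \<open>L(z)\<close>. If \<open>L(1/q)\<close> were zero then \<open>L(z)/(1 - q z)\<close> would be a polynomial; but its
  logarithmic derivative has nonnegative coefficients, infinitely many of them positive, so the
  same holds for its own coefficients. Finally, the alternating sum
  of the logarithmic derivatives over all subsets only sees the points at which all four symbols are
  \<open>-1\<close>, or at which one of them is zero. If there were finitely many, the sum would have
  periodic coefficients, which is incompatible with its pole at \<open>1/q\<close> coming from the empty subset.
\<close>

section \<open>Logarithmic derivatives of generating functions\<close>

text \<open>Nonsquareness has to be tested in the residue field of the closed point, whereas the
  counting is done with points of the algebraic closure. The link is the norm: for x fixed by the
  j-th iterate of Frobenius, the symbol attached to \<open>orbit_mset j x\<close> is the quadratic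
  character of the norm of the value at x from the field with q^j elements, so -1 certifies a
  nonsquare in that field. Evaluation at x embeds the residue field of the closed point below x into
  it, and a nonsquare stays a nonsquare in a smaller field; j may therefore be any period of x. Only
  finitely many x lie above one closed point, so infinitely many x give infinitely many closed
  points. The obstacle is independence of the four symbols: if the product of some of the
  polynomials were a constant times a square, their signs could be tied together in a way that
  excludes four values -1. Hence every nonempty subset must have a root of odd multiplicity. Odd
  characteristic keeps 4c nonzero, so that \<open>Pi2\<close> is again of the form c (T^2 + a)^2 +
  k.\<close>

context includes fps_syntax
begin

text \<open>With A and \<Psi> the generating functions of \<open>a\<close> and \<open>psi\<close>,
  the recurrence is the coefficient form of X A' = \<Psi> A, so \<Psi> is X times the logarithmic
  derivative of A. The sum starts at j = 1, so \<open>psi 0\<close> is unconstrained and is replaced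
  by 0.\<close>

lemma fps_X_mult_deriv_eq_of_recurrence:
  fixes a psi :: "nat \<Rightarrow> real"
  assumes rec: "\<And>n. real n * a n = (\<Sum>j=1..n. psi j * a (n - j))"
  shows "fps_X * fps_deriv (Abs_fps a) = Abs_fps (\<lambda>j. if j = 0 then 0 else psi j) * Abs_fps a"
proof (rule fps_ext)
  fix n
  have "(fps_X * fps_deriv (Abs_fps a)) $ n = real n * a n"
    by (cases n) (simp_all)
  also have "\<dots> = (\<Sum>j=0..n. (if j = 0 then 0 else psi j) * a (n - j))"
  proof -
    have "(\<Sum>j=1..n. psi j * a (n - j)) = (\<Sum>j=0..n. (if j = 0 then 0 else psi j) * a (n - j))"
      by (rule sum.mono_neutral_cong_left) auto
    then show ?thesis by (rule trans[OF rec])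
  qed
  finally show "(fps_X * fps_deriv (Abs_fps a)) $ n =
      (Abs_fps (\<lambda>j. if j = 0 then 0 else psi j) * Abs_fps a) $ n"
    by (simp add: fps_mult_nth)
qed

lemma fps_eq_fps_of_polyI:
  fixes f :: "real fps"
  assumes "\<And>n. n \<ge> r \<Longrightarrow> f $ n = 0"
  obtains p where "f = fps_of_poly p"
proof
  have "finite {n. f $ n \<noteq> 0}"
    by (rule finite_subset[of _ "{..<r}"]) (use assms in \<open>auto intro: ccontr\<close>)
  then have "\<forall>\<^sub>\<infinity>n. f $ n = 0" by (simp add: MOST_iff_cofinite)
  then show "f = fps_of_poly (Abs_poly (fps_nth f))"
    by (intro fps_ext) (simp add: coeff_Abs_poly Abs_poly_inverse)
qed

text \<open>Comparing coefficients gives n C_n as the sum of the \<Psi>_j C_(n-j), where the term j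
  = 0 vanishes, so nonnegativity propagates by induction. The single term j = n equals \<Psi>_n C_0
  and already makes C_n positive.\<close>

lemma log_deriv_nonneg_imp_pos:
  fixes C \<Psi> :: "real fps"
  assumes CX: "fps_X * fps_deriv C = \<Psi> * C" and C0: "C $ 0 > 0"
    and nonneg: "\<And>j. \<Psi> $ j \<ge> 0" and "\<Psi> $ 0 = 0"
  shows "C $ n \<ge> 0" and "\<Psi> $ n > 0 \<Longrightarrow> C $ n > 0"
proof -
  have eq: "real n * C $ n = (\<Sum>j=0..n. \<Psi> $ j * C $ (n - j))" for n
  proof -
    have "real n * C $ n = (fps_X * fps_deriv C) $ n" by (cases n) simp_all
    then show ?thesis unfolding CX by (simp add: fps_mult_nth)
  qed
  have ge0: "C $ n \<ge> 0" for n
  proof (induction n rule: less_induct)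
    case (less n)
    show ?case
    proof (cases "n = 0")
      case False
      have "\<Psi> $ j * C $ (n - j) \<ge> 0" if "j \<in> {0..n}" for j
        using less[of "n - j"] nonneg[of j] assms(4) False by (cases "j = 0") auto
      then have "real n * C $ n \<ge> 0" unfolding eq by (rule sum_nonneg)
      with False show ?thesis by (simp add: zero_le_mult_iff)
    qed (use C0 in simp)
  qed
  show "C $ n \<ge> 0" by (rule ge0)
  assume pos: "\<Psi> $ n > 0"
  then have "n \<noteq> 0" using assms(4) by (metis less_irrefl)
  have "0 < \<Psi> $ n * C $ (n - n)" using pos C0 by simp
  also have "\<dots> \<le> (\<Sum>j=0..n. \<Psi> $ j * C $ (n - j))"
    by (rule member_le_sum) (use nonneg ge0 in auto)
  finally show "C $ n > 0" unfolding eq[symmetric] using \<open>n \<noteq> 0\<close> by (simp add: zero_less_mult_iff)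
qed

text \<open>The index \<open>s0\<close> carries the zeta function 1/(1 - qX); the other series are
  polynomials, shown not to vanish at 1/q. The combination therefore has a pole at 1/q, whereas a
  series with N-periodic coefficients has poles at N-th roots of unity only. \<open>D\<close> marks
  a progression on which positivity is strict, enough to exceed any degree.\<close>

lemma log_deriv_combination_not_periodic:
  fixes a psi :: "'s \<Rightarrow> nat \<Rightarrow> real" and \<sigma> :: "'s \<Rightarrow> real" and q :: real
  assumes J: "finite J" "s0 \<in> J" and \<sigma>: "\<sigma> s0 \<noteq> 0" and q: "q > 1"
    and rec: "\<And>s n. s \<in> J \<Longrightarrow> real n * a s n = (\<Sum>j=1..n. psi s j * a s (n - j))"
    and a0: "\<And>s. s \<in> J \<Longrightarrow> a s 0 = 1"
    and zeta: "\<And>n. a s0 n = q ^ n"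
    and fin: "\<And>s n. s \<in> J - {s0} \<Longrightarrow> n \<ge> r \<Longrightarrow> a s n = 0"
    and nonneg: "\<And>s j. s \<in> J - {s0} \<Longrightarrow> j \<ge> 1 \<Longrightarrow> psi s0 j + psi s j \<ge> 0"
    and D: "D \<ge> (1::nat)" "\<And>s k. s \<in> J - {s0} \<Longrightarrow> k \<ge> 1 \<Longrightarrow> psi s0 (D * k) + psi s (D * k) > 0"
    and N: "N \<ge> (1::nat)"
      "\<And>j. j \<ge> 1 \<Longrightarrow> (\<Sum>s\<in>J. \<sigma> s * psi s (j + N)) = (\<Sum>s\<in>J. \<sigma> s * psi s j)"
  shows False
proof -
  define A where "A s = Abs_fps (a s)" for s
  define \<Psi> where "\<Psi> s = Abs_fps (\<lambda>j. if j = 0 then 0 else psi s j)" for s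
  define Z where "Z = A s0"
  have logd: "fps_X * fps_deriv (A s) = \<Psi> s * A s" if "s \<in> J" for s
    unfolding A_def \<Psi>_def by (rule fps_X_mult_deriv_eq_of_recurrence[OF rec[OF that]])
  let ?e = "[:1, - q:]"
  have e: "fps_of_poly ?e = 1 - fps_const q * fps_X"
    by (rule fps_ext) (auto simp: coeff_pCons split: nat.splits)
  have Ze: "Z * fps_of_poly ?e = 1"
  proof (rule fps_ext)
    fix n show "(Z * fps_of_poly ?e) $ n = 1 $ n"
      unfolding e Z_def A_def by (cases n) (simp_all add: algebra_simps zeta)
  qed
  have "\<exists>L. \<forall>s\<in>J - {s0}. A s = fps_of_poly (L s)"
  proof (rule bchoice, rule ballI)
    fix s assume "s \<in> J - {s0}"
    then show "\<exists>L. A s = fps_of_poly L"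
      using fps_eq_fps_of_polyI[of r "A s"] fin[of s] by (metis A_def fps_nth_Abs_fps)
  qed
  then obtain L where L: "\<And>s. s \<in> J - {s0} \<Longrightarrow> A s = fps_of_poly (L s)" by blast
  have nonvanish: "poly (L s) (1 / q) \<noteq> 0" if s: "s \<in> J - {s0}" for s
  proof
    assume "poly (L s) (1 / q) = 0"
    then have "[:- (1 / q), 1:] dvd L s" by (simp add: poly_eq_0_iff_dvd)
    moreover have "?e = Polynomial.smult (- q) [:- (1 / q), 1:]" using q by simp
    ultimately have "?e dvd L s" using q by (metis smult_dvd neg_equal_0_iff_equal not_one_less_zero)
    \<comment> \<open>A zero of \<open>L s\<close> at 1/q cancels the pole of \<open>Z\<close>, so
      the product of both is the polynomial \<open>V\<close>. Logarithmic derivatives add, which is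
      why the hypotheses pair \<open>psi s0\<close> with \<open>psi s\<close>.\<close>
    then obtain V where V: "L s = ?e * V" by (elim dvdE)
    define C where "C = Z * A s"
    have "C = (Z * fps_of_poly ?e) * fps_of_poly V"
      unfolding C_def L[OF s] V by (simp only: fps_of_poly_mult mult.assoc)
    then have CV: "C = fps_of_poly V" by (simp add: Ze)
    have CX: "fps_X * fps_deriv C = (\<Psi> s0 + \<Psi> s) * C"
    proof -
      have "fps_X * fps_deriv C = (fps_X * fps_deriv Z) * A s + Z * (fps_X * fps_deriv (A s))"
        unfolding C_def by (simp add: algebra_simps)
      also have "\<dots> = (\<Psi> s0 * Z) * A s + Z * (\<Psi> s * A s)"
        using logd s J(2) unfolding Z_def by simp
      finally show ?thesis unfolding C_def by (simp add: algebra_simps)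
    qed
    have "C $ (D * k) > 0" if "k \<ge> 1" for k
    proof (rule log_deriv_nonneg_imp_pos(2)[OF CX])
      show "C $ 0 > 0" using a0 s J(2) by (simp add: C_def Z_def A_def)
      show "(\<Psi> s0 + \<Psi> s) $ j \<ge> 0" for j using nonneg[OF s, of j] by (simp add: \<Psi>_def)
      show "(\<Psi> s0 + \<Psi> s) $ (D * k) > 0"
        using D(1) D(2)[OF s that] that by (simp add: \<Psi>_def)
    qed (simp add: \<Psi>_def)
    \<comment> \<open>A positive coefficient beyond the degree of \<open>V\<close> is impossible; D
      \<ge> 1 makes the index D k at least k.\<close>
    from this[of "Suc (Polynomial.degree V)"]
    have "poly.coeff V (D * Suc (Polynomial.degree V)) \<noteq> 0" unfolding CV by simp
    moreover have "D * Suc (Polynomial.degree V) \<ge> Suc (Polynomial.degree V)"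
      using mult_le_mono1[OF D(1), of "Suc (Polynomial.degree V)"] by simp
    ultimately show False by (metis Suc_le_lessD coeff_eq_0)
  qed
  \<comment> \<open>\<open>P\<close> is a common denominator of all the logarithmic derivatives
    except that of \<open>s0\<close>, and it is nonzero at 1/q.\<close>
  define P where "P = (\<Prod>s\<in>J - {s0}. L s)"
  have Pq: "poly P (1 / q) \<noteq> 0"
    unfolding P_def poly_prod using nonvanish J(1) by simp
  have \<Psi>0: "\<Psi> s0 = fps_const q * fps_X * Z"
  proof -
    have "fps_deriv (Z * fps_of_poly ?e) = 0" by (simp add: Ze)
    then have "fps_deriv Z * fps_of_poly ?e = fps_const q * Z"
      unfolding e by (simp add: algebra_simps)
    then have "fps_X * fps_deriv Z * fps_of_poly ?e = fps_const q * fps_X * Z"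
      by (simp add: algebra_simps)
    then have "\<Psi> s0 * (Z * fps_of_poly ?e) = fps_const q * fps_X * Z"
      using logd[OF J(2)] unfolding Z_def by (simp add: mult.assoc)
    then show ?thesis by (simp add: Ze)
  qed
  have "\<exists>H. \<forall>s\<in>J - {s0}. \<Psi> s * fps_of_poly P = fps_of_poly (H s)"
  proof (rule bchoice, rule ballI)
    fix s assume s: "s \<in> J - {s0}"
    have "P = L s * (\<Prod>t\<in>J - {s0} - {s}. L t)"
      unfolding P_def using s J(1) by (simp add: prod.remove)
    then have "\<Psi> s * fps_of_poly P = (\<Psi> s * A s) * fps_of_poly (\<Prod>t\<in>J - {s0} - {s}. L t)"
      using L[OF s] by (simp add: fps_of_poly_mult mult.assoc)
    also have "\<dots> = (fps_X * fps_deriv (A s)) * fps_of_poly (\<Prod>t\<in>J - {s0} - {s}. L t)"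
      using logd s by simp
    also have "\<dots> = fps_of_poly (([:0,1:] * pderiv (L s)) * (\<Prod>t\<in>J - {s0} - {s}. L t))"
      unfolding L[OF s] fps_of_poly_mult fps_of_poly_fps_X[symmetric] fps_of_poly_pderiv
      by (simp add: fps_of_poly_pCons fps_of_poly_pderiv)
    finally show "\<exists>H. \<Psi> s * fps_of_poly P = fps_of_poly H" by blast
  qed
  then obtain H where H: "\<And>s. s \<in> J - {s0} \<Longrightarrow> \<Psi> s * fps_of_poly P = fps_of_poly (H s)" by blast
  define G where "G = (\<Sum>s\<in>J. fps_const (\<sigma> s) * \<Psi> s)"
  have Gn: "G $ j = (\<Sum>s\<in>J. \<sigma> s * psi s j)" if "j \<ge> 1" for j
    using that by (simp add: G_def \<Psi>_def fps_sum_nth)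
  \<comment> \<open>Multiplication by 1 - X^N turns a series that is N-periodic from index 1 on into
    a polynomial; the cut at \<open>Suc N\<close> accounts for the exceptional index 0.\<close>
  let ?u = "1 - Polynomial.monom 1 N"
  have u: "fps_of_poly ?u = 1 - fps_X ^ N"
    by (rule fps_ext) (simp add: fps_X_power_nth)
  have "(G * fps_of_poly ?u) $ n = 0" if "n \<ge> Suc N" for n
    using that N(2)[of "n - N"] Gn[of n] Gn[of "n - N"]
    unfolding u by (simp add: algebra_simps fps_X_power_mult_right_nth)
  then obtain W where W: "G * fps_of_poly ?u = fps_of_poly W"
    using fps_eq_fps_of_polyI by blast
  \<comment> \<open>\<open>U\<close> clears every denominator of \<open>G\<close> except that of
    \<open>\<Psi> s0\<close>, which is qX/(1 - qX). Multiplying the resulting identity by 1 - qX and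
    evaluating at 1/q gives U(1/q) = 0, against (1/q)^N < 1 and P(1/q) \<noteq> 0.\<close>
  define U where "U = Polynomial.smult (\<sigma> s0) (?u * P)"
  define Q where "Q = W * P - (\<Sum>s\<in>J - {s0}. Polynomial.smult (\<sigma> s) (H s)) * ?u"
  have "\<Psi> s0 * fps_of_poly U = fps_of_poly Q"
  proof -
    have Gsplit: "G = fps_const (\<sigma> s0) * \<Psi> s0 + (\<Sum>s\<in>J - {s0}. fps_const (\<sigma> s) * \<Psi> s)"
      unfolding G_def using J by (simp add: sum.remove)
    have "fps_of_poly (W * P) = G * fps_of_poly P * fps_of_poly ?u"
      by (simp add: fps_of_poly_mult W[symmetric] mult_ac)
    also have "\<dots> = \<Psi> s0 * fps_of_poly U +
        (\<Sum>s\<in>J - {s0}. fps_const (\<sigma> s) * (\<Psi> s * fps_of_poly P)) * fps_of_poly ?u"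
      unfolding Gsplit U_def
      by (simp add: fps_of_poly_mult fps_of_poly_smult algebra_simps sum_distrib_left sum_distrib_right)
    also have "(\<Sum>s\<in>J - {s0}. fps_const (\<sigma> s) * (\<Psi> s * fps_of_poly P)) =
        fps_of_poly (\<Sum>s\<in>J - {s0}. Polynomial.smult (\<sigma> s) (H s))"
      using H by (simp add: fps_of_poly_sum fps_of_poly_smult)
    finally show ?thesis
      unfolding Q_def fps_of_poly_diff fps_of_poly_mult by (simp add: algebra_simps)
  qed
  then have "fps_const q * fps_X * fps_of_poly U * (Z * fps_of_poly ?e) = fps_of_poly Q * fps_of_poly ?e"
    unfolding \<Psi>0 by (simp add: mult_ac)
  then have "fps_of_poly ([:0, q:] * U) = fps_of_poly (Q * ?e)"
    unfolding Ze fps_of_poly_mult by (simp add: fps_of_poly_pCons mult_ac)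
  then have "[:0, q:] * U = Q * ?e" by (simp only: fps_of_poly_eq_iff)
  then have "poly ([:0, q:] * U) (1 / q) = poly (Q * ?e) (1 / q)" by simp
  then have "poly U (1 / q) = 0" using q by simp
  moreover have "poly ?u (1 / q) \<noteq> 0"
  proof -
    have "(1 / q) ^ N < 1" using power_strict_decreasing[of 0 N "1 / q"] q N(1) by simp
    then show ?thesis by (simp add: poly_monom)
  qed
  ultimately show False using Pq \<sigma> by (simp add: U_def)
qed

end

section \<open>Multisets stable under an injective self-map\<close>

text \<open>Abstracts the Frobenius map on an algebraic closure. Injectivity makes every orbit that
  stays in a finite set periodic from its first point on.\<close>

locale injective_self_map =
  fixes Om :: "'x set" and \<phi> :: "'x \<Rightarrow> 'x"
  assumes closed: "x \<in> Om \<Longrightarrow> \<phi> x \<in> Om" and inj: "inj_on \<phi> Om"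
begin

definition fixpts :: "nat \<Rightarrow> 'x set" where
  "fixpts j = {x \<in> Om. (\<phi> ^^ j) x = x}"

text \<open>If x has exact period d and d divides j, the orbit is traversed j/d times. For Frobenius
  this is the root multiset of the (j/d)-th power of the minimal polynomial of x, so the pairs (j,
  x) with x in \<open>fixpts j\<close> carry the weights of the von Mangoldt function.\<close>

definition orbit_mset :: "nat \<Rightarrow> 'x \<Rightarrow> 'x multiset" where
  "orbit_mset j x = mset (map (\<lambda>i. (\<phi> ^^ i) x) [0..<j])"

definition stable :: "'x multiset \<Rightarrow> bool" where
  "stable M \<longleftrightarrow> set_mset M \<subseteq> Om \<and> image_mset \<phi> M = M"

definition stable_of_size :: "nat \<Rightarrow> 'x multiset set" where
  "stable_of_size n = {M. stable M \<and> size M = n}"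

lemma funpow_closed: "x \<in> Om \<Longrightarrow> (\<phi> ^^ i) x \<in> Om"
  by (induction i) (auto simp: closed)

lemma funpow_cancel:
  assumes "x \<in> Om" "y \<in> Om" "(\<phi> ^^ i) x = (\<phi> ^^ i) y"
  shows "x = y"
  using assms(3)
proof (induction i)
  case (Suc i)
  then have "(\<phi> ^^ i) x = (\<phi> ^^ i) y"
    using inj funpow_closed assms(1,2) by (auto dest: inj_onD)
  then show ?case by (rule Suc.IH)
qed simp

lemma funpow_eq_imp_fixed:
  assumes "x \<in> Om" "i < j" "(\<phi> ^^ i) x = (\<phi> ^^ j) x"
  shows "(\<phi> ^^ (j - i)) x = x"
proof -
  have "(\<phi> ^^ i) ((\<phi> ^^ (j - i)) x) = (\<phi> ^^ i) x"
    using assms(2,3) by (metis add.commute comp_apply funpow_add le_add_diff_inverse2 less_imp_le)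
  then show ?thesis using funpow_cancel assms(1) funpow_closed by blast
qed

lemma funpow_period_mult: "(\<phi> ^^ d) x = x \<Longrightarrow> (\<phi> ^^ (d * k)) x = x"
  by (induction k) (simp_all add: funpow_add)

lemma exists_period:
  assumes "finite S" "x \<in> S" "S \<subseteq> Om" "\<And>y. y \<in> S \<Longrightarrow> \<phi> y \<in> S"
  shows "\<exists>d\<ge>1. (\<phi> ^^ d) x = x"
proof -
  have "(\<phi> ^^ i) x \<in> S" for i by (induction i) (use assms in auto)
  then have "range (\<lambda>i. (\<phi> ^^ i) x) \<subseteq> S" by blast
  then have "\<not> inj (\<lambda>i::nat. (\<phi> ^^ i) x)"
    using assms(1) finite_subset finite_imageD by blast
  then obtain i j :: nat where "i < j" "(\<phi> ^^ i) x = (\<phi> ^^ j) x"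
    unfolding inj_def by (metis linorder_neqE_nat)
  then show ?thesis
    using funpow_eq_imp_fixed assms(2,3) by (intro exI[of _ "j - i"]) auto
qed

lemma exists_minimal_period:
  assumes "x \<in> Om" "m \<ge> 1" "(\<phi> ^^ m) x = x"
  obtains d where "d \<ge> 1" "(\<phi> ^^ d) x = x" "\<And>j. (\<phi> ^^ j) x = x \<longleftrightarrow> d dvd j"
    "inj_on (\<lambda>i. (\<phi> ^^ i) x) {..<d}"
proof -
  define d where "d = (LEAST d. d \<ge> 1 \<and> (\<phi> ^^ d) x = x)"
  have d: "d \<ge> 1 \<and> (\<phi> ^^ d) x = x"
    unfolding d_def by (rule LeastI[of _ m]) (use assms in auto)
  have least: "d \<le> j" if "j \<ge> 1" "(\<phi> ^^ j) x = x" for j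
    unfolding d_def by (rule Least_le) (use that in auto)
  have "d dvd j" if "(\<phi> ^^ j) x = x" for j
  proof -
    have "(\<phi> ^^ (j mod d)) x = (\<phi> ^^ (j mod d)) ((\<phi> ^^ (d * (j div d))) x)"
      using d funpow_period_mult by simp
    also have "\<dots> = (\<phi> ^^ j) x" by (metis comp_apply funpow_add mod_mult_div_eq)
    finally have "(\<phi> ^^ (j mod d)) x = x" using that by simp
    moreover have "j mod d < d" using d by simp
    ultimately have "j mod d = 0" using least[of "j mod d"] by (cases "j mod d = 0") auto
    then show ?thesis by auto
  qed
  moreover have "(\<phi> ^^ j) x = x" if "d dvd j" for j
    using that d funpow_period_mult by (auto elim!: dvdE)
  moreover have "inj_on (\<lambda>i. (\<phi> ^^ i) x) {..<d}"
  proof (rule linorder_inj_onI)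
    fix i j assume "i < j" "i \<in> {..<d}" "j \<in> {..<d}"
    then show "(\<phi> ^^ i) x \<noteq> (\<phi> ^^ j) x"
      using funpow_eq_imp_fixed[OF assms(1), of i j] least[of "j - i"] by fastforce
  qed auto
  ultimately show ?thesis using that d by blast
qed

lemma orbit_mset_Suc: "orbit_mset (Suc j) x = add_mset ((\<phi> ^^ j) x) (orbit_mset j x)"
  by (simp add: orbit_mset_def)

text \<open>An orbit segment can be extended at its end or, after one shift by \<phi>, at its
  beginning. When x returns after j steps both extensions add x, and cancelling it shows that the
  segment is stable.\<close>

lemma orbit_mset_Suc': "orbit_mset (Suc j) x = add_mset x (image_mset \<phi> (orbit_mset j x))"
proof (induction j)
  case (Suc j)
  have "orbit_mset (Suc (Suc j)) x =
      add_mset ((\<phi> ^^ Suc j) x) (add_mset x (image_mset \<phi> (orbit_mset j x)))"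
    unfolding orbit_mset_Suc[of "Suc j"] Suc.IH ..
  then show ?case by (simp add: orbit_mset_Suc[of j])
qed (simp add: orbit_mset_def)

lemma size_orbit_mset [simp]: "size (orbit_mset j x) = j"
  by (simp add: orbit_mset_def)

lemma orbit_mset_add: "orbit_mset (i + j) x = orbit_mset i x + orbit_mset j ((\<phi> ^^ i) x)"
  by (induction j) (simp_all add: orbit_mset_Suc, simp_all add: orbit_mset_def funpow_add add.commute)

lemma stable_orbit_mset:
  assumes "x \<in> fixpts j"
  shows "stable (orbit_mset j x)"
proof -
  have "add_mset x (image_mset \<phi> (orbit_mset j x)) = add_mset x (orbit_mset j x)"
    using orbit_mset_Suc[of j x] orbit_mset_Suc'[of j x] assms by (simp add: fixpts_def)
  moreover have "set_mset (orbit_mset j x) \<subseteq> Om"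
    using assms funpow_closed by (auto simp: orbit_mset_def fixpts_def)
  ultimately show ?thesis by (simp add: stable_def)
qed

lemma stable_add: "stable M \<Longrightarrow> stable N \<Longrightarrow> stable (M + N)"
  by (auto simp: stable_def)

lemma stable_diff:
  assumes "stable M" "stable N" "N \<subseteq># M"
  shows "stable (M - N)"
  using assms by (auto simp: stable_def image_mset_Diff dest: in_diffD)

text \<open>By injectivity the fibre of \<phi> over \<phi> x is {x}, so the image multiset carries
  at \<phi> x exactly the multiplicity of x.\<close>

lemma count_stable:
  assumes "stable M" "x \<in> Om"
  shows "count M (\<phi> x) = count M x"
proof -
  have "count M (\<phi> x) = (\<Sum>y\<in>\<phi> -` {\<phi> x} \<inter> set_mset M. count M y)"
    using assms(1) by (metis count_image_mset stable_def)
  also have "\<phi> -` {\<phi> x} \<inter> set_mset M = {x} \<inter> set_mset M"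
    using assms inj by (auto simp: stable_def inj_on_def)
  also have "(\<Sum>y\<in>{x} \<inter> set_mset M. count M y) = count M x"
    by (cases "x \<in># M") (auto simp: not_in_iff)
  finally show ?thesis .
qed

lemma count_stable_funpow:
  assumes "stable M" "x \<in> Om"
  shows "count M ((\<phi> ^^ i) x) = count M x"
  by (induction i) (use assms count_stable funpow_closed in auto)

lemma orbit_mset_mult:
  assumes "(\<phi> ^^ d) x = x"
  shows "orbit_mset (d * k) x = repeat_mset k (orbit_mset d x)"
proof (induction k)
  case (Suc k)
  have "orbit_mset (d * Suc k) x = orbit_mset (d * k + d) x" by (simp add: add.commute)
  also have "\<dots> = repeat_mset (Suc k) (orbit_mset d x)"
    unfolding orbit_mset_add using Suc funpow_period_mult[OF assms] by simp
  finally show ?case .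
qed (simp add: orbit_mset_def)

lemma count_orbit_mset_period:
  assumes "inj_on (\<lambda>i. (\<phi> ^^ i) x) {..<d}"
  shows "count (orbit_mset d x) y = (if y \<in> (\<lambda>i. (\<phi> ^^ i) x) ` {..<d} then 1 else 0)"
proof -
  have "distinct (map (\<lambda>i. (\<phi> ^^ i) x) [0..<d])"
    using assms by (simp add: distinct_map atLeast0LessThan)
  then show ?thesis
    unfolding orbit_mset_def by (auto simp: distinct_count_atmost_1 atLeast0LessThan)
qed

text \<open>The periods of x are the multiples d k of its exact period d, and d k steps give k
  copies of a multiplicity-free orbit. As the multiplicities in M are constant along this orbit, k
  copies fit exactly when k is at most the multiplicity of x.\<close>

lemma card_orbits_within_stable:
  assumes "stable M" "x \<in># M"
  shows "card {j. j \<ge> 1 \<and> x \<in> fixpts j \<and> orbit_mset j x \<subseteq># M} = count M x"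
proof -
  have x: "x \<in> Om" using assms by (auto simp: stable_def)
  have "\<phi> y \<in> set_mset M" if "y \<in># M" for y
    using that assms(1) by (metis image_eqI set_image_mset stable_def)
  then obtain m where "m \<ge> 1" "(\<phi> ^^ m) x = x"
    using exists_period[of "set_mset M" x] assms by (auto simp: stable_def)
  then obtain d where d: "d \<ge> 1" "(\<phi> ^^ d) x = x" "\<And>j. (\<phi> ^^ j) x = x \<longleftrightarrow> d dvd j"
    "inj_on (\<lambda>i. (\<phi> ^^ i) x) {..<d}"
    using exists_minimal_period[OF x] by blast
  have sub: "orbit_mset (d * k) x \<subseteq># M \<longleftrightarrow> k \<le> count M x" for k
  proof
    assume "orbit_mset (d * k) x \<subseteq># M"
    then have "count (orbit_mset (d * k) x) x \<le> count M x" by (rule mset_subset_eq_count)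
    moreover have "count (orbit_mset d x) x = 1"
      using d(1) by (auto simp: count_orbit_mset_period[OF d(4)] intro!: image_eqI[of _ _ 0])
    ultimately show "k \<le> count M x" by (simp add: orbit_mset_mult[OF d(2)])
  next
    assume k: "k \<le> count M x"
    show "orbit_mset (d * k) x \<subseteq># M"
    proof (rule mset_subset_eqI)
      fix y
      show "count (orbit_mset (d * k) x) y \<le> count M y"
        using k count_stable_funpow[OF assms(1) x]
        by (auto simp: orbit_mset_mult[OF d(2)] count_orbit_mset_period[OF d(4)])
    qed
  qed
  have "{j. j \<ge> 1 \<and> x \<in> fixpts j \<and> orbit_mset j x \<subseteq># M} = (\<lambda>k. d * k) ` {1..count M x}"
    using d(1) x sub by (fastforce simp: fixpts_def d(3) elim!: dvdE)
  also have "card \<dots> = count M x"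
    using d(1) by (subst card_image) (auto simp: inj_on_def)
  finally show ?thesis .
qed

text \<open>The set counted here records the prime power divisors of \<open>M\<close>: an orbit of length \<open>d\<close>
  contributes its \<open>d\<close> elements for every power dividing \<open>M\<close>. This is the identity
  \<open>deg = 1 * \<Lambda>\<close> for the von Mangoldt function.\<close>
lemma card_pointed_orbits_within_stable:
  assumes "stable M"
  shows "card {(j, x). j \<in> {1..size M} \<and> x \<in> fixpts j \<and> orbit_mset j x \<subseteq># M} = size M"
proof -
  let ?J = "\<lambda>x. {j. j \<ge> 1 \<and> x \<in> fixpts j \<and> orbit_mset j x \<subseteq># M}"
  have mem: "x \<in># M" if "j \<ge> 1" "orbit_mset j x \<subseteq># M" for j x
  proof -
    have "x \<in># orbit_mset j x"
      using that(1) by (auto simp: orbit_mset_def intro!: image_eqI[of _ _ 0])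
    then show ?thesis using that(2) by (meson mset_subset_eqD)
  qed
  have "{(j, x). j \<in> {1..size M} \<and> x \<in> fixpts j \<and> orbit_mset j x \<subseteq># M}
      = prod.swap ` (SIGMA x:set_mset M. ?J x)"
    using mem size_mset_mono[of "orbit_mset _ _" M] by (fastforce simp: image_iff)
  then have "card {(j, x). j \<in> {1..size M} \<and> x \<in> fixpts j \<and> orbit_mset j x \<subseteq># M}
      = card (SIGMA x:set_mset M. ?J x)" by (simp add: card_image)
  also have "\<dots> = (\<Sum>x\<in>set_mset M. card (?J x))"
  proof (rule card_SigmaI)
    show "\<forall>x\<in>set_mset M. finite (?J x)"
    proof
      fix x assume "x \<in># M"
      then have "card (?J x) > 0" using card_orbits_within_stable[OF assms] by simp
      then show "finite (?J x)" by (rule card_ge_0_finite)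
    qed
  qed simp
  also have "\<dots> = size M"
    using card_orbits_within_stable[OF assms] by (simp add: size_multiset_overloaded_eq)
  finally show ?thesis .
qed

text \<open>Double counting of the pairs of a stable M of size n and a pointed orbit (j, x) inside
  M, weighted by \<chi> M. Each M occurs n times; removing the orbit leaves an arbitrary stable
  multiset of size n - j, and multiplicativity splits the weight. This gives the logarithmic
  derivative of the Euler product without writing the product down.\<close>

lemma log_derivative_recurrence:
  fixes \<chi> :: "'x multiset \<Rightarrow> real"
  assumes mult: "\<And>M N. stable M \<Longrightarrow> stable N \<Longrightarrow> \<chi> (M + N) = \<chi> M * \<chi> N"
    and finF: "\<And>j. j \<ge> 1 \<Longrightarrow> finite (fixpts j)"
    and finW: "\<And>n. finite (stable_of_size n)"
  shows "real n * (\<Sum>M\<in>stable_of_size n. \<chi> M) =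
    (\<Sum>j=1..n. (\<Sum>x\<in>fixpts j. \<chi> (orbit_mset j x)) * (\<Sum>M\<in>stable_of_size (n - j). \<chi> M))"
proof -
  let ?T = "\<lambda>M. {(j, x). j \<in> {1..n} \<and> x \<in> fixpts j \<and> orbit_mset j x \<subseteq># M}"
  have finT: "finite (?T M)" for M
    by (rule finite_subset[of _ "SIGMA j:{1..n}. fixpts j"]) (use finF in auto)
  have "real n * (\<Sum>M\<in>stable_of_size n. \<chi> M) = (\<Sum>M\<in>stable_of_size n. \<Sum>t\<in>?T M. \<chi> M)"
    unfolding sum_distrib_left
    by (rule sum.cong)
      (use card_pointed_orbits_within_stable in \<open>auto simp: stable_of_size_def\<close>)
  also have "\<dots> = (\<Sum>(M, t)\<in>(SIGMA M:stable_of_size n. ?T M). \<chi> M)"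
    by (rule sum.Sigma) (use finW finT in auto)
  also have "\<dots> = (\<Sum>(j, x, N)\<in>(SIGMA j:{1..n}. SIGMA x:fixpts j. stable_of_size (n - j)).
      \<chi> (orbit_mset j x) * \<chi> N)"
  proof (rule sum.reindex_bij_witness[where
        i = "\<lambda>(j, x, N). (orbit_mset j x + N, j, x)" and
        j = "\<lambda>(M, j, x). (j, x, M - orbit_mset j x)"], goal_cases)
    case (1 a) then show ?case by auto
  next
    case (2 a)
    then show ?case
      using stable_diff stable_orbit_mset by (auto simp: stable_of_size_def size_Diff_submset)
  next
    case (3 b) then show ?case by auto
  next
    case (4 b)
    then show ?case
      using stable_add stable_orbit_mset by (auto simp: stable_of_size_def)
  next
    case (5 a)
    obtain M j x where a: "a = (M, j, x)" by (cases a)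
    have "\<chi> M = \<chi> (orbit_mset j x + (M - orbit_mset j x))" using 5 a by simp
    also have "\<dots> = \<chi> (orbit_mset j x) * \<chi> (M - orbit_mset j x)"
      by (rule mult) (use 5 a stable_diff stable_orbit_mset in \<open>auto simp: stable_of_size_def\<close>)
    finally show ?case using a by simp
  qed
  also have "\<dots> = (\<Sum>j=1..n. \<Sum>(x, N)\<in>fixpts j \<times> stable_of_size (n - j).
      \<chi> (orbit_mset j x) * \<chi> N)"
    by (subst sum.Sigma) (use finF finW in auto)
  also have "\<dots> = (\<Sum>j=1..n. (\<Sum>x\<in>fixpts j. \<chi> (orbit_mset j x)) *
      (\<Sum>M\<in>stable_of_size (n - j). \<chi> M))"
    by (simp add: sum_product sum.cartesian_product)
  finally show ?thesis .
qed

end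

section \<open>Products over multisets and monic split polynomials\<close>

definition (in comm_monoid) mprod :: "('i \<Rightarrow> 'a) \<Rightarrow> 'i multiset \<Rightarrow> 'a" where
  "mprod f M = (\<Otimes>i\<in>set_mset M. f i [^] count M i)"

context comm_monoid
begin

lemma mprod_empty [simp]: "mprod f {#} = \<one>"
  by (simp add: mprod_def)

lemma mprod_closed [intro]: "f \<in> set_mset M \<rightarrow> carrier G \<Longrightarrow> mprod f M \<in> carrier G"
  unfolding mprod_def by (intro finprod_closed) auto

lemma mprod_add_mset:
  assumes "f \<in> set_mset (add_mset i M) \<rightarrow> carrier G"
  shows "mprod f (add_mset i M) = f i \<otimes> mprod f M"
proof -
  let ?R = "set_mset M - {i}"
  have f: "f i \<in> carrier G" "f \<in> ?R \<rightarrow> carrier G" using assms by auto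
  have rest: "(\<Otimes>k\<in>?R. f k [^] count (add_mset i M) k) = (\<Otimes>k\<in>?R. f k [^] count M k)"
    by (rule finprod_cong') (use f in auto)
  have "mprod f (add_mset i M) = (\<Otimes>k\<in>insert i ?R. f k [^] count (add_mset i M) k)"
    by (simp add: mprod_def)
  also have "\<dots> = f i [^] Suc (count M i) \<otimes> (\<Otimes>k\<in>?R. f k [^] count M k)"
    using f rest by (subst finprod_insert) auto
  also have "\<dots> = f i \<otimes> (f i [^] count M i \<otimes> (\<Otimes>k\<in>?R. f k [^] count M k))"
  proof -
    have "(\<Otimes>k\<in>?R. f k [^] count M k) \<in> carrier G" using f by (intro finprod_closed) auto
    then show ?thesis using f nat_pow_comm[of "f i" "count M i" 1] by (simp flip: m_assoc)
  qed
  also have "f i [^] count M i \<otimes> (\<Otimes>k\<in>?R. f k [^] count M k) = mprod f M"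
  proof (cases "i \<in># M")
    case True
    then have "mprod f M = (\<Otimes>k\<in>insert i ?R. f k [^] count M k)"
      by (simp add: mprod_def insert_absorb)
    then show ?thesis using f by (subst (asm) finprod_insert) auto
  next
    case False
    then have "count M i = 0" "?R = set_mset M" by (auto simp: not_in_iff)
    moreover have "(\<Otimes>k\<in>?R. f k [^] count M k) \<in> carrier G" using f by (intro finprod_closed) auto
    ultimately show ?thesis by (simp add: mprod_def)
  qed
  finally show ?thesis .
qed

lemma mprod_cong:
  assumes "\<And>i. i \<in># M \<Longrightarrow> f i = g i" "g \<in> set_mset M \<rightarrow> carrier G"
  shows "mprod f M = mprod g M"
  unfolding mprod_def by (rule finprod_cong') (use assms in auto)

lemma mprod_one: "(\<And>i. i \<in># M \<Longrightarrow> f i = \<one>) \<Longrightarrow> mprod f M = \<one>"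
  unfolding mprod_def by (subst finprod_cong'[of _ _ "\<lambda>_. \<one>"]) (auto simp: finprod_one_eqI)

lemma mprod_union:
  assumes "f \<in> set_mset (M + N) \<rightarrow> carrier G"
  shows "mprod f (M + N) = mprod f M \<otimes> mprod f N"
  using assms
proof (induction M)
  case (add i M)
  then have "f i \<in> carrier G" "mprod f M \<in> carrier G" "mprod f N \<in> carrier G" by auto
  then show ?case using add by (simp add: mprod_add_mset m_assoc)
qed (simp add: mprod_closed)

lemma mprod_image:
  assumes "f \<in> g ` set_mset M \<rightarrow> carrier G"
  shows "mprod f (image_mset g M) = mprod (\<lambda>i. f (g i)) M"
  using assms
proof (induction M)
  case (add i M)
  then have "(\<lambda>i. f (g i)) \<in> set_mset (add_mset i M) \<rightarrow> carrier G" by auto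
  then show ?case using add by (simp add: mprod_add_mset[where f = f] mprod_add_mset)
qed simp

lemma mprod_mult:
  assumes "f \<in> set_mset M \<rightarrow> carrier G" "g \<in> set_mset M \<rightarrow> carrier G"
  shows "mprod (\<lambda>i. f i \<otimes> g i) M = mprod f M \<otimes> mprod g M"
  using assms
proof (induction M)
  case (add i M)
  then have "f i \<in> carrier G" "g i \<in> carrier G" "mprod f M \<in> carrier G" "mprod g M \<in> carrier G"
    "(\<lambda>i. f i \<otimes> g i) \<in> set_mset (add_mset i M) \<rightarrow> carrier G"
    by auto
  then show ?case using add by (simp add: mprod_add_mset m_ac)
qed simp

lemma mprod_const: "c \<in> carrier G \<Longrightarrow> mprod (\<lambda>_. c) M = c [^] size M"
proof (induction M)
  case (add i M)
  then show ?case using m_comm[of c "c [^] size M"] by (simp add: mprod_add_mset)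
qed simp

text \<open>For differences of two families of roots this computes their resultant from either side;
  reciprocity rests on it.\<close>

lemma mprod_swap:
  assumes "\<And>i j. i \<in># M \<Longrightarrow> j \<in># N \<Longrightarrow> f i j \<in> carrier G"
  shows "mprod (\<lambda>i. mprod (f i) N) M = mprod (\<lambda>j. mprod (\<lambda>i. f i j) M) N"
  using assms
proof (induction M)
  case empty
  then show ?case by (simp add: mprod_one)
next
  case (add i M)
  have "mprod (\<lambda>j. mprod (\<lambda>i. f i j) (add_mset i M)) N = mprod (\<lambda>j. f i j \<otimes> mprod (\<lambda>i. f i j) M) N"
    by (rule mprod_cong) (use add.prems in \<open>auto simp: mprod_add_mset\<close>)
  also have "\<dots> = mprod (f i) N \<otimes> mprod (\<lambda>j. mprod (\<lambda>i. f i j) M) N"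
    by (rule mprod_mult) (use add.prems in auto)
  also have "\<dots> = mprod (\<lambda>i. mprod (f i) N) (add_mset i M)"
    using add by (subst mprod_add_mset) auto
  finally show ?case by simp
qed

lemma mprod_repeat:
  assumes "f \<in> set_mset M \<rightarrow> carrier G"
  shows "mprod f (repeat_mset c M) = mprod f M [^] c"
proof (induction c)
  case (Suc c)
  have "set_mset (repeat_mset c M) \<subseteq> set_mset M" by (auto simp flip: count_greater_zero_iff)
  then have "f \<in> set_mset (M + repeat_mset c M) \<rightarrow> carrier G" using assms by auto
  then have "mprod f (repeat_mset (Suc c) M) = mprod f M \<otimes> mprod f (repeat_mset c M)"
    by (simp add: mprod_union)
  then show ?case using Suc assms by (simp add: m_comm mprod_closed)
qed simp

end

lemma (in cring) mprod_hom:
  assumes "h \<in> ring_hom R R" "f \<in> set_mset M \<rightarrow> carrier R"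
  shows "h (mprod f M) = mprod (\<lambda>i. h (f i)) M"
  using assms(2)
proof (induction M)
  case empty
  then show ?case using ring_hom_one[OF assms(1)] by simp
next
  case (add i M)
  then have "f i \<in> carrier R" "mprod f M \<in> carrier R" by auto
  then show ?case
    using add ring_hom_mult[OF assms(1)] ring_hom_closed[OF assms(1)]
    by (subst (1 2) mprod_add_mset) auto
qed

lemma (in domain) mprod_eq_zero_iff:
  assumes "f \<in> set_mset M \<rightarrow> carrier R"
  shows "mprod f M = \<zero> \<longleftrightarrow> (\<exists>i\<in>#M. f i = \<zero>)"
  using assms
proof (induction M)
  case (add i M)
  then have "f i \<in> carrier R" "mprod f M \<in> carrier R" by auto
  then show ?case using add by (simp add: mprod_add_mset integral_iff)
qed simp

text \<open>Coefficient lists start with the leading coefficient, so the shorter list is padded in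
  front and leaves the head alone. As the head is nonzero, normalization removes nothing.\<close>

lemma (in ring) hd_poly_add_longer:
  assumes "set p \<subseteq> carrier R" "hd p \<noteq> \<zero>" "length r < length p"
  shows "hd (poly_add p r) = hd p" "length (poly_add p r) = length p"
proof -
  obtain a p' where p: "p = a # p'" using assms(3) by (cases p) auto
  obtain n where n: "length p - length r = Suc n" using assms(3) by (metis Suc_diff_Suc)
  have "poly_add p r = normalize (map2 (\<oplus>) p (replicate (length p - length r) \<zero> @ r))"
    using assms(3) by simp
  also have "\<dots> = a # map2 (\<oplus>) p' (replicate n \<zero> @ r)"
    unfolding n using p assms by simp
  finally have eq: "poly_add p r = a # map2 (\<oplus>) p' (replicate n \<zero> @ r)" .
  show "hd (poly_add p r) = hd p" by (subst eq) (simp add: p)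
  show "length (poly_add p r) = length p"
    by (subst eq) (use p n assms(3) in simp)
qed

section \<open>Monic polynomials and their root multisets\<close>

context field
begin

lemma poly_eval_hom:
  "x \<in> carrier R \<Longrightarrow> (\<lambda>p. eval p x) \<in> ring_hom (poly_ring R) R"
  by (rule eval_is_hom[OF carrier_is_subring])

lemma set_poly_subset: "p \<in> carrier (poly_ring R) \<Longrightarrow> set p \<subseteq> carrier R"
  using univ_poly_carrier polynomial_incl by blast

lemma poly_ring_memI: "set p \<subseteq> carrier R \<Longrightarrow> hd p \<noteq> \<zero> \<Longrightarrow> p \<in> carrier (poly_ring R)"
  using univ_poly_carrier polynomialI by blast

lemma linear_mult_props:
  assumes "a \<in> carrier R" "p \<in> carrier (poly_ring R)" "p \<noteq> []"
  shows "[\<one>, \<ominus> a] \<otimes>\<^bsub>poly_ring R\<^esub> p \<in> carrier (poly_ring R)"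
    and "length ([\<one>, \<ominus> a] \<otimes>\<^bsub>poly_ring R\<^esub> p) = Suc (length p)"
    and "hd ([\<one>, \<ominus> a] \<otimes>\<^bsub>poly_ring R\<^esub> p) = hd p"
    and "x \<in> carrier R \<Longrightarrow> eval ([\<one>, \<ominus> a] \<otimes>\<^bsub>poly_ring R\<^esub> p) x = (x \<ominus> a) \<otimes> eval p x"
    and "roots ([\<one>, \<ominus> a] \<otimes>\<^bsub>poly_ring R\<^esub> p) = add_mset a (roots p)"
proof -
  interpret UP: domain "poly_ring R" by (rule univ_poly_is_domain[OF carrier_is_subring])
  have lin: "[\<one>, \<ominus> a] \<in> carrier (poly_ring R)"
    using assms(1) by (intro poly_ring_memI) auto
  then show "[\<one>, \<ominus> a] \<otimes>\<^bsub>poly_ring R\<^esub> p \<in> carrier (poly_ring R)" using assms by simp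
  have pol: "polynomial (carrier R) [\<one>, \<ominus> a]" "polynomial (carrier R) p"
    using lin assms univ_poly_carrier by blast+
  have nz: "[\<one>, \<ominus> a] \<otimes>\<^bsub>poly_ring R\<^esub> p \<noteq> []"
    using UP.integral_iff[OF lin assms(2)] assms(3) by (simp add: univ_poly_zero)
  have "length (poly_mult [\<one>, \<ominus> a] p) - 1 = (length [\<one>, \<ominus> a] - 1) + (length p - 1)"
    using poly_mult_degree_eq[OF carrier_is_subring pol] assms(3) by simp
  then show "length ([\<one>, \<ominus> a] \<otimes>\<^bsub>poly_ring R\<^esub> p) = Suc (length p)"
    using assms(3) nz unfolding univ_poly_mult by (cases p; cases "poly_mult [\<one>, \<ominus> a] p") auto
  have "hd p \<in> carrier R" using set_poly_subset[OF assms(2)] assms(3) by (cases p) auto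
  then show "hd ([\<one>, \<ominus> a] \<otimes>\<^bsub>poly_ring R\<^esub> p) = hd p"
    using poly_mult_lead_coeff[OF carrier_is_subring pol] assms(3) by (simp add: univ_poly_mult)
  show "roots ([\<one>, \<ominus> a] \<otimes>\<^bsub>poly_ring R\<^esub> p) = add_mset a (roots p)"
    by (rule poly_mult_degree_one_monic_imp_same_roots[OF assms])
  assume x: "x \<in> carrier R"
  show "eval ([\<one>, \<ominus> a] \<otimes>\<^bsub>poly_ring R\<^esub> p) x = (x \<ominus> a) \<otimes> eval p x"
    using ring_hom_mult[OF poly_eval_hom[OF x] lin assms(2)] x assms(1)
    by (simp add: a_minus_def)
qed

definition monic_split :: "'a list \<Rightarrow> bool" where
  "monic_split p \<longleftrightarrow> p \<in> carrier (poly_ring R) \<and> p \<noteq> [] \<and> hd p = \<one> \<and> splitted p"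

lemma monic_split_one: "monic_split [\<one>]" and roots_one: "roots [\<one>] = {#}"
proof -
  have "[\<one>] \<in> carrier (poly_ring R)" by (rule poly_ring_memI) auto
  then show "monic_split [\<one>]" "roots [\<one>] = {#}"
    using degree_zero_imp_splitted[of "[\<one>]"] degree_zero_imp_empty_roots[of "[\<one>]"]
    by (auto simp: monic_split_def)
qed

lemma monic_split_linear_mult:
  assumes "a \<in> carrier R" "monic_split p"
  shows "monic_split ([\<one>, \<ominus> a] \<otimes>\<^bsub>poly_ring R\<^esub> p)"
proof -
  have p: "p \<in> carrier (poly_ring R)" "p \<noteq> []" using assms(2) by (auto simp: monic_split_def)
  note * = linear_mult_props[OF assms(1) p]
  have "[\<one>, \<ominus> a] \<otimes>\<^bsub>poly_ring R\<^esub> p \<noteq> []" using *(2) by (metis list.size(3) nat.distinct(1))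
  then show ?thesis
    using *(1,2,3,5) assms(2) p(2)
    by (cases p) (auto simp: monic_split_def splitted_def)
qed

lemma is_root_imp_linear_factor:
  assumes "p \<in> carrier (poly_ring R)" "is_root p a"
  obtains r where "r \<in> carrier (poly_ring R)" "r \<noteq> []" "p = [\<one>, \<ominus> a] \<otimes>\<^bsub>poly_ring R\<^esub> r"
proof -
  interpret UP: domain "poly_ring R" by (rule univ_poly_is_domain[OF carrier_is_subring])
  have a: "a \<in> carrier R" "p \<noteq> []" using assms(2) by (auto simp: is_root_def)
  obtain r where r: "r \<in> carrier (poly_ring R)" "p = [\<one>, \<ominus> a] \<otimes>\<^bsub>poly_ring R\<^esub> r"
    using is_root_imp_pdivides[OF assms] unfolding pdivides_def factor_def by auto
  have "[\<one>, \<ominus> a] \<in> carrier (poly_ring R)" using a by (intro poly_ring_memI) auto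
  then have "r \<noteq> []" using r(2) a(2) UP.r_null by (auto simp: univ_poly_zero)
  with r that show ?thesis by blast
qed

text \<open>While the root multiset is nonempty a linear factor can be split off, and the cofactor
  is again monic and split because \<open>roots\<close> loses exactly one element.\<close>

lemma monic_split_induct [consumes 1, case_names one mult]:
  assumes "monic_split p" "Q [\<one>]"
    and step: "\<And>a p. a \<in> carrier R \<Longrightarrow> monic_split p \<Longrightarrow> Q p \<Longrightarrow> Q ([\<one>, \<ominus> a] \<otimes>\<^bsub>poly_ring R\<^esub> p)"
  shows "Q p"
  using assms(1)
proof (induction "length p" arbitrary: p)
  case 0 then show ?case by (simp add: monic_split_def)
next
  case (Suc n)
  then have p: "p \<in> carrier (poly_ring R)" "p \<noteq> []" "hd p = \<one>" "size (roots p) = n"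
    by (auto simp: monic_split_def splitted_def)
  show ?case
  proof (cases "n = 0")
    case True
    then have "p = [\<one>]" using Suc(2) p by (cases p) auto
    then show ?thesis using assms(2) by simp
  next
    case False
    then obtain a where "a \<in># roots p" using p(4) by (metis size_eq_0_iff_empty multiset_nonemptyE)
    then have root: "is_root p a" using roots_mem_iff_is_root[OF p(1)] by simp
    then have a: "a \<in> carrier R" by (simp add: is_root_def)
    obtain r where r: "r \<in> carrier (poly_ring R)" "p = [\<one>, \<ominus> a] \<otimes>\<^bsub>poly_ring R\<^esub> r" "r \<noteq> []"
      using is_root_imp_linear_factor[OF p(1) root] by blast
    note * = linear_mult_props[OF a r(1,3)]
    have "monic_split r"
      using *(2,3,5) p r Suc(2) by (auto simp: monic_split_def splitted_def)
    moreover from this have "Q r" using Suc(1)[of r] Suc(2) *(2) r(2) by simp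
    ultimately show ?thesis using step[OF a] r(2) by simp
  qed
qed

lemma length_monic_split: "monic_split p \<Longrightarrow> length p = Suc (size (roots p))"
  by (cases p) (auto simp: monic_split_def splitted_def)

lemma roots_carrier: "p \<in> carrier (poly_ring R) \<Longrightarrow> set_mset (roots p) \<subseteq> carrier R"
  using roots_mem_iff_is_root by (auto simp: is_root_def)

lemma eval_monic_split:
  assumes "monic_split p" "x \<in> carrier R"
  shows "eval p x = mprod (\<lambda>\<alpha>. x \<ominus> \<alpha>) (roots p)"
  using assms(1)
proof (induction rule: monic_split_induct)
  case one
  show ?case using assms(2) by (simp add: roots_one)
next
  case (mult a p)
  then have p: "p \<in> carrier (poly_ring R)" "p \<noteq> []" by (auto simp: monic_split_def)
  have "(\<lambda>\<alpha>. x \<ominus> \<alpha>) \<in> set_mset (add_mset a (roots p)) \<rightarrow> carrier R"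
    using roots_carrier[OF p(1)] mult(1) assms(2) by auto
  then show ?case
    using linear_mult_props(4,5)[OF mult(1) p] mult assms(2) by (simp add: mprod_add_mset)
qed

lemma exists_monic_split:
  assumes "set_mset M \<subseteq> carrier R"
  shows "\<exists>p. monic_split p \<and> roots p = M"
  using assms
proof (induction M)
  case empty
  show ?case using monic_split_one roots_one by blast
next
  case (add a M)
  then obtain p where p: "monic_split p" "roots p = M" by auto
  moreover have "a \<in> carrier R" using add by simp
  ultimately show ?case
    using monic_split_linear_mult[of a p] linear_mult_props(5)[of a p]
    by (auto simp: monic_split_def)
qed

lemma monic_split_unique:
  assumes "monic_split p" "monic_split r" "roots p = roots r"
  shows "p = r"
  using assms
proof (induction arbitrary: r rule: monic_split_induct)
  case one
  then have "length r = 1" using length_monic_split by (simp add: roots_one)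
  then show ?case using one by (cases r) (auto simp: monic_split_def)
next
  case (mult a p)
  have r: "r \<in> carrier (poly_ring R)" "r \<noteq> []" using mult by (auto simp: monic_split_def)
  have p: "p \<in> carrier (poly_ring R)" "p \<noteq> []" using mult by (auto simp: monic_split_def)
  have rr: "roots r = add_mset a (roots p)" using linear_mult_props(5)[OF mult(1) p] mult by simp
  then have "is_root r a" using roots_mem_iff_is_root[OF r(1), of a] by simp
  then obtain s where s: "s \<in> carrier (poly_ring R)" "r = [\<one>, \<ominus> a] \<otimes>\<^bsub>poly_ring R\<^esub> s" "s \<noteq> []"
    using is_root_imp_linear_factor[OF r(1)] by blast
  note * = linear_mult_props[OF mult(1) s(1,3)]
  have "monic_split s"
    using *(2,3,5) s r mult by (auto simp: monic_split_def splitted_def)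
  moreover have "roots p = roots s" using *(5) s(2) rr by simp
  ultimately show ?case using mult.IH s(2) by blast
qed

section \<open>Uniqueness and existence of interpolation polynomials\<close>

lemma card_zeros_less_length:
  assumes "p \<in> carrier (poly_ring R)" "finite Z" "Z \<subseteq> carrier R" "\<And>z. z \<in> Z \<Longrightarrow> eval p z = \<zero>"
    "length p \<le> card Z"
  shows "p = []"
proof (rule ccontr)
  assume ne: "p \<noteq> []"
  have "Z \<subseteq> set_mset (roots p)"
    using assms roots_mem_iff_is_root[OF assms(1)] ne by (auto simp: is_root_def)
  then have "mset_set Z \<subseteq># roots p"
    using assms(2) by (intro mset_subset_eqI) (auto simp: count_mset_set')
  then have "card Z \<le> size (roots p)" using size_mset_mono by fastforce
  also have "\<dots> \<le> length p - 1" by (rule size_roots_le_degree[OF assms(1)])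
  finally show False using assms(5) ne by (cases p) auto
qed

lemma poly_determined_by_values:
  assumes "p \<in> carrier (poly_ring R)" "r \<in> carrier (poly_ring R)" "finite Z" "Z \<subseteq> carrier R"
    "\<And>z. z \<in> Z \<Longrightarrow> eval p z = eval r z" "length p \<le> card Z" "length r \<le> card Z"
  shows "p = r"
proof -
  interpret UP: domain "poly_ring R" by (rule univ_poly_is_domain[OF carrier_is_subring])
  have len: "length (\<ominus>\<^bsub>poly_ring R\<^esub> r) = length r"
    using univ_poly_a_inv_length[OF carrier_is_subring assms(2)] by simp
  have "p \<ominus>\<^bsub>poly_ring R\<^esub> r = []"
  proof (rule card_zeros_less_length[OF _ assms(3,4)])
    show "eval (p \<ominus>\<^bsub>poly_ring R\<^esub> r) z = \<zero>" if z: "z \<in> Z" for z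
    proof -
      have zc: "z \<in> carrier R" using z assms(4) by auto
      interpret h: ring_hom_ring "poly_ring R" R "\<lambda>p. eval p z"
        by (rule ring_hom_ringI2[OF UP.ring_axioms ring_axioms poly_eval_hom[OF zc]])
      show ?thesis
        using assms(1,2,5) z by (simp add: a_minus_def)
          (metis h.hom_closed r_neg)
    qed
    show "length (p \<ominus>\<^bsub>poly_ring R\<^esub> r) \<le> card Z"
      unfolding a_minus_def univ_poly_add
      using poly_add_length_le[of p "\<ominus>\<^bsub>poly_ring R\<^esub> r"] len assms(6,7) by simp
  qed (use assms in simp)
  then have "p \<ominus>\<^bsub>poly_ring R\<^esub> r = \<zero>\<^bsub>poly_ring R\<^esub>" by (simp add: univ_poly_zero)
  then show ?thesis using assms by simp
qed

text \<open>Newton interpolation: the polynomial for the old nodes is corrected by a multiple of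
  \<open>w\<close>, the product of the linear factors at those nodes. A length is a degree plus one,
  so the bound says that the degree is below the number of nodes.\<close>

lemma exists_interpolation:
  assumes "finite Z" "Z \<subseteq> carrier R" "\<And>z. z \<in> Z \<Longrightarrow> v z \<in> carrier R"
  shows "\<exists>p\<in>carrier (poly_ring R). length p \<le> card Z \<and> (\<forall>z\<in>Z. eval p z = v z)"
  using assms
proof (induction Z rule: finite_induct)
  case empty
  show ?case by (rule bexI[of _ "[]"]) (simp_all add: univ_poly_zero_closed)
next
  case (insert z Z)
  then obtain p where p: "p \<in> carrier (poly_ring R)" "length p \<le> card Z" "\<forall>z\<in>Z. eval p z = v z"
    by auto
  interpret UP: domain "poly_ring R" by (rule univ_poly_is_domain[OF carrier_is_subring])
  have zc: "z \<in> carrier R" "v z \<in> carrier R" using insert.prems by auto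
  obtain w where w: "monic_split w" "roots w = mset_set Z"
    using exists_monic_split[of "mset_set Z"] insert by auto
  have wc: "w \<in> carrier (poly_ring R)" using w(1) by (simp add: monic_split_def)
  have lw: "length w = Suc (card Z)" using length_monic_split[OF w(1)] w(2) by simp
  have ew: "eval w y = mprod (\<lambda>\<alpha>. y \<ominus> \<alpha>) (mset_set Z)" if "y \<in> carrier R" for y
    using eval_monic_split[OF w(1) that] w(2) by simp
  have maps: "(\<lambda>\<alpha>. y \<ominus> \<alpha>) \<in> set_mset (mset_set Z) \<rightarrow> carrier R" if "y \<in> carrier R" for y
    using that insert by auto
  have w0: "eval w y = \<zero>" if "y \<in> Z" for y
  proof -
    have "y \<in> carrier R" using that insert.prems by auto
    then show ?thesis
      using that mprod_eq_zero_iff[OF maps] ew insert.hyps(1) by (auto intro!: bexI[of _ y])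
  qed
  have wz: "eval w z \<noteq> \<zero>"
  proof
    assume "eval w z = \<zero>"
    then obtain y where "y \<in> Z" "z \<ominus> y = \<zero>"
      using mprod_eq_zero_iff[OF maps[OF zc(1)]] ew[OF zc(1)] insert.hyps(1) by auto
    then show False using insert zc by auto
  qed
  have wzc: "eval w z \<in> carrier R" "eval p z \<in> carrier R"
    using set_poly_subset wc p(1) zc eval_in_carrier by auto
  \<comment> \<open>The multiple of \<open>w\<close> that repairs the value at the new node z; w(z)
    is invertible because z is not among the old nodes.\<close>
  define e where "e = (v z \<ominus> eval p z) \<otimes> inv (eval w z)"
  have inv: "inv (eval w z) \<in> carrier R" "inv (eval w z) \<otimes> eval w z = \<one>"
    using wz wzc field_Units by auto
  have ec: "e \<in> carrier R" unfolding e_def using wzc inv zc by simp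
  define c where "c = poly_of_const e"
  have cc: "c \<in> carrier (poly_ring R)"
    using ring_hom_closed[OF canonical_embedding_is_hom[OF carrier_is_subring]] ec
    unfolding c_def by fastforce
  have cev: "eval c y = e" if "y \<in> carrier R" for y
    unfolding c_def poly_of_const_def using ec that by auto
  define r where "r = p \<oplus>\<^bsub>poly_ring R\<^esub> (c \<otimes>\<^bsub>poly_ring R\<^esub> w)"
  have ev: "eval r y = eval p y \<oplus> e \<otimes> eval w y" if "y \<in> carrier R" for y
    unfolding r_def
    using ring_hom_add[OF poly_eval_hom[OF that]] ring_hom_mult[OF poly_eval_hom[OF that]] p(1) cc wc
      cev[OF that] by simp
  have lcw: "length (c \<otimes>\<^bsub>poly_ring R\<^esub> w) \<le> length w"
  proof (cases "e = \<zero>")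
    case True
    then have "c = []" by (simp add: c_def poly_of_const_def)
    then show ?thesis by (simp add: univ_poly_mult)
  next
    case False
    then have "c = [e]" by (simp add: c_def poly_of_const_def)
    then show ?thesis
      using poly_mult_degree_eq[OF carrier_is_subring, of c w] cc wc lw
      unfolding univ_poly_mult univ_poly_carrier[symmetric] by (auto simp del: poly_mult.simps split: if_splits)
  qed
  show ?case
  proof (rule bexI[of _ r], intro conjI ballI)
    show "r \<in> carrier (poly_ring R)" unfolding r_def using p cc wc by simp
    show "length r \<le> card (insert z Z)"
      unfolding r_def univ_poly_add
      using poly_add_length_le[of p "c \<otimes>\<^bsub>poly_ring R\<^esub> w"] lcw lw p(2) insert.hyps by simp
    fix y assume y: "y \<in> insert z Z"
    show "eval r y = v y"
    proof (cases "y = z")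
      case True
      have "eval p z \<oplus> (v z \<ominus> eval p z) \<otimes> inv (eval w z) \<otimes> eval w z = v z"
        using wzc inv zc by (simp add: m_assoc, algebra)
      then show ?thesis using ev[OF zc(1)] True by (simp add: e_def)
    next
      case False
      then have "y \<in> Z" "y \<in> carrier R" using y insert.prems by auto
      then show ?thesis using ev w0 p(1,3) ec set_poly_subset eval_in_carrier insert.prems(2)[of y] by simp
    qed
  qed
qed

lemma card_roots_of_unity:
  assumes "n \<ge> 1"
  shows "finite {x \<in> carrier R. x [^] n = \<one>}" "card {x \<in> carrier R. x [^] n = \<one>} \<le> n"
proof -
  define p where "p = \<one> # replicate (n - 1) \<zero> @ [\<ominus> \<one>]"
  have p: "p \<in> carrier (poly_ring R)"
    unfolding p_def by (rule poly_ring_memI) auto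
  have ev: "eval p x = x [^] n \<oplus> \<ominus> \<one>" if "x \<in> carrier R" for x
    unfolding p_def using that assms eval_replicate[of "[\<ominus> \<one>]" x "n - 1"] by simp
  have sub: "{x \<in> carrier R. x [^] n = \<one>} \<subseteq> set_mset (roots p)"
    using roots_mem_iff_is_root[OF p] ev by (auto simp: is_root_def r_neg p_def)
  then show "finite {x \<in> carrier R. x [^] n = \<one>}" by (rule finite_subset) simp
  have "card {x \<in> carrier R. x [^] n = \<one>} \<le> card (set_mset (roots p))"
    using sub by (intro card_mono) auto
  also have "\<dots> \<le> size (roots p)"
    using size_mset_mono[OF mset_set_set_mset_msubset[of "roots p"]] by simp
  also have "\<dots> \<le> length p - 1" by (rule size_roots_le_degree[OF p])
  finally show "card {x \<in> carrier R. x [^] n = \<one>} \<le> n" using assms by (simp add: p_def)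
qed

end

section \<open>Fields with a Frobenius endomorphism\<close>

text \<open>The intended R is an algebraic closure of the field with q elements, which is recovered
  as the set of solutions of x^q = x. Algebraic closedness is expressed by the splitting of
  polynomials over this fixed field.\<close>

locale frobenius_field = field R for R (structure) +
  fixes q :: nat
  assumes frob_add': "x \<in> carrier R \<Longrightarrow> y \<in> carrier R \<Longrightarrow> (x \<oplus> y) [^] q = x [^] q \<oplus> y [^] q"
    and odd_q: "odd q" and q_gt_1: "q > 1" and two_nonzero: "\<one> \<oplus> \<one> \<noteq> \<zero>"
    and card_fixed': "card {x \<in> carrier R. x [^] q = x} = q"
    and split_fixed': "p \<in> carrier ({x \<in> carrier R. x [^] q = x}[X]) \<Longrightarrow> splitted p"
begin

definition frob :: "'a \<Rightarrow> 'a" where "frob x = x [^] q"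

definition fixed :: "'a set" where "fixed = {x \<in> carrier R. frob x = x}"

lemma card_fixed: "card fixed = q" and finite_fixed: "finite fixed"
proof -
  show "card fixed = q" using card_fixed' by (simp add: fixed_def frob_def)
  then show "finite fixed" using q_gt_1 by (intro card_ge_0_finite) simp
qed

lemma frob_hom: "frob \<in> ring_hom R R"
  by (rule ring_hom_memI) (auto simp: frob_def nat_pow_distrib frob_add')

sublocale frob: ring_hom_ring R R frob
  by (rule ring_hom_ringI2[OF ring_axioms ring_axioms frob_hom])

sublocale injective_self_map "carrier R" frob
  using non_trivial_field_hom_is_inj[OF frob_hom field_axioms field_axioms]
  by unfold_locales auto

lemma fixed_iff: "x \<in> fixed \<longleftrightarrow> x \<in> carrier R \<and> frob x = x"
  by (simp add: fixed_def)

lemma splitted_fixed: "set p \<subseteq> fixed \<Longrightarrow> hd p \<noteq> \<zero> \<Longrightarrow> splitted p"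
  using split_fixed'[of p] univ_poly_carrier[of R fixed p] polynomialI[of p fixed]
  by (simp add: fixed_def frob_def)

lemma map_frob_closed: "p \<in> carrier (poly_ring R) \<Longrightarrow> map frob p \<in> carrier (poly_ring R)"
  by (rule polynomial_hom[OF frob_hom field_axioms field_axioms])

lemma map_frob_mult:
  assumes "p \<in> carrier (poly_ring R)" "r \<in> carrier (poly_ring R)"
  shows "map frob (p \<otimes>\<^bsub>poly_ring R\<^esub> r) = map frob p \<otimes>\<^bsub>poly_ring R\<^esub> map frob r"
proof -
  interpret UP: domain "poly_ring R" by (rule univ_poly_is_domain[OF carrier_is_subring])
  have "polynomial (carrier R) (map frob (poly_mult p r))"
    using map_frob_closed[OF UP.m_closed[OF assms]] by (simp add: univ_poly_carrier univ_poly_mult)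
  then show ?thesis
    using frob.poly_mult_hom'[OF assms[THEN set_poly_subset]] normalize_polynomial
    by (simp add: univ_poly_mult)
qed

lemma roots_map_frob:
  assumes "monic_split p"
  shows "monic_split (map frob p)" "roots (map frob p) = image_mset frob (roots p)"
proof -
  have "monic_split (map frob p) \<and> roots (map frob p) = image_mset frob (roots p)"
    using assms
  proof (induction rule: monic_split_induct)
    case one
    then show ?case using monic_split_one roots_one by simp
  next
    case (mult a p)
    then have p: "p \<in> carrier (poly_ring R)" "p \<noteq> []" "map frob p \<in> carrier (poly_ring R)"
      using map_frob_closed by (auto simp: monic_split_def)
    have "[\<one>, \<ominus> a] \<in> carrier (poly_ring R)" using mult(1) by (intro poly_ring_memI) auto
    then have eq: "map frob ([\<one>, \<ominus> a] \<otimes>\<^bsub>poly_ring R\<^esub> p) = [\<one>, \<ominus> frob a] \<otimes>\<^bsub>poly_ring R\<^esub> map frob p"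
      using mult(1) p by (simp add: map_frob_mult frob.hom_a_inv)
    show ?case unfolding eq
      using mult p monic_split_linear_mult[of "frob a" "map frob p"]
        linear_mult_props(5)[OF mult(1) p(1,2)] linear_mult_props(5)[OF _ p(3), of "frob a"]
      by auto
  qed
  then show "monic_split (map frob p)" "roots (map frob p) = image_mset frob (roots p)" by auto
qed

section \<open>Stable multisets as monic polynomials over the fixed field\<close>

definition monic_fixed :: "nat \<Rightarrow> 'a list set" where
  "monic_fixed n = {p. set p \<subseteq> fixed \<and> length p = Suc n \<and> hd p = \<one>}"

lemma monic_fixed_split:
  assumes "p \<in> monic_fixed n"
  shows "monic_split p" "map frob p = p" "size (roots p) = n" "p \<in> carrier (poly_ring R)"
proof -
  have p: "set p \<subseteq> fixed" "length p = Suc n" "hd p = \<one>" using assms by (auto simp: monic_fixed_def)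
  then have "set p \<subseteq> carrier R" by (auto simp: fixed_iff)
  then show P: "p \<in> carrier (poly_ring R)" using p by (intro poly_ring_memI) auto
  show m: "monic_split p"
    unfolding monic_split_def using P p splitted_fixed[of p] by auto
  show "map frob p = p" using p(1) by (intro map_idI) (auto simp: fixed_iff)
  show "size (roots p) = n" using length_monic_split[OF m] p(2) by simp
qed

lemma stable_roots:
  assumes "p \<in> monic_fixed n"
  shows "roots p \<in> stable_of_size n"
  using monic_fixed_split[OF assms] roots_map_frob(2)[OF monic_fixed_split(1)[OF assms]] roots_carrier
  by (simp add: stable_of_size_def stable_def)

text \<open>Galois descent: the monic polynomial with root multiset M and its Frobenius conjugate
  have the same roots, hence coincide, so the coefficients are fixed.\<close>

lemma exists_monic_fixed:
  assumes "M \<in> stable_of_size n"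
  shows "\<exists>p\<in>monic_fixed n. roots p = M"
proof -
  obtain p where p: "monic_split p" "roots p = M"
    using exists_monic_split[of M] assms by (auto simp: stable_of_size_def stable_def)
  then have "map frob p = p"
    using monic_split_unique roots_map_frob[OF p(1)] assms
    by (auto simp: stable_of_size_def stable_def)
  then have "set p \<subseteq> fixed"
    using p(1) set_poly_subset[of p] map_eq_conv[of frob p id]
    by (auto simp: monic_split_def fixed_iff)
  then have "p \<in> monic_fixed n"
    using p length_monic_split[OF p(1)] assms
    by (auto simp: monic_fixed_def stable_of_size_def monic_split_def)
  then show ?thesis using p by blast
qed

lemma bij_betw_roots: "bij_betw roots (monic_fixed n) (stable_of_size n)"
  unfolding bij_betw_def
proof (intro conjI inj_onI)
  show "p = r" if "p \<in> monic_fixed n" "r \<in> monic_fixed n" "roots p = roots r" for p r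
    using that monic_split_unique monic_fixed_split by blast
  show "roots ` monic_fixed n = stable_of_size n"
    using stable_roots exists_monic_fixed by (auto simp: image_iff) blast
qed

lemma card_monic_fixed: "card (monic_fixed n) = q ^ n" and finite_monic_fixed: "finite (monic_fixed n)"
proof -
  have eq: "monic_fixed n = (#) \<one> ` {p. set p \<subseteq> fixed \<and> length p = n}"
  proof
    show "monic_fixed n \<subseteq> (#) \<one> ` {p. set p \<subseteq> fixed \<and> length p = n}"
    proof
      fix p assume "p \<in> monic_fixed n"
      then show "p \<in> (#) \<one> ` {p. set p \<subseteq> fixed \<and> length p = n}"
        by (cases p) (auto simp: monic_fixed_def)
    qed
    have "\<one> \<in> fixed" by (simp add: fixed_iff)
    then show "(#) \<one> ` {p. set p \<subseteq> fixed \<and> length p = n} \<subseteq> monic_fixed n"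
      by (auto simp: monic_fixed_def)
  qed
  show "card (monic_fixed n) = q ^ n"
    unfolding eq by (subst card_image) (auto simp: card_lists_length_eq[OF finite_fixed] card_fixed)
  show "finite (monic_fixed n)"
    unfolding eq using finite_lists_length_eq[OF finite_fixed] by simp
qed

lemma card_stable_of_size: "card (stable_of_size n) = q ^ n"
  and finite_stable_of_size: "finite (stable_of_size n)"
  using bij_betw_same_card[OF bij_betw_roots, of n] bij_betw_finite[OF bij_betw_roots, of n]
    card_monic_fixed finite_monic_fixed by auto

text \<open>Conjugating the coefficients of an interpolation polynomial conjugates its nodes and
  values. For equivariant data on a Frobenius-stable set the conjugate solves the same problem, and
  uniqueness in degree below \<open>card Z\<close> makes the polynomial its own conjugate.\<close>

lemma exists_interpolation_fixed:
  assumes Z: "finite Z" "Z \<subseteq> carrier R" "frob ` Z \<subseteq> Z"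
    and v: "\<And>z. z \<in> Z \<Longrightarrow> v z \<in> carrier R" "\<And>z. z \<in> Z \<Longrightarrow> v (frob z) = frob (v z)"
  shows "\<exists>p\<in>carrier (poly_ring R). set p \<subseteq> fixed \<and> length p \<le> card Z \<and> (\<forall>z\<in>Z. eval p z = v z)"
proof -
  obtain p where p: "p \<in> carrier (poly_ring R)" "length p \<le> card Z" "\<forall>z\<in>Z. eval p z = v z"
    using exists_interpolation[OF Z(1,2), of v] v(1) by blast
  have "frob ` Z = Z"
    using Z inj by (metis endo_inj_surj inj_on_subset)
  have "map frob p = p"
  proof (rule poly_determined_by_values[OF _ _ Z(1,2)])
    fix z assume "z \<in> Z"
    then obtain y where y: "y \<in> Z" "z = frob y" using \<open>frob ` Z = Z\<close> by blast
    then have "y \<in> carrier R" "frob y \<in> Z" using Z(2,3) by auto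
    then have "eval (map frob p) (frob y) = eval p (frob y)"
      using frob.eval_hom'[of y p] set_poly_subset[OF p(1)] p(3) v(2)[OF y(1)] y(1) by simp
    then show "eval (map frob p) z = eval p z" using y(2) by simp
  qed (use p map_frob_closed in auto)
  then have "set p \<subseteq> fixed"
    using set_poly_subset[OF p(1)] map_eq_conv[of frob p id] by (auto simp: fixed_iff)
  then show ?thesis using p by blast
qed

text \<open>Adding to a monic polynomial the interpolation polynomial of small degree that rescales its
  values on \<open>Z\<close> permutes the monic polynomials of a fixed degree.\<close>
lemma exists_rescaling_permutation:
  assumes Z: "finite Z" "Z \<subseteq> carrier R" "frob ` Z \<subseteq> Z" and n: "card Z \<le> n"
    and w: "\<And>z. z \<in> Z \<Longrightarrow> w z \<in> carrier R - {\<zero>}" "\<And>z. z \<in> Z \<Longrightarrow> w (frob z) = frob (w z)"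
  shows "\<exists>T. bij_betw T (stable_of_size n) (stable_of_size n) \<and>
    (\<forall>M\<in>stable_of_size n. \<forall>z\<in>Z. mprod (\<lambda>\<alpha>. z \<ominus> \<alpha>) (T M) = w z \<otimes> mprod (\<lambda>\<alpha>. z \<ominus> \<alpha>) M)"
proof -
  interpret UP: domain "poly_ring R" by (rule univ_poly_is_domain[OF carrier_is_subring])
  let ?P = "poly_ring R"
  \<comment> \<open>Adding a polynomial with value (w(z) - 1) p(z) at z changes p(z) into w(z)
    p(z).\<close>
  define v where "v p z = (w z \<ominus> \<one>) \<otimes> eval p z" for p z
  have evc: "eval p z \<in> carrier R" if "p \<in> carrier ?P" "z \<in> carrier R" for p z
    using that set_poly_subset eval_in_carrier by blast
  have "\<exists>I. \<forall>p\<in>monic_fixed n. I p \<in> carrier ?P \<and> set (I p) \<subseteq> fixed \<and> length (I p) \<le> card Z \<and>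
      (\<forall>z\<in>Z. eval (I p) z = v p z)"
  proof (rule bchoice, rule ballI)
    fix p assume p: "p \<in> monic_fixed n"
    have "v p z \<in> carrier R \<and> v p (frob z) = frob (v p z)" if z: "z \<in> Z" for z
    proof -
      have zc: "z \<in> carrier R" "w z \<in> carrier R" using z Z(2) w(1) by auto
      have "eval p (frob z) = frob (eval p z)"
        using frob.eval_hom'[OF zc(1), of p] set_poly_subset monic_fixed_split(2,4)[OF p] by simp
      then show ?thesis
        using evc[OF monic_fixed_split(4)[OF p] zc(1)] zc w(2)[OF z]
        by (simp add: v_def a_minus_def)
    qed
    then show "\<exists>I. I \<in> carrier ?P \<and> set I \<subseteq> fixed \<and> length I \<le> card Z \<and> (\<forall>z\<in>Z. eval I z = v p z)"
      using exists_interpolation_fixed[OF Z, of "v p"] by blast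
  qed
  then obtain I where I: "\<And>p. p \<in> monic_fixed n \<Longrightarrow> I p \<in> carrier ?P"
    "\<And>p. p \<in> monic_fixed n \<Longrightarrow> set (I p) \<subseteq> fixed" "\<And>p. p \<in> monic_fixed n \<Longrightarrow> length (I p) \<le> card Z"
    "\<And>p z. p \<in> monic_fixed n \<Longrightarrow> z \<in> Z \<Longrightarrow> eval (I p) z = v p z"
    by blast
  define S where "S p = p \<oplus>\<^bsub>?P\<^esub> I p" for p
  have S_eval: "eval (S p) z = w z \<otimes> eval p z" if p: "p \<in> monic_fixed n" and z: "z \<in> Z" for p z
  proof -
    have zc: "z \<in> carrier R" "w z \<in> carrier R" using z Z(2) w(1) by auto
    have e: "eval p z \<in> carrier R" using evc[OF monic_fixed_split(4)[OF p] zc(1)] .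
    have "eval (S p) z = eval p z \<oplus> (w z \<ominus> \<one>) \<otimes> eval p z"
      unfolding S_def
      using ring_hom_add[OF poly_eval_hom[OF zc(1)] monic_fixed_split(4)[OF p] I(1)[OF p]] I(4)[OF p z]
      by (simp add: v_def)
    also have "\<dots> = w z \<otimes> eval p z" using e zc by algebra
    finally show ?thesis .
  qed
  have S_mem: "S p \<in> monic_fixed n" if p: "p \<in> monic_fixed n" for p
  proof -
    have pc: "set p \<subseteq> carrier R" "set (I p) \<subseteq> carrier R" "hd p = \<one>" "length p = Suc n"
      using p I(2)[OF p] by (auto simp: monic_fixed_def fixed_iff)
    \<comment> \<open>The correction has length at most \<open>card Z\<close>, hence at most n,
      while p has length n + 1: the sum stays monic of degree n.\<close>
    have *: "hd (S p) = \<one>" "length (S p) = Suc n"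
      unfolding S_def univ_poly_add
      using hd_poly_add_longer[of p "I p"] pc I(3)[OF p] n by (simp_all del: poly_add.simps)
    have "map frob (S p) = S p"
    proof -
      have "S p \<in> carrier ?P" unfolding S_def using I(1)[OF p] monic_fixed_split(4)[OF p] by simp
      then have "polynomial (carrier R) (map frob (poly_add p (I p)))"
        using map_frob_closed by (simp add: S_def univ_poly_carrier univ_poly_add del: poly_add.simps)
      moreover have "map frob p = p" "map frob (I p) = I p"
        using monic_fixed_split(2)[OF p] I(2)[OF p] by (auto intro!: map_idI simp: fixed_iff)
      ultimately show ?thesis
        using frob.poly_add_hom'[OF pc(1,2)] normalize_polynomial
        by (simp add: S_def univ_poly_add del: poly_add.simps)
    qed
    moreover have "set (S p) \<subseteq> carrier R"
      unfolding S_def univ_poly_add using poly_add_in_carrier pc by blast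
    ultimately have "set (S p) \<subseteq> fixed"
      using map_eq_conv[of frob "S p" id] by (auto simp: fixed_iff)
    then show ?thesis using * by (simp add: monic_fixed_def)
  qed
  have "inj_on S (monic_fixed n)"
  proof (rule inj_onI)
    fix p r assume pr: "p \<in> monic_fixed n" "r \<in> monic_fixed n" "S p = S r"
    have ev: "eval p z = eval r z" if z: "z \<in> Z" for z
    proof -
      have "w z \<otimes> eval p z = w z \<otimes> eval r z" using pr S_eval z by metis
      moreover have "z \<in> carrier R" using z Z(2) by auto
      ultimately show ?thesis
        using w(1)[OF z] m_lcancel[of "w z"] evc monic_fixed_split(4) pr by blast
    qed
    \<comment> \<open>The correction depends on p only through its values on Z, and
      \<open>S p\<close> determines these because w has no zeros; so p can be recovered from
      \<open>S p\<close>.\<close>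
    have "I p = I r"
      by (rule poly_determined_by_values[OF _ _ Z(1,2)]) (use I pr ev in \<open>auto simp: v_def\<close>)
    then show "p = r"
      using pr I(1)[OF pr(1)] monic_fixed_split(4)[OF pr(1)] monic_fixed_split(4)[OF pr(2)]
      unfolding S_def by simp
  qed
  moreover have "S ` monic_fixed n \<subseteq> monic_fixed n" using S_mem by blast
  ultimately have Sbij: "bij_betw S (monic_fixed n) (monic_fixed n)"
    by (simp add: bij_betw_def endo_inj_surj finite_monic_fixed)
  define U where "U = the_inv_into (monic_fixed n) roots"
  have Ubij: "bij_betw U (stable_of_size n) (monic_fixed n)"
    unfolding U_def by (rule bij_betw_the_inv_into[OF bij_betw_roots])
  have rU: "roots (U M) = M" "U M \<in> monic_fixed n" if "M \<in> stable_of_size n" for M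
    using that bij_betwE[OF Ubij] f_the_inv_into_f_bij_betw[OF bij_betw_roots[of n]]
    by (auto simp: U_def)
  show ?thesis
  proof (intro exI conjI ballI)
    show "bij_betw (\<lambda>M. roots (S (U M))) (stable_of_size n) (stable_of_size n)"
      using bij_betw_trans[OF bij_betw_trans[OF Ubij Sbij] bij_betw_roots] by (simp add: comp_def)
    fix M z assume M: "M \<in> stable_of_size n" and z: "z \<in> Z"
    have zc: "z \<in> carrier R" using z Z(2) by auto
    show "mprod (\<lambda>\<alpha>. z \<ominus> \<alpha>) (roots (S (U M))) = w z \<otimes> mprod (\<lambda>\<alpha>. z \<ominus> \<alpha>) M"
      using S_eval[OF rU(2)[OF M] z] eval_monic_split[OF monic_fixed_split(1)[OF S_mem[OF rU(2)[OF M]]] zc]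
        eval_monic_split[OF monic_fixed_split(1)[OF rU(2)[OF M]] zc] rU(1)[OF M]
      by simp
  qed
qed

lemma funpow_frob: "x \<in> carrier R \<Longrightarrow> (frob ^^ j) x = x [^] (q ^ j)"
  by (induction j) (simp_all add: frob_def nat_pow_pow mult.commute)

lemma finite_fixpts:
  assumes "j \<ge> 1"
  shows "finite (fixpts j)"
proof -
  have qj: "q ^ j > 1" using one_less_power[OF q_gt_1, of j] assms by simp
  have "x [^] (q ^ j - 1) = \<one>" if x: "x \<in> carrier R" "x \<noteq> \<zero>" "(frob ^^ j) x = x" for x
  proof -
    have "x [^] (q ^ j - 1) \<otimes> x = x [^] Suc (q ^ j - 1)" by simp
    also have "Suc (q ^ j - 1) = q ^ j" using qj by simp
    finally have "x [^] (q ^ j - 1) \<otimes> x = \<one> \<otimes> x"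
      using x funpow_frob[OF x(1), of j] by simp
    then show ?thesis using x m_rcancel[of x "x [^] (q ^ j - 1)" \<one>] by simp
  qed
  then have "fixpts j \<subseteq> insert \<zero> {x \<in> carrier R. x [^] (q ^ j - 1) = \<one>}"
    by (auto simp: fixpts_def)
  then show ?thesis
    using card_roots_of_unity(1)[of "q ^ j - 1"] qj by (auto intro: finite_subset)
qed

text \<open>For the trivial character the recurrence reads n q^n = sum over j of
  \<open>card (fixpts j)\<close> q^(n - j); subtracting q times its instance for n - 1 isolates the
  last term.\<close>

lemma card_fixpts:
  assumes "j \<ge> 1"
  shows "card (fixpts j) = q ^ j"
proof -
  have rec: "real n * real q ^ n = (\<Sum>j=1..n. real (card (fixpts j)) * real q ^ (n - j))" for n
    using log_derivative_recurrence[of "\<lambda>_. 1" n] finite_fixpts finite_stable_of_size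
    by (simp add: card_stable_of_size)
  obtain m where m: "j = Suc m" using assms by (cases j) auto
  have "(\<Sum>j=1..m. real (card (fixpts j)) * real q ^ (Suc m - j))
      = q * (\<Sum>j=1..m. real (card (fixpts j)) * real q ^ (m - j))"
    unfolding sum_distrib_left by (rule sum.cong) (auto simp: Suc_diff_le)
  then have "real (Suc m) * real q ^ Suc m = real (card (fixpts j)) + q * (real m * real q ^ m)"
    using rec[of "Suc m"] rec[of m] m by simp
  then have "real (card (fixpts j)) = real (q ^ j)" using m by (simp add: algebra_simps)
  then show ?thesis by (simp only: of_nat_eq_iff)
qed

end

section \<open>Quadratic symbols\<close>

lemma (in domain) nat_pow_nonzero:
  "x \<in> carrier R \<Longrightarrow> x \<noteq> \<zero> \<Longrightarrow> x [^] (n::nat) \<noteq> \<zero>"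
  by (induction n) (auto simp: integral_iff)

context frobenius_field
begin

text \<open>Euler's criterion for the quadratic character of the fixed field, real-valued so that
  its values can be summed over points. The value -1 is also the default outside
  \<open>fixed\<close>, so multiplicativity is claimed on \<open>fixed\<close> only.\<close>

definition eta :: "'a \<Rightarrow> real" where
  "eta y = (if y = \<zero> then 0 else if y [^] ((q - 1) div 2) = \<one> then 1 else - 1)"

lemma half_power_cases:
  assumes "y \<in> fixed" "y \<noteq> \<zero>"
  shows "y [^] ((q - 1) div 2) = \<one> \<or> y [^] ((q - 1) div 2) = \<ominus> \<one>"
proof -
  let ?u = "y [^] ((q - 1) div 2)"
  have y: "y \<in> carrier R" "y [^] q = y" using assms(1) by (auto simp: fixed_iff frob_def)
  have u: "?u \<in> carrier R" using y by simp
  have "(q - 1) div 2 + (q - 1) div 2 + 1 = q" using odd_q by (auto elim!: oddE)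
  then have "?u \<otimes> ?u \<otimes> y = y" using y by (metis nat_pow_closed nat_pow_eone nat_pow_mult)
  then have "?u \<otimes> ?u = \<one>" using y u assms(2) m_rcancel[of y "?u \<otimes> ?u" \<one>] by simp
  then have "(?u \<ominus> \<one>) \<otimes> (?u \<oplus> \<one>) = \<zero>" using u by algebra
  then have "?u \<ominus> \<one> = \<zero> \<or> ?u \<oplus> \<one> = \<zero>"
    using u integral[of "?u \<ominus> \<one>" "?u \<oplus> \<one>"] by simp
  then show ?thesis using u by (metis minus_equality one_closed r_right_minus_eq)
qed

lemma minus_one_neq_one: "\<ominus> \<one> \<noteq> \<one>"
  using two_nonzero by (metis l_neg one_closed)

lemma fixed_mult: "y \<in> fixed \<Longrightarrow> z \<in> fixed \<Longrightarrow> y \<otimes> z \<in> fixed"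
  by (simp add: fixed_iff)

lemma eta_mult:
  assumes "y \<in> fixed" "z \<in> fixed"
  shows "eta (y \<otimes> z) = eta y * eta z"
proof -
  have "y \<in> carrier R" "z \<in> carrier R" using assms by (auto simp: fixed_iff)
  moreover have "\<ominus> \<one> \<otimes> \<ominus> \<one> = \<one>" by algebra
  ultimately show ?thesis
    using half_power_cases[OF assms(1)] half_power_cases[OF assms(2)] minus_one_neq_one
    by (cases "y = \<zero> \<or> z = \<zero>") (auto simp: eta_def nat_pow_distrib integral_iff)
qed

lemma eta_one [simp]: "eta \<one> = 1"
  by (simp add: eta_def)

lemma eta_cases: "eta y \<in> {-1, 0, 1}"
  by (simp add: eta_def)

lemma eta_zero_iff: "eta y = 0 \<longleftrightarrow> y = \<zero>"
  by (simp add: eta_def)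

lemma eta_pow:
  assumes "y \<in> fixed"
  shows "y [^] (n::nat) \<in> fixed" "eta (y [^] n) = eta y ^ n"
proof -
  have "y [^] n \<in> fixed \<and> eta (y [^] n) = eta y ^ n"
    using assms by (induction n) (auto simp: eta_mult fixed_mult, simp add: fixed_iff)
  then show "y [^] n \<in> fixed" "eta (y [^] n) = eta y ^ n" by auto
qed

text \<open>Frobenius merely permutes the factors when M is stable and f is equivariant. For an
  orbit this says that a norm lies in the base field.\<close>

lemma mprod_fixed:
  assumes "stable M" "\<And>x. x \<in> carrier R \<Longrightarrow> f x \<in> carrier R"
    "\<And>x. x \<in> carrier R \<Longrightarrow> f (frob x) = frob (f x)"
  shows "mprod f M \<in> fixed"
proof -
  have M: "set_mset M \<subseteq> carrier R" "image_mset frob M = M" using assms(1) by (auto simp: stable_def)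
  have f: "f \<in> set_mset M \<rightarrow> carrier R" using M assms(2) by auto
  have "frob (mprod f M) = mprod (\<lambda>x. frob (f x)) M" by (rule mprod_hom[OF frob_hom f])
  also have "\<dots> = mprod (\<lambda>x. f (frob x)) M" by (rule mprod_cong) (use M assms in auto)
  also have "\<dots> = mprod f (image_mset frob M)" by (rule mprod_image[symmetric]) (use M assms in auto)
  finally show ?thesis using M f by (simp add: fixed_iff mprod_closed)
qed

lemma mprod_orbit_mset:
  assumes "\<And>x. x \<in> carrier R \<Longrightarrow> f x \<in> carrier R" "x \<in> carrier R"
  shows "mprod f (orbit_mset j x) = mprod (\<lambda>k. f ((frob ^^ k) x)) (mset [0..<j])"
proof -
  have "orbit_mset j x = image_mset (\<lambda>k. (frob ^^ k) x) (mset [0..<j])"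
    by (simp add: orbit_mset_def)
  then show ?thesis
    using assms funpow_closed by (simp only:) (rule mprod_image, auto)
qed

text \<open>The exponent is (q^j - 1)/(q - 1), so for x in \<open>fixpts j\<close> this is the norm
  from the field with q^j elements.\<close>

lemma mprod_orbit_mset_power:
  assumes "x \<in> carrier R"
  shows "mprod (\<lambda>x. x) (orbit_mset j x) = x [^] (\<Sum>i<j. q ^ i)"
proof (induction j)
  case 0 then show ?case by (simp add: orbit_mset_def)
next
  case (Suc j)
  have "(\<lambda>x. x) \<in> set_mset (orbit_mset (Suc j) x) \<rightarrow> carrier R"
    using assms funpow_closed by (auto simp: orbit_mset_def)
  then have "mprod (\<lambda>x. x) (orbit_mset (Suc j) x) = x [^] (q ^ j) \<otimes> x [^] (\<Sum>i<j. q ^ i)"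
    using Suc assms by (simp add: orbit_mset_Suc mprod_add_mset funpow_frob)
  then show ?case using assms by (simp add: nat_pow_mult add.commute)
qed

text \<open>Otherwise all nonzero elements of the field with q^s elements would satisfy \<theta>^e =
  1 for e = (q^s - 1)/2, which is more solutions than the degree allows.\<close>

lemma exists_nonsquare_norm:
  assumes "s \<ge> 1"
  shows "\<exists>\<theta>\<in>fixpts s. eta (mprod (\<lambda>x. x) (orbit_mset s \<theta>)) = -1"
proof (rule ccontr)
  assume neg: "\<not> ?thesis"
  define e where "e = (\<Sum>i<s. q ^ i) * ((q - 1) div 2)"
  have "(q - 1) * (\<Sum>i<s. q ^ i) = q ^ s - 1"
  proof (induction s)
    case (Suc s)
    have "1 \<le> q ^ s" using q_gt_1 by simp
    have "(q - 1) * (\<Sum>i<Suc s. q ^ i) = (q ^ s - 1) + (q - 1) * q ^ s"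
      using Suc by (simp add: distrib_left)
    also have "\<dots> = (q ^ s - 1) + (q * q ^ s - q ^ s)" by (simp only: diff_mult_distrib mult_1)
    also have "\<dots> = q ^ Suc s - 1"
      using \<open>1 \<le> q ^ s\<close> q_gt_1 by simp
    finally show ?case .
  qed simp
  moreover have "2 * ((q - 1) div 2) = q - 1" using odd_q by simp
  ultimately have two_e: "2 * e = q ^ s - 1"
    unfolding e_def by (metis mult.assoc mult.commute)
  have "q ^ s > 1" using one_less_power[OF q_gt_1, of s] assms by simp
  then have e: "e \<ge> 1" using two_e by simp
  have "\<theta> [^] e = \<one>" if th: "\<theta> \<in> fixpts s" "\<theta> \<noteq> \<zero>" for \<theta>
  proof -
    have c: "\<theta> \<in> carrier R" using th by (simp add: fixpts_def)
    let ?n = "mprod (\<lambda>x. x) (orbit_mset s \<theta>)"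
    have n: "?n = \<theta> [^] (\<Sum>i<s. q ^ i)" by (rule mprod_orbit_mset_power[OF c])
    then have "?n \<noteq> \<zero>" using c th nat_pow_nonzero by metis
    then have "?n [^] ((q - 1) div 2) = \<one>"
      using neg th by (auto simp: eta_def split: if_splits)
    then show ?thesis unfolding n e_def using c by (simp add: nat_pow_pow)
  qed
  then have "fixpts s - {\<zero>} \<subseteq> {x \<in> carrier R. x [^] e = \<one>}" by (auto simp: fixpts_def)
  then have "card (fixpts s - {\<zero>}) \<le> e"
    using card_roots_of_unity[OF e] card_mono le_trans by blast
  then have "q ^ s - 1 \<le> e"
    using card_fixpts[OF assms] finite_fixpts[OF assms] by (simp add: card_Diff_singleton_if split: if_splits)
  then show False using two_e e by linarith
qed

text \<open>Take \<theta> of nonsquare norm in the field generated by \<beta>, spread it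
  equivariantly along the orbit of \<beta> and put w = 1 elsewhere. The product over a stable V is
  then the norm of \<theta> to the power \<open>count V \<beta>\<close>. As a residue class, w is a
  nonsquare at the place of \<beta> and trivial at all other places.\<close>

lemma exists_equivariant_weight:
  assumes b: "\<beta> \<in> carrier R" and m: "m \<ge> 1" "(frob ^^ m) \<beta> = \<beta>"
  shows "\<exists>w. (\<forall>z\<in>carrier R. w z \<in> carrier R - {\<zero>} \<and> w (frob z) = frob (w z)) \<and>
    (\<forall>V. stable V \<longrightarrow> mprod w V \<in> fixed \<and> eta (mprod w V) = (-1) ^ count V \<beta>)"
proof -
  obtain s where s: "s \<ge> 1" "(frob ^^ s) \<beta> = \<beta>" "\<And>j. (frob ^^ j) \<beta> = \<beta> \<longleftrightarrow> s dvd j"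
    "inj_on (\<lambda>i. (frob ^^ i) \<beta>) {..<s}"
    using exists_minimal_period[OF b m] by blast
  obtain \<theta> where th: "\<theta> \<in> fixpts s" "eta (mprod (\<lambda>x. x) (orbit_mset s \<theta>)) = -1"
    using exists_nonsquare_norm[OF s(1)] by blast
  have thc: "\<theta> \<in> carrier R" using th by (simp add: fixpts_def)
  have th0: "\<theta> \<noteq> \<zero>"
  proof
    assume "\<theta> = \<zero>"
    moreover have "(\<Sum>i<s. q ^ i) \<noteq> 0"
      using s(1) q_gt_1 by (auto intro!: exI[of _ 0])
    ultimately have "mprod (\<lambda>x. x) (orbit_mset s \<theta>) = \<zero>"
      using mprod_orbit_mset_power[OF thc] by (simp add: nat_pow_zero)
    then show False using th(2) by (simp add: eta_def)
  qed
  \<comment> \<open>Any exponent carrying \<beta> to z may be chosen: two of them differ by a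
    multiple of s, and \<theta> is fixed by the s-th iterate.\<close>
  define w where "w z = (if \<exists>i. (frob ^^ i) \<beta> = z
    then (frob ^^ (SOME i. (frob ^^ i) \<beta> = z)) \<theta> else \<one>)" for z
  have same: "(frob ^^ i) \<theta> = (frob ^^ j) \<theta>" if "(frob ^^ i) \<beta> = (frob ^^ j) \<beta>" "i \<le> j" for i j
  proof -
    have "(frob ^^ (j - i)) \<beta> = \<beta>"
      using funpow_eq_imp_fixed[OF b, of i j] that by (cases "i = j") auto
    then obtain k where k: "j - i = s * k" using s(3) by (metis dvdE)
    have "(frob ^^ s) \<theta> = \<theta>" using th(1) by (simp add: fixpts_def)
    then have per: "(frob ^^ (j - i)) \<theta> = \<theta>" unfolding k by (rule funpow_period_mult)
    have "(frob ^^ j) \<theta> = (frob ^^ (i + (j - i))) \<theta>" using that(2) by simp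
    also have "\<dots> = (frob ^^ i) \<theta>" by (simp only: funpow_add comp_apply per)
    finally show ?thesis by simp
  qed
  have w_orbit: "w ((frob ^^ i) \<beta>) = (frob ^^ i) \<theta>" for i
  proof -
    define j where "j = (SOME j. (frob ^^ j) \<beta> = (frob ^^ i) \<beta>)"
    have "(frob ^^ j) \<beta> = (frob ^^ i) \<beta>" unfolding j_def by (rule someI) simp
    then have "(frob ^^ j) \<theta> = (frob ^^ i) \<theta>"
      using same[of i j] same[of j i] by (metis nat_le_linear)
    then show ?thesis unfolding w_def j_def[symmetric] by auto
  qed
  have w_frob: "w (frob z) = frob (w z)" if z: "z \<in> carrier R" for z
  proof (cases "\<exists>i. (frob ^^ i) \<beta> = z")
    case True
    then obtain i where i: "z = (frob ^^ i) \<beta>" by auto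
    then have "frob z = (frob ^^ Suc i) \<beta>" by simp
    then show ?thesis using w_orbit[of "Suc i"] w_orbit[of i] i by simp
  next
    case False
    have "\<not> (\<exists>i. (frob ^^ i) \<beta> = frob z)"
    proof
      assume "\<exists>i. (frob ^^ i) \<beta> = frob z"
      then obtain i where i: "(frob ^^ i) \<beta> = frob z" by auto
      \<comment> \<open>The orbit is closed under inverse Frobenius: s - 1 further steps undo one
        step.\<close>
      have "(frob ^^ Suc (i + s - 1)) \<beta> = (frob ^^ (i + s)) \<beta>" using s(1) by simp
      also have "\<dots> = (frob ^^ i) \<beta>" by (simp only: funpow_add comp_apply s(2))
      finally have "frob ((frob ^^ (i + s - 1)) \<beta>) = frob z" using i by simp
      then have "(frob ^^ (i + s - 1)) \<beta> = z"
        using inj funpow_closed[OF b] z by (auto dest: inj_onD)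
      then show False using False by blast
    qed
    then show ?thesis using False by (simp add: w_def)
  qed
  have w_ne: "w z \<in> carrier R - {\<zero>}" for z
  proof (cases "\<exists>i. (frob ^^ i) \<beta> = z")
    case True
    then obtain i where i: "z = (frob ^^ i) \<beta>" by auto
    have "(frob ^^ i) \<theta> \<noteq> \<zero>" using th0 thc nat_pow_nonzero by (simp add: funpow_frob)
    then show ?thesis using w_orbit i funpow_closed[OF thc] by simp
  qed (simp add: w_def)
  let ?O = "orbit_mset s \<beta>"
  define b0 where "b0 = mprod (\<lambda>x. x) (orbit_mset s \<theta>)"
  have b0: "b0 \<in> fixed" "eta b0 = -1"
    unfolding b0_def using th mprod_fixed[OF stable_orbit_mset[OF th(1)], of "\<lambda>x. x"] by auto
  have wO: "mprod w ?O = b0"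
    unfolding b0_def using mprod_orbit_mset[of w \<beta> s] mprod_orbit_mset[of "\<lambda>x. x" \<theta> s] w_ne b thc
    by (simp add: w_orbit)
  have "eta (mprod w V) = (-1) ^ count V \<beta>" if V: "stable V" for V
  proof -
    let ?c = "count V \<beta>"
    \<comment> \<open>Multiplicities are constant along the orbit, so V consists of
      \<open>count V \<beta>\<close> full orbits of \<beta> and a rest disjoint from that orbit,
      where w is 1.\<close>
    have sub: "repeat_mset ?c ?O \<subseteq># V"
    proof (rule mset_subset_eqI)
      fix y show "count (repeat_mset ?c ?O) y \<le> count V y"
        using count_stable_funpow[OF V b] by (auto simp: count_orbit_mset_period[OF s(4)])
    qed
    define N where "N = V - repeat_mset ?c ?O"
    have V_eq: "V = repeat_mset ?c ?O + N" unfolding N_def using sub by simp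
    have "w y = \<one>" if y: "y \<in># N" for y
    proof -
      have "(frob ^^ i) \<beta> \<notin># N" for i
      proof -
        have "(frob ^^ i) \<beta> = (frob ^^ (i mod s)) \<beta>"
          using s(2) funpow_period_mult[of s \<beta> "i div s"]
          by (metis comp_apply funpow_add mod_mult_div_eq)
        then have "(frob ^^ i) \<beta> \<in> (\<lambda>i. (frob ^^ i) \<beta>) ` {..<s}" using s(1) by auto
        then have "count ?O ((frob ^^ i) \<beta>) = 1" by (simp add: count_orbit_mset_period[OF s(4)])
        then show ?thesis
          unfolding N_def not_in_iff using count_stable_funpow[OF V b] by simp
      qed
      then show ?thesis using y by (auto simp: w_def)
    qed
    then have N1: "mprod w N = \<one>" by (rule mprod_one)
    have wfun: "w \<in> A \<rightarrow> carrier R" for A using w_ne by auto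
    have "mprod w V = mprod w ?O [^] ?c"
      by (subst V_eq) (simp add: mprod_union[OF wfun] mprod_repeat[OF wfun] N1 mprod_closed[OF wfun])
    then show ?thesis using wO b0 eta_pow by simp
  qed
  moreover have "mprod w V \<in> fixed" if "stable V" for V
    using mprod_fixed[OF that, of w] w_ne w_frob by auto
  ultimately show ?thesis using w_ne w_frob by blast
qed



text \<open>Each difference contributes one sign and the double product may be reordered: the
  resultant is symmetric up to -1 to the product of the degrees.\<close>

lemma mprod_differences_swap:
  assumes "set_mset M \<subseteq> carrier R" "set_mset V \<subseteq> carrier R"
  shows "mprod (\<lambda>\<alpha>. mprod (\<lambda>\<beta>. \<alpha> \<ominus> \<beta>) V) M =
    (\<ominus> \<one>) [^] (size V * size M) \<otimes> mprod (\<lambda>\<beta>. mprod (\<lambda>\<alpha>. \<beta> \<ominus> \<alpha>) M) V"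
proof -
  have inner: "mprod (\<lambda>\<beta>. \<alpha> \<ominus> \<beta>) V = (\<ominus> \<one>) [^] size V \<otimes> mprod (\<lambda>\<beta>. \<beta> \<ominus> \<alpha>) V" if "\<alpha> \<in> carrier R" for \<alpha>
  proof -
    have "mprod (\<lambda>\<beta>. \<alpha> \<ominus> \<beta>) V = mprod (\<lambda>\<beta>. (\<ominus> \<one>) \<otimes> (\<beta> \<ominus> \<alpha>)) V"
    proof (rule mprod_cong)
      fix \<beta> assume "\<beta> \<in># V"
      then have "\<beta> \<in> carrier R" using assms by auto
      then show "\<alpha> \<ominus> \<beta> = (\<ominus> \<one>) \<otimes> (\<beta> \<ominus> \<alpha>)" using that by algebra
    qed (use assms that in auto)
    then show ?thesis using assms that by (subst (asm) mprod_mult) (auto simp: mprod_const)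
  qed
  have cl: "mprod (\<lambda>\<beta>. \<beta> \<ominus> \<alpha>) V \<in> carrier R" if "\<alpha> \<in> carrier R" for \<alpha>
    using assms that by (intro mprod_closed) auto
  have "mprod (\<lambda>\<alpha>. mprod (\<lambda>\<beta>. \<alpha> \<ominus> \<beta>) V) M =
      mprod (\<lambda>\<alpha>. (\<ominus> \<one>) [^] size V \<otimes> mprod (\<lambda>\<beta>. \<beta> \<ominus> \<alpha>) V) M"
    by (rule mprod_cong) (use assms inner cl in auto)
  also have "\<dots> = (\<ominus> \<one>) [^] (size V * size M) \<otimes> mprod (\<lambda>\<alpha>. mprod (\<lambda>\<beta>. \<beta> \<ominus> \<alpha>) V) M"
    using assms cl by (subst mprod_mult) (auto simp: mprod_const nat_pow_pow)
  also have "mprod (\<lambda>\<alpha>. mprod (\<lambda>\<beta>. \<beta> \<ominus> \<alpha>) V) M = mprod (\<lambda>\<beta>. mprod (\<lambda>\<alpha>. \<beta> \<ominus> \<alpha>) M) V"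
    by (rule mprod_swap) (use assms in auto)
  finally show ?thesis .
qed

end

text \<open>The i-th polynomial has leading coefficient \<open>l i\<close> and root multiset
  \<open>V i\<close>. The last axiom excludes that a product over a nonempty subset is a constant
  times a square; the odd root may depend on the subset.\<close>

locale quadratic_symbols = frobenius_field +
  fixes I :: "'i set" and l :: "'i \<Rightarrow> 'a" and V :: "'i \<Rightarrow> 'a multiset"
  assumes finite_I: "finite I"
    and l: "i \<in> I \<Longrightarrow> l i \<in> fixed - {\<zero>}"
    and V: "i \<in> I \<Longrightarrow> stable (V i)"
    and odd_mult: "S \<subseteq> I \<Longrightarrow> S \<noteq> {} \<Longrightarrow> \<exists>\<beta>\<in>carrier R. odd (\<Sum>i\<in>S. count (V i) \<beta>)"
begin

definition val :: "'i \<Rightarrow> 'a \<Rightarrow> 'a" where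
  "val i x = l i \<otimes> mprod (\<lambda>\<beta>. x \<ominus> \<beta>) (V i)"

text \<open>Up to the power of \<open>l i\<close>, the argument of \<open>eta\<close> is the
  resultant of the i-th polynomial and the monic polynomial with roots M, so this is a Jacobi symbol
  modulo the latter.\<close>

definition symb :: "'i \<Rightarrow> 'a multiset \<Rightarrow> real" where
  "symb i M = eta (mprod (val i) M)"

definition Z :: "'a set" where "Z = (\<Union>i\<in>I. set_mset (V i))"

lemma V_carrier: "i \<in> I \<Longrightarrow> set_mset (V i) \<subseteq> carrier R"
  using V by (simp add: stable_def)

lemma l_carrier: "i \<in> I \<Longrightarrow> l i \<in> carrier R"
  using l by (auto simp: fixed_iff)

lemma val_closed: "i \<in> I \<Longrightarrow> x \<in> carrier R \<Longrightarrow> val i x \<in> carrier R"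
  unfolding val_def using l_carrier V_carrier by (intro m_closed mprod_closed) auto

lemma val_frob:
  assumes "i \<in> I" "x \<in> carrier R"
  shows "val i (frob x) = frob (val i x)"
proof -
  have c: "(\<lambda>\<beta>. x \<ominus> \<beta>) \<in> set_mset (V i) \<rightarrow> carrier R" "(\<lambda>\<beta>. frob x \<ominus> \<beta>) \<in> A \<inter> carrier R \<rightarrow> carrier R" for A
    using V_carrier assms by auto
  have "mprod (\<lambda>\<beta>. frob x \<ominus> \<beta>) (V i) = mprod (\<lambda>\<beta>. frob x \<ominus> \<beta>) (image_mset frob (V i))"
    using V[OF assms(1)] by (simp add: stable_def)
  also have "\<dots> = mprod (\<lambda>\<beta>. frob x \<ominus> frob \<beta>) (V i)"
    using V_carrier[OF assms(1)] assms(2) by (intro mprod_image) auto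
  also have "\<dots> = mprod (\<lambda>\<beta>. frob (x \<ominus> \<beta>)) (V i)"
    using V_carrier[OF assms(1)] assms(2)
    by (intro mprod_cong) (auto simp: a_minus_def frob.hom_a_inv)
  also have "\<dots> = frob (mprod (\<lambda>\<beta>. x \<ominus> \<beta>) (V i))"
    by (rule mprod_hom[OF frob_hom c(1), symmetric])
  finally show ?thesis
    using l[OF assms(1)] mprod_closed[OF c(1)] by (simp add: val_def fixed_iff)
qed

lemma val_funpow: "i \<in> I \<Longrightarrow> x \<in> carrier R \<Longrightarrow> val i ((frob ^^ k) x) = (frob ^^ k) (val i x)"
  by (induction k) (auto simp: val_frob funpow_closed)

lemma val_eq_zero_iff:
  assumes "i \<in> I" "x \<in> carrier R"
  shows "val i x = \<zero> \<longleftrightarrow> x \<in># V i"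
proof -
  have c: "(\<lambda>\<beta>. x \<ominus> \<beta>) \<in> set_mset (V i) \<rightarrow> carrier R" using V_carrier assms by auto
  have "val i x = \<zero> \<longleftrightarrow> (\<exists>\<beta>\<in>#V i. x \<ominus> \<beta> = \<zero>)"
    unfolding val_def using l[OF assms(1)] l_carrier[OF assms(1)] mprod_closed[OF c]
    by (simp add: integral_iff mprod_eq_zero_iff[OF c])
  also have "\<dots> \<longleftrightarrow> x \<in># V i" using V_carrier assms by (auto simp: subset_iff)
  finally show ?thesis .
qed

lemma mprod_val_fixed: "i \<in> I \<Longrightarrow> stable M \<Longrightarrow> mprod (val i) M \<in> fixed"
  by (rule mprod_fixed) (auto simp: val_closed val_frob)

lemma symb_add:
  assumes "i \<in> I" "stable M" "stable N"
  shows "symb i (M + N) = symb i M * symb i N"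
proof -
  have "val i \<in> set_mset (M + N) \<rightarrow> carrier R"
    using assms val_closed by (auto simp: stable_def)
  then show ?thesis
    using assms by (simp add: symb_def mprod_union eta_mult mprod_val_fixed)
qed

lemma symb_eq_zero_iff:
  assumes "i \<in> I" "stable M"
  shows "symb i M = 0 \<longleftrightarrow> (\<exists>x\<in>#M. x \<in># V i)"
proof -
  have M: "set_mset M \<subseteq> carrier R" using assms by (simp add: stable_def)
  then have "val i \<in> set_mset M \<rightarrow> carrier R" using assms val_closed by auto
  then have "symb i M = 0 \<longleftrightarrow> (\<exists>x\<in>#M. val i x = \<zero>)"
    by (simp add: symb_def eta_zero_iff mprod_eq_zero_iff)
  also have "\<dots> \<longleftrightarrow> (\<exists>x\<in>#M. x \<in># V i)"
    using M val_eq_zero_iff[OF assms(1)] by auto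
  finally show ?thesis .
qed

lemma symb_cases: "symb i M \<in> {-1, 0, 1}"
  unfolding symb_def by (rule eta_cases)

lemma symb_orbit_eq_zero_iff:
  assumes "i \<in> I" "j \<ge> 1" "x \<in> fixpts j"
  shows "symb i (orbit_mset j x) = 0 \<longleftrightarrow> x \<in># V i"
proof -
  have x: "x \<in> carrier R" using assms by (simp add: fixpts_def)
  have "symb i (orbit_mset j x) = 0 \<longleftrightarrow> (\<exists>k\<in>{0..<j}. (frob ^^ k) x \<in># V i)"
    using symb_eq_zero_iff[OF assms(1) stable_orbit_mset[OF assms(3)]] by (auto simp: orbit_mset_def)
  also have "\<dots> \<longleftrightarrow> x \<in># V i"
    using count_stable_funpow[OF V[OF assms(1)] x] assms(2)
    by (auto simp flip: count_greater_zero_iff intro!: bexI[of _ 0] exI[of _ 0])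
  finally show ?thesis .
qed

text \<open>The conjugates of y multiply to an element b of the fixed field, and the product
  defining the symbol is b^2. Read contrapositively, -1 certifies a nonsquare in the field with q^j
  elements.\<close>

lemma symb_square_neq_minus_one:
  assumes "i \<in> I" "x \<in> fixpts j" "y \<in> fixpts j" "val i x = y \<otimes> y"
  shows "symb i (orbit_mset j x) \<noteq> -1"
proof -
  have c: "x \<in> carrier R" "y \<in> carrier R" using assms by (auto simp: fixpts_def)
  define b where "b = mprod (\<lambda>x. x) (orbit_mset j y)"
  have b: "b \<in> fixed"
    unfolding b_def using stable_orbit_mset[OF assms(3)] by (rule mprod_fixed) auto
  have sq: "val i ((frob ^^ k) x) = (frob ^^ k) y \<otimes> (frob ^^ k) y" for k
  proof -
    have "(frob ^^ k) (y \<otimes> y) = (frob ^^ k) y \<otimes> (frob ^^ k) y"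
      by (induction k) (use c funpow_closed in auto)
    then show ?thesis using val_funpow assms c by simp
  qed
  have "mprod (val i) (orbit_mset j x) = mprod (\<lambda>k. (frob ^^ k) y \<otimes> (frob ^^ k) y) (mset [0..<j])"
    using mprod_orbit_mset[of "val i" x j] val_closed[OF assms(1)] c by (simp add: sq)
  also have "\<dots> = b \<otimes> b"
    unfolding b_def using c funpow_closed mprod_orbit_mset[of "\<lambda>x. x" y j]
    by (subst mprod_mult) auto
  finally show ?thesis using b eta_cases[of b] by (auto simp: symb_def eta_mult)
qed

text \<open>Rescaling the values on \<open>Z\<close> by the weight of \<beta> permutes the monic
  polynomials of degree n and multiplies the i-th symbol by -1 to the power
  \<open>count (V i) \<beta>\<close>. These signs multiply to -1 over S, so the sum equals its
  negative: orthogonality for a nontrivial character.\<close>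

lemma sum_symb_eq_zero:
  assumes S: "S \<subseteq> I" "S \<noteq> {}" and n: "card Z \<le> n"
  shows "(\<Sum>M\<in>stable_of_size n. \<Prod>i\<in>S. symb i M) = 0"
proof -
  obtain \<beta> where \<beta>: "\<beta> \<in> carrier R" "odd (\<Sum>i\<in>S. count (V i) \<beta>)"
    using odd_mult[OF S] by blast
  have "\<exists>i\<in>S. count (V i) \<beta> \<noteq> 0"
  proof (rule ccontr)
    assume "\<not> ?thesis"
    then have "(\<Sum>i\<in>S. count (V i) \<beta>) = 0" by (intro sum.neutral) (auto simp: not_in_iff)
    then show False using \<beta>(2) by simp
  qed
  then obtain i0 where i0: "i0 \<in> S" "\<beta> \<in># V i0" by (auto simp: not_in_iff)
  have frobV: "frob x \<in># V i" if "i \<in> I" "x \<in># V i" for i x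
    using V[OF that(1)] that(2) by (metis image_eqI set_image_mset stable_def)
  \<comment> \<open>\<open>V i0\<close> is finite and closed under Frobenius, which makes its
    element \<beta> periodic.\<close>
  obtain m where m: "m \<ge> 1" "(frob ^^ m) \<beta> = \<beta>"
    using exists_period[of "set_mset (V i0)" \<beta>] i0 S V_carrier frobV by blast
  obtain w where w: "\<And>z. z \<in> carrier R \<Longrightarrow> w z \<in> carrier R - {\<zero>}"
      "\<And>z. z \<in> carrier R \<Longrightarrow> w (frob z) = frob (w z)"
      "\<And>V. stable V \<Longrightarrow> mprod w V \<in> fixed" "\<And>V. stable V \<Longrightarrow> eta (mprod w V) = (-1) ^ count V \<beta>"
    using exists_equivariant_weight[OF \<beta>(1) m] by blast
  have Zp: "finite Z" "Z \<subseteq> carrier R" "frob ` Z \<subseteq> Z"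
    using finite_I V_carrier frobV by (auto simp: Z_def)
  obtain T where T: "bij_betw T (stable_of_size n) (stable_of_size n)"
      "\<And>M z. M \<in> stable_of_size n \<Longrightarrow> z \<in> Z \<Longrightarrow>
        mprod (\<lambda>\<alpha>. z \<ominus> \<alpha>) (T M) = w z \<otimes> mprod (\<lambda>\<alpha>. z \<ominus> \<alpha>) M"
    using exists_rescaling_permutation[OF Zp n, of w] w(1,2) Zp(2) by blast
  have step: "symb i (T M) = (-1) ^ count (V i) \<beta> * symb i M" if i: "i \<in> I" and M: "M \<in> stable_of_size n" for i M
  proof -
    \<comment> \<open>The power of the leading coefficient and the reciprocity sign depend on i and
      n only, so M and T M share the constant \<open>c\<close>.\<close>
    define c where "c = l i [^] n \<otimes> (\<ominus> \<one>) [^] (size (V i) * n)"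
    have c: "c \<in> carrier R" unfolding c_def using l_carrier[OF i] by simp
    let ?m = "\<lambda>M \<beta>. mprod (\<lambda>\<alpha>. \<beta> \<ominus> \<alpha>) M"
    have recip: "mprod (val i) N = c \<otimes> mprod (?m N) (V i)" if N: "N \<in> stable_of_size n" for N
    proof -
      have Nc: "set_mset N \<subseteq> carrier R" "size N = n" using N by (auto simp: stable_of_size_def stable_def)
      have "val i = (\<lambda>x. l i \<otimes> mprod (\<lambda>\<beta>. x \<ominus> \<beta>) (V i))" by (simp add: fun_eq_iff val_def)
      moreover have "(\<lambda>x. mprod (\<lambda>\<beta>. x \<ominus> \<beta>) (V i)) \<in> set_mset N \<rightarrow> carrier R"
        using Nc V_carrier[OF i] by (auto intro!: mprod_closed)
      ultimately have "mprod (val i) N = l i [^] n \<otimes> mprod (\<lambda>x. mprod (\<lambda>\<beta>. x \<ominus> \<beta>) (V i)) N"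
        using l_carrier[OF i] Nc by (simp add: mprod_mult mprod_const)
      moreover have "mprod (?m N) (V i) \<in> carrier R"
        using Nc V_carrier[OF i] by (auto intro!: mprod_closed)
      ultimately show ?thesis
        using mprod_differences_swap[OF Nc(1) V_carrier[OF i]] l_carrier[OF i] Nc(2)
        by (simp add: c_def m_assoc)
    qed
    have TM: "T M \<in> stable_of_size n" using T(1) M by (auto dest: bij_betwE)
    have mc: "?m M \<in> set_mset (V i) \<rightarrow> carrier R"
      using M V_carrier[OF i] by (auto simp: stable_of_size_def stable_def intro!: mprod_closed)
    have wc: "w \<in> set_mset (V i) \<rightarrow> carrier R" using w(1) V_carrier[OF i] by auto
    have "mprod (?m (T M)) (V i) = mprod (\<lambda>\<beta>. w \<beta> \<otimes> ?m M \<beta>) (V i)"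
      by (rule mprod_cong) (use T(2)[OF M] i mc wc in \<open>auto simp: Z_def\<close>)
    also have "\<dots> = mprod w (V i) \<otimes> mprod (?m M) (V i)" by (rule mprod_mult[OF wc mc])
    finally have "mprod (val i) (T M) = mprod w (V i) \<otimes> mprod (val i) M"
      unfolding recip[OF TM] recip[OF M] using c mprod_closed[OF wc] mprod_closed[OF mc]
      by (simp add: m_lcomm)
    then show ?thesis
      unfolding symb_def using w(3,4)[OF V[OF i]] mprod_val_fixed[OF i, of M] M
      by (simp add: eta_mult stable_of_size_def)
  qed
  have "(\<Sum>M\<in>stable_of_size n. \<Prod>i\<in>S. symb i M) = (\<Sum>M\<in>stable_of_size n. \<Prod>i\<in>S. symb i (T M))"
    using sum.reindex_bij_betw[OF T(1), of "\<lambda>M. \<Prod>i\<in>S. symb i M"] by simp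
  also have "\<dots> = (\<Sum>M\<in>stable_of_size n. - (\<Prod>i\<in>S. symb i M))"
  proof (rule sum.cong)
    fix M assume "M \<in> stable_of_size n"
    then have "(\<Prod>i\<in>S. symb i (T M)) = (\<Prod>i\<in>S. (-1) ^ count (V i) \<beta>) * (\<Prod>i\<in>S. symb i M)"
      using S step by (simp add: subset_iff prod.distrib[symmetric])
    also have "(\<Prod>i\<in>S. (-1::real) ^ count (V i) \<beta>) = -1"
      using \<beta>(2) by (simp add: power_sum[symmetric])
    finally show "(\<Prod>i\<in>S. symb i (T M)) = - (\<Prod>i\<in>S. symb i M)" by simp
  qed simp
  finally show ?thesis by (simp add: sum_negf)
qed

end

section \<open>Simultaneous values of quadratic symbols\<close>

context quadratic_symbols
begin

lemma prod_symb_bounded: "\<bar>\<Prod>i\<in>S. symb i M\<bar> \<le> 1"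
proof -
  have "\<bar>symb i M\<bar> \<le> 1" for i using symb_cases[of i M] by auto
  then show ?thesis unfolding abs_prod by (intro prod_le_1) auto
qed

text \<open>Going round twice squares the symbol. This is the origin of the factors 2 in
  \<open>D\<close> and \<open>N\<close> below.\<close>

lemma symb_double_orbit:
  assumes "i \<in> I" "j \<ge> 1" "x \<in> fixpts j"
  shows "symb i (orbit_mset (2 * j) x) = (if x \<in># V i then 0 else 1)"
proof -
  have "orbit_mset (2 * j) x = orbit_mset j x + orbit_mset j x"
    using orbit_mset_add[of j j x] assms(3) by (simp add: fixpts_def mult_2)
  then have "symb i (orbit_mset (2 * j) x) = symb i (orbit_mset j x) * symb i (orbit_mset j x)"
    using assms stable_orbit_mset by (simp add: symb_add)
  then show ?thesis
    using symb_orbit_eq_zero_iff[OF assms] symb_cases[of i "orbit_mset j x"] by auto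
qed

lemma common_period:
  assumes "finite E" "\<And>x. x \<in> E \<Longrightarrow> \<exists>j\<ge>1. x \<in> fixpts j"
  shows "\<exists>N\<ge>1. \<forall>x\<in>E. x \<in> fixpts N"
  using assms
proof (induction rule: finite_induct)
  case (insert x E)
  then obtain j where j: "j \<ge> 1" "x \<in> fixpts j" by blast
  obtain N where N: "N \<ge> 1" "\<forall>x\<in>E. x \<in> fixpts N" using insert by blast
  have "x \<in> fixpts (N * j)"
    using j funpow_period_mult[of j x N] by (simp add: fixpts_def mult.commute)
  moreover have "y \<in> fixpts (N * j)" if "y \<in> E" for y
    using N that funpow_period_mult[of N y j] by (simp add: fixpts_def)
  moreover have "N * j \<ge> 1" using N j by simp
  ultimately show ?case by blast
qed auto

text \<open>Expansion of the product of the factors 1 - symbol, which vanishes as soon as one symbol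
  equals 1.\<close>

lemma sum_over_subsets_symb:
  "(\<Sum>S\<in>Pow I. (-1) ^ card S * (\<Sum>x\<in>fixpts j. \<Prod>i\<in>S. symb i (orbit_mset j x))) =
    (\<Sum>x\<in>fixpts j. \<Prod>i\<in>I. 1 - symb i (orbit_mset j x))"
proof -
  have "(\<Prod>i\<in>I. 1 - symb i (orbit_mset j x)) =
      (\<Sum>S\<in>Pow I. (-1) ^ card S * (\<Prod>i\<in>S. symb i (orbit_mset j x)))" for x
  proof -
    have "(\<Prod>i\<in>I. 1 - symb i (orbit_mset j x)) = (\<Prod>i\<in>I. (-1) * symb i (orbit_mset j x) + 1)"
      by (rule prod.cong) auto
    also have "\<dots> = (\<Sum>S\<in>Pow I. \<Prod>i\<in>S. (-1) * symb i (orbit_mset j x))"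
      by (subst prod_add[OF finite_I]) simp
    also have "\<dots> = (\<Sum>S\<in>Pow I. (-1) ^ card S * (\<Prod>i\<in>S. symb i (orbit_mset j x)))"
      by (rule sum.cong[OF refl], subst prod.distrib) simp
    finally show ?thesis .
  qed
  then have "(\<Sum>x\<in>fixpts j. \<Prod>i\<in>I. 1 - symb i (orbit_mset j x)) =
      (\<Sum>x\<in>fixpts j. \<Sum>S\<in>Pow I. (-1) ^ card S * (\<Prod>i\<in>S. symb i (orbit_mset j x)))"
    by simp
  also have "\<dots> = (\<Sum>S\<in>Pow I. \<Sum>x\<in>fixpts j. (-1) ^ card S * (\<Prod>i\<in>S. symb i (orbit_mset j x)))"
    by (rule sum.swap)
  finally show ?thesis by (simp add: sum_distrib_left)
qed

lemma infinite_all_symb_minus_one: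
  "infinite {x \<in> carrier R. \<exists>j\<ge>1. x \<in> fixpts j \<and> (\<forall>i\<in>I. symb i (orbit_mset j x) = -1)}"
proof
  let ?G = "{x \<in> carrier R. \<exists>j\<ge>1. x \<in> fixpts j \<and> (\<forall>i\<in>I. symb i (orbit_mset j x) = -1)}"
  assume fin: "finite ?G"
  \<comment> \<open>A periodic point outside \<open>E\<close> has some symbol equal to 1 for each of
    its periods, so only the finite set \<open>E\<close> contributes to the alternating sum.\<close>
  define E where "E = ?G \<union> {x \<in> Z. \<exists>j\<ge>1. x \<in> fixpts j}"
  have finZ: "finite Z" using finite_I by (simp add: Z_def)
  have "\<exists>N\<ge>1. \<forall>x\<in>E. x \<in> fixpts N"
    by (rule common_period) (use fin finZ in \<open>auto simp: E_def\<close>)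
  then obtain N where N: "N \<ge> 1" "\<And>x. x \<in> E \<Longrightarrow> x \<in> fixpts N" by blast
  \<comment> \<open>The field with q^(s+1) elements is chosen larger than \<open>Z\<close>, so that
    it contains a point x0 where no symbol vanishes. Over two rounds all symbols of x0 are 1, which
    supplies the strictly positive term along the multiples of 2(s + 1).\<close>
  obtain s where "real (card Z) < real q ^ s"
    using q_gt_1 real_arch_pow[of "real q" "real (card Z)"] by auto
  then have "card Z < q ^ s" by (metis of_nat_less_iff of_nat_power)
  also have "q ^ s \<le> q ^ Suc s" using q_gt_1 by simp
  finally have s1: "card Z < q ^ Suc s" .
  have "\<not> fixpts (Suc s) \<subseteq> Z"
    using card_mono[OF finZ, of "fixpts (Suc s)"] s1 card_fixpts[of "Suc s"] by (metis One_nat_def Suc_le_mono le0 not_less)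
  then obtain x0 where x0: "x0 \<in> fixpts (Suc s)" "x0 \<notin> Z" by blast
  define a where "a S n = (\<Sum>M\<in>stable_of_size n. \<Prod>i\<in>S. symb i M)" for S n
  define psi where "psi S j = (\<Sum>x\<in>fixpts j. \<Prod>i\<in>S. symb i (orbit_mset j x))" for S j
  have psi_sum: "psi {} j + psi S j = (\<Sum>x\<in>fixpts j. 1 + (\<Prod>i\<in>S. symb i (orbit_mset j x)))" for S j
    by (simp add: psi_def sum.distrib)
  have term_nonneg: "1 + (\<Prod>i\<in>S. symb i M) \<ge> 0" for S M
    using prod_symb_bounded[where S = S and M = M] by linarith
  show False
  \<comment> \<open>The empty subset yields the zeta function, and the signs
    \<open>(-1) ^ card S\<close> are those of the expansion over subsets.\<close>
  proof (rule log_deriv_combination_not_periodic[where J = "Pow I" and ?s0.0 = "{}" and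
        \<sigma> = "\<lambda>S. (-1) ^ card S" and q = "real q" and a = a and psi = psi and r = "card Z" and
        D = "2 * Suc s" and N = "2 * N"])
    show "finite (Pow I)" using finite_I by simp
    show "1 < real q" using q_gt_1 by simp
    show "real n * a S n = (\<Sum>j = 1..n. psi S j * a S (n - j))" if "S \<in> Pow I" for S n
      unfolding a_def psi_def
    proof (rule log_derivative_recurrence)
      show "(\<Prod>i\<in>S. symb i (M + M')) = (\<Prod>i\<in>S. symb i M) * (\<Prod>i\<in>S. symb i M')"
        if "stable M" "stable M'" for M M'
        unfolding prod.distrib[symmetric] using that \<open>S \<in> Pow I\<close> by (intro prod.cong) (auto simp: symb_add)
    qed (auto simp: finite_fixpts finite_stable_of_size)
    show "a S 0 = 1" if "S \<in> Pow I" for S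
    proof -
      have "stable_of_size 0 = {{#}}" by (auto simp: stable_of_size_def stable_def)
      then show ?thesis by (simp add: a_def symb_def)
    qed
    show "a {} n = real q ^ n" for n by (simp add: a_def card_stable_of_size)
    show "a S n = 0" if "S \<in> Pow I - {{}}" "n \<ge> card Z" for S n
      using sum_symb_eq_zero[of S n] that by (simp add: a_def)
    show "psi {} j + psi S j \<ge> 0" for S j
      unfolding psi_sum by (rule sum_nonneg) (rule term_nonneg)
    show "psi {} (2 * Suc s * k) + psi S (2 * Suc s * k) > 0"
      if S: "S \<in> Pow I - {{}}" and k: "k \<ge> 1" for S k
      unfolding psi_sum
    proof (rule sum_pos2)
      have per: "x0 \<in> fixpts (Suc s * k)"
        using x0(1) funpow_period_mult[of "Suc s" x0 k] by (simp add: fixpts_def del: mult_Suc funpow.simps)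
      have "x0 \<in> fixpts (2 * (Suc s * k))"
        using per funpow_period_mult[of "Suc s * k" x0 2] by (simp only: fixpts_def mult.commute) simp
      then show "x0 \<in> fixpts (2 * Suc s * k)" by (simp only: mult.assoc)
      have "symb i (orbit_mset (2 * (Suc s * k)) x0) = 1" if "i \<in> S" for i
        using symb_double_orbit[of i "Suc s * k" x0] per S that x0(2) k by (auto simp: Z_def)
      then show "0 < 1 + (\<Prod>i\<in>S. symb i (orbit_mset (2 * Suc s * k) x0))"
        by (simp only: mult.assoc) simp
      show "finite (fixpts (2 * Suc s * k))" using k by (intro finite_fixpts) simp
    qed (rule term_nonneg)
    have psi_E: "(\<Sum>S\<in>Pow I. (-1) ^ card S * psi S j) =
        (\<Sum>x\<in>fixpts j \<inter> E. \<Prod>i\<in>I. 1 - symb i (orbit_mset j x))" if j: "j \<ge> 1" for j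
      unfolding psi_def sum_over_subsets_symb
    proof (rule sum.mono_neutral_right)
      show "\<forall>x\<in>fixpts j - fixpts j \<inter> E. (\<Prod>i\<in>I. 1 - symb i (orbit_mset j x)) = 0"
      proof
        fix x assume x: "x \<in> fixpts j - fixpts j \<inter> E"
        then have xc: "x \<in> carrier R" "x \<notin> Z" "x \<notin> ?G" using j by (auto simp: E_def fixpts_def)
        then obtain i where i: "i \<in> I" "symb i (orbit_mset j x) \<noteq> -1" using j x by auto
        moreover have "symb i (orbit_mset j x) \<noteq> 0"
          using symb_orbit_eq_zero_iff[of i j x] i(1) j x xc(2) by (auto simp: Z_def)
        ultimately have "symb i (orbit_mset j x) = 1" using symb_cases[of i "orbit_mset j x"] by auto
        then show "(\<Prod>i\<in>I. 1 - symb i (orbit_mset j x)) = 0"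
          using finite_I i(1) by (auto intro!: prod_zero)
      qed
    qed (use finite_fixpts[OF j] in auto)
    show "(\<Sum>S\<in>Pow I. (-1) ^ card S * psi S (j + 2 * N)) = (\<Sum>S\<in>Pow I. (-1) ^ card S * psi S j)"
      if j: "j \<ge> 1" for j
    proof -
      have per: "(frob ^^ (2 * N)) x = x" if "x \<in> E" for x
        using N(2)[OF that] funpow_period_mult[of N x 2] by (simp add: fixpts_def mult.commute)
      have eqfix: "fixpts (j + 2 * N) \<inter> E = fixpts j \<inter> E"
        using per by (auto simp: fixpts_def funpow_add)
      have "(\<Prod>i\<in>I. 1 - symb i (orbit_mset (j + 2 * N) x)) = (\<Prod>i\<in>I. 1 - symb i (orbit_mset j x))"
        if x: "x \<in> fixpts j \<inter> E" for x
      proof (rule prod.cong)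
        fix i assume i: "i \<in> I"
        have "orbit_mset (j + 2 * N) x = orbit_mset j x + orbit_mset (2 * N) x"
          using x by (simp add: orbit_mset_add fixpts_def)
        moreover have "x \<in> fixpts (2 * N)" using x per by (auto simp: fixpts_def)
        ultimately have "symb i (orbit_mset (j + 2 * N) x) =
            symb i (orbit_mset j x) * symb i (orbit_mset (2 * N) x)"
          using x i stable_orbit_mset by (simp add: symb_add)
        \<comment> \<open>The 2N extra steps contribute the factor 1, unless x is a zero of the i-th
          polynomial and both sides are 0.\<close>
        also have "\<dots> = symb i (orbit_mset j x)"
          using symb_double_orbit[OF i N(1)] symb_orbit_eq_zero_iff[OF i j] N(2) x by auto
        finally show "1 - symb i (orbit_mset (j + 2 * N) x) = 1 - symb i (orbit_mset j x)" by simp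
      qed simp
      then show ?thesis using psi_E[of j] psi_E[of "j + 2 * N"] j eqfix by simp
    qed
  qed (use N(1) in auto)
qed

end

section \<open>The Frobenius endomorphism of a finite field\<close>

context cring
begin

lemma nat_mult_left_one: "x \<in> carrier R \<Longrightarrow> add_pow R (n::nat) x = (add_pow R n \<one>) \<otimes> x"
  using add_pow_ldistr[of \<one> x n] by simp

lemma binomial_theorem:
  assumes x: "x \<in> carrier R" and y: "y \<in> carrier R"
  shows "(x \<oplus> y) [^] (n::nat) = (\<Oplus>k\<in>{..n}. add_pow R (n choose k) (x [^] k \<otimes> y [^] (n - k)))"
proof (induction n)
  case (Suc n)
  let ?t = "\<lambda>m k. add_pow R (n choose k) (x [^] k \<otimes> y [^] (m - k))"
  let ?u = "\<lambda>k. add_pow R (n choose k) (x [^] Suc k \<otimes> y [^] (n - k))"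
  have tc: "?t m \<in> A \<rightarrow> carrier R" "?u \<in> A \<rightarrow> carrier R" for m A using x y by auto
  have ux: "?t n k \<otimes> x = ?u k" for k
    using x y add_pow_ldistr[of "x [^] k \<otimes> y [^] (n - k)" x] m_comm[of "y [^] (n - k)" x]
    by (simp add: m_assoc)
  have uy: "?t n k \<otimes> y = ?t (Suc n) k" if "k \<le> n" for k
    using x y that add_pow_ldistr[of "x [^] k \<otimes> y [^] (n - k)" y] by (simp add: m_assoc Suc_diff_le)
  have "(x \<oplus> y) [^] Suc n = (\<Oplus>k\<in>{..n}. ?t n k) \<otimes> x \<oplus> (\<Oplus>k\<in>{..n}. ?t n k) \<otimes> y"
    using x y tc by (simp add: Suc r_distr finsum_closed)
  also have "(\<Oplus>k\<in>{..n}. ?t n k) \<otimes> x = (\<Oplus>k\<in>{..n}. ?u k)"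
    using x tc by (simp add: finsum_ldistr ux)
  also have "(\<Oplus>k\<in>{..n}. ?t n k) \<otimes> y = (\<Oplus>k\<in>{..n}. ?t (Suc n) k)"
    using y tc by (subst finsum_ldistr) (auto intro!: finsum_cong' simp: uy)
  also have "\<dots> = (\<Oplus>k\<in>{..Suc n}. ?t (Suc n) k)"
    using x y tc by (subst finsum_Suc) (auto simp: binomial_eq_0)
  also have "\<dots> = (\<Oplus>k\<in>{..n}. ?t (Suc n) (Suc k)) \<oplus> ?t (Suc n) 0"
    by (rule finsum_Suc2) (rule tc)
  also have "(\<Oplus>k\<in>{..n}. ?u k) \<oplus> ((\<Oplus>k\<in>{..n}. ?t (Suc n) (Suc k)) \<oplus> ?t (Suc n) 0)
      = (\<Oplus>k\<in>{..n}. ?u k \<oplus> ?t (Suc n) (Suc k)) \<oplus> ?t (Suc n) 0"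
    using x y tc by (subst finsum_addf) (auto simp: a_assoc finsum_closed)
  also have "(\<Oplus>k\<in>{..n}. ?u k \<oplus> ?t (Suc n) (Suc k)) =
      (\<Oplus>k\<in>{..n}. add_pow R (Suc n choose Suc k) (x [^] Suc k \<otimes> y [^] (Suc n - Suc k)))"
    by (rule finsum_cong') (use x y in \<open>auto simp: add.nat_pow_mult\<close>)
  also have "\<dots> \<oplus> ?t (Suc n) 0 = (\<Oplus>k\<in>{..Suc n}. add_pow R (Suc n choose k) (x [^] k \<otimes> y [^] (Suc n - k)))"
    using x y by (subst finsum_Suc2) auto
  finally show ?case .
qed (use x y in simp)

lemma frobenius_add:
  fixes p :: nat
  assumes p: "Factorial_Ring.prime p" "add_pow R p \<one> = \<zero>" and x: "x \<in> carrier R" and y: "y \<in> carrier R"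
  shows "(x \<oplus> y) [^] p = x [^] p \<oplus> y [^] p"
proof -
  let ?t = "\<lambda>k. add_pow R (p choose k) (x [^] k \<otimes> y [^] (p - k))"
  have zero: "?t k = \<zero>" if "0 < k" "k < p" for k
  proof -
    have "p dvd (p choose k)" using that p(1) by (intro dvd_choose_prime) auto
    then obtain m where m: "p choose k = p * m" by (elim dvdE)
    have "add_pow R (p choose k) \<one> = \<zero>"
      unfolding m using p(2) add.nat_pow_pow[of \<one> m p] by simp
    then show ?thesis using nat_mult_left_one[of "x [^] k \<otimes> y [^] (p - k)" "p choose k"] x y by simp
  qed
  have p1: "p > 1" using p(1) prime_gt_1_nat by blast
  then have "p = Suc (Suc (p - 2))" by simp
  then obtain m where m: "p = Suc (Suc m)" by blast
  have "(x \<oplus> y) [^] p = (\<Oplus>k\<in>{..Suc (Suc m)}. ?t k)"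
    using binomial_theorem[OF x y, of p] m by simp
  also have "\<dots> = ?t p \<oplus> (\<Oplus>k\<in>{..Suc m}. ?t k)"
    using x y m by (subst finsum_Suc) auto
  also have "(\<Oplus>k\<in>{..Suc m}. ?t k) = (\<Oplus>k\<in>{..m}. ?t (Suc k)) \<oplus> ?t 0"
    using x y by (subst finsum_Suc2) auto
  also have "(\<Oplus>k\<in>{..m}. ?t (Suc k)) = \<zero>"
    by (rule add.finprod_one_eqI, rule zero) (use m in auto)
  finally show ?thesis using x y by simp
qed

lemma frobenius_pow_add:
  fixes p :: nat
  assumes p: "Factorial_Ring.prime p" "add_pow R p \<one> = \<zero>" and x: "x \<in> carrier R" and y: "y \<in> carrier R"
  shows "(x \<oplus> y) [^] (p ^ m) = x [^] (p ^ m) \<oplus> y [^] (p ^ m)"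
proof (induction m)
  case (Suc m)
  have "(x \<oplus> y) [^] (p ^ Suc m) = ((x \<oplus> y) [^] (p ^ m)) [^] p"
    using x y by (simp add: nat_pow_pow power_Suc2 del: power_Suc)
  also have "\<dots> = (x [^] (p ^ m)) [^] p \<oplus> (y [^] (p ^ m)) [^] p"
    unfolding Suc using x y by (intro frobenius_add[OF p]) auto
  finally show ?case using x y by (simp add: nat_pow_pow power_Suc2 del: power_Suc)
qed (use x y in simp)

end

lemma (in ring_hom_ring) hom_nat_mult:
  "x \<in> carrier R \<Longrightarrow> h (add_pow R (n::nat) x) = add_pow S n (h x)"
  by (induction n) auto

section \<open>Characteristic and cardinality of a finite field\<close>

context field
begin

lemma alg_char_eq_ord:
  assumes "finite (carrier R)"
  shows "alg_char R = add.ord \<one>" and "alg_char R > 0"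
proof -
  have ord: "add.ord \<one> \<ge> 1" using add.ord_ge_1[of \<one>] assms by simp
  have iff: "add_pow R n \<one> = \<zero> \<longleftrightarrow> add.ord \<one> dvd n" for n :: nat
    using add.pow_eq_id[of \<one> n] by simp
  have "(LEAST n::nat. n > 0 \<and> add_pow R n \<one> = \<zero>) = add.ord \<one>"
    unfolding iff using ord by (intro Least_equality) (auto dest: dvd_imp_le)
  moreover have "\<exists>n::nat. n > 0 \<and> add_pow R n \<one> = \<zero>"
    unfolding iff using ord by (intro exI[of _ "add.ord \<one>"]) auto
  ultimately show "alg_char R = add.ord \<one>" by (simp add: alg_char_def)
  then show "alg_char R > 0" using ord by simp
qed

lemma nat_mult_one_eq_zero_iff:
  assumes "finite (carrier R)"
  shows "add_pow R n \<one> = \<zero> \<longleftrightarrow> alg_char R dvd n"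
  using add.pow_eq_id[of \<one> n] alg_char_eq_ord[OF assms] by simp

lemma prime_alg_char:
  assumes "finite (carrier R)"
  shows "Factorial_Ring.prime (alg_char R)"
proof (rule prime_natI)
  have "\<not> alg_char R dvd 1" using nat_mult_one_eq_zero_iff[OF assms, of 1] by simp
  then show "2 \<le> alg_char R" using alg_char_eq_ord(2)[OF assms] by (cases "alg_char R = 1") auto
  fix a b assume "alg_char R dvd a * b"
  then have "add_pow R (a * b) \<one> = \<zero>" using nat_mult_one_eq_zero_iff[OF assms] by simp
  then have "(add_pow R b \<one>) \<otimes> (add_pow R a \<one>) = \<zero>"
    using add.nat_pow_pow[of \<one> b a] nat_mult_left_one[of "add_pow R a \<one>" b] by simp
  then show "alg_char R dvd a \<or> alg_char R dvd b"
    using nat_mult_one_eq_zero_iff[OF assms] integral by fastforce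
qed

text \<open>For a prime r dividing the cardinality there is a nonzero x with r x = 0; cancelling x
  gives r 1 = 0, so r is the characteristic. This form of q is what makes the q-th power map
  additive.\<close>

lemma card_eq_alg_char_power:
  assumes fin: "finite (carrier R)"
  shows "\<exists>m. card (carrier R) = alg_char R ^ m"
proof -
  let ?n = "card (carrier R)"
  have n0: "?n > 0" using fin by (auto simp: card_gt_0_iff)
  have "r = alg_char R" if r: "Factorial_Ring.prime r" "r dvd ?n" for r
  proof -
    \<comment> \<open>With exponent 1, Sylow's existence theorem becomes Cauchy's theorem.\<close>
    obtain k where k: "?n = r ^ 1 * k" using r(2) by (auto elim: dvdE)
    obtain H where H: "subgroup H (add_monoid R)" "card H = r ^ 1"
      using sylow_thm[OF r(1) add.is_group, of 1 k] k fin by (auto simp: order_def)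
    have "card H > 1" using H(2) r(1) prime_gt_1_nat by simp
    moreover have "\<zero> \<in> H" using subgroup.one_closed[OF H(1)] by simp
    ultimately obtain x where x: "x \<in> H" "x \<noteq> \<zero>"
      by (metis card_1_singleton_iff card.empty is_singletonI' is_singleton_def less_irrefl less_numeral_extra(4) One_nat_def empty_iff)
    have xc: "x \<in> carrier R" using subgroup.subset[OF H(1)] x by auto
    interpret H: group "add_monoid R\<lparr>carrier := H\<rparr>" by (rule add.subgroup_imp_group[OF H(1)])
    have "x [^]\<^bsub>add_monoid R\<lparr>carrier := H\<rparr>\<^esub> order (add_monoid R\<lparr>carrier := H\<rparr>) = \<zero>"
      using H.pow_order_eq_1[of x] x(1) by simp
    then have "add_pow R r x = \<zero>"
      using H(2) by (simp add: order_def add_pow_def nat_pow_def)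
    then have "(add_pow R r \<one>) \<otimes> x = \<zero>" using nat_mult_left_one[OF xc] by simp
    then have "add_pow R r \<one> = \<zero>" using xc x(2) integral by fastforce
    then have "alg_char R dvd r" using nat_mult_one_eq_zero_iff[OF fin] by simp
    then show ?thesis using r(1) prime_alg_char[OF fin] primes_dvd_imp_eq by metis
  qed
  then have "prime_factors ?n \<subseteq> {alg_char R}" by (auto simp: prime_factors_dvd)
  then consider "prime_factors ?n = {}" | "prime_factors ?n = {alg_char R}" by blast
  moreover have prod: "(\<Prod>r\<in>prime_factors ?n. r ^ multiplicity r ?n) = ?n"
    using prod_prime_factors[of ?n] n0 by simp
  ultimately show ?thesis
  proof cases
    case 1
    then show ?thesis using prod by (intro exI[of _ 0]) simp
  next
    case 2
    then show ?thesis using prod by (intro exI[of _ "multiplicity (alg_char R) ?n"]) simp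
  qed
qed

lemma pow_card_eq_self:
  assumes "finite (carrier R)" "x \<in> carrier R"
  shows "x [^] card (carrier R) = x"
proof -
  have pos: "card (carrier R) > 0" using assms by (auto simp: card_gt_0_iff)
  show ?thesis
  proof (cases "x = \<zero>")
    case True
    then show ?thesis using pos by (simp add: nat_pow_zero)
  next
    case False
    interpret M: group "Multiplicative_Group.mult_of R" by (rule field_mult_group)
    have "x [^] (card (carrier R) - 1) = \<one>"
      using M.pow_order_eq_1[of x] False assms order_mult_of[OF assms(1)]
      by (simp add: Multiplicative_Group.nat_pow_mult_of order_def)
    then have "x [^] Suc (card (carrier R) - 1) = x" using assms(2) by simp
    then show ?thesis using pos by simp
  qed
qed

end

section \<open>The four quadratic conditions\<close>

lemma (in domain) poly_of_const_hom: "poly_of_const \<in> ring_hom R (poly_ring R)"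
  using canonical_embedding_is_hom[OF carrier_is_subring] by simp

text \<open>With a = x^p and k = d x + m these are the elements -c k and c (c a^2 + k) of the
  irreducibility criterion; m = 0 belongs to \<open>Pi1\<close>, and m = 1 to \<open>Pi2\<close>
  with 4c and 4d for c and d. S is the field in which square roots are sought.\<close>

definition (in ring) biquadratic_nonsquares :: "'a set \<Rightarrow> nat \<Rightarrow> 'a \<Rightarrow> 'a \<Rightarrow> 'a \<Rightarrow> 'a \<Rightarrow> bool" where
  "biquadratic_nonsquares S p c d m x \<longleftrightarrow> (\<forall>y\<in>S. y \<otimes> y \<noteq> \<ominus> (c \<otimes> (d \<otimes> x \<oplus> m)) \<and>
    y \<otimes> y \<noteq> c \<otimes> (c \<otimes> (x [^] p \<otimes> x [^] p) \<oplus> (d \<otimes> x \<oplus> m)))"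

context frobenius_field
begin

text \<open>Separability comes from expanding about a root a. Since X^p = (X - a)^p + a^p and p
  \<ge> 2, X^(2p) is congruent to a^(2p) and the whole trinomial to e (X - a) modulo (X - a)^2; a
  double root would force e = 0.\<close>

lemma separable_trinomial:
  fixes p :: nat
  assumes p: "Factorial_Ring.prime p" "add_pow R p \<one> = \<zero>"
    and e: "e \<in> fixed" "e \<noteq> \<zero>" and h: "h \<in> fixed"
  shows "\<exists>W. stable W \<and> size W = 2 * p \<and> (\<forall>\<beta>. count W \<beta> \<le> 1) \<and>
    (\<forall>x\<in>carrier R. mprod (\<lambda>\<beta>. x \<ominus> \<beta>) W = x [^] p \<otimes> x [^] p \<oplus> (e \<otimes> x \<oplus> h))"
proof -
  let ?U = "poly_ring R"
  interpret UP: domain ?U by (rule univ_poly_is_domain[OF carrier_is_subring])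
  interpret C: ring_hom_ring R ?U poly_of_const
    by (rule ring_hom_ringI2[OF ring_axioms UP.ring_axioms poly_of_const_hom])
  have p2: "p \<ge> 2" using p(1) prime_ge_2_nat by blast
  have ec: "e \<in> carrier R" "h \<in> carrier R" using e h by (auto simp: fixed_iff)
  \<comment> \<open>The 2p - 2 zeros put e and h in degrees 1 and 0 below the leading term
    X^(2p).\<close>
  define tail where "tail = replicate (2 * p - 2) \<zero> @ [e, h]"
  define P where "P = \<one> # tail"
  have lt: "length tail = 2 * p" using p2 by (simp add: tail_def)
  have tf: "set tail \<subseteq> fixed" using e h by (auto simp: tail_def fixed_iff)
  have tc: "set tail \<subseteq> carrier R" using tf by (auto simp: fixed_iff)
  have PM: "P \<in> monic_fixed (2 * p)"
    using tf lt by (auto simp: P_def monic_fixed_def fixed_iff)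
  note Pf = monic_fixed_split[OF PM]
  have ev: "eval P x = x [^] p \<otimes> x [^] p \<oplus> (e \<otimes> x \<oplus> h)" if x: "x \<in> carrier R" for x
  proof -
    have "eval tail x = e \<otimes> x \<oplus> h"
      unfolding tail_def using eval_replicate[of "[e, h]" x "2 * p - 2"] ec x by simp
    then show ?thesis using x lt by (simp add: P_def nat_pow_mult mult_2)
  qed
  let ?X = "[\<one>, \<zero>]"
  have Xc: "?X \<in> carrier ?U" by (rule poly_ring_memI) auto
  have PX: "P = ?X [^]\<^bsub>?U\<^esub> (2 * p) \<oplus>\<^bsub>?U\<^esub> [e, h]"
  proof -
    have "?X [^]\<^bsub>?U\<^esub> (2 * p) = monom \<one> (2 * p)"
      using unitary_monom_eq_var_pow[OF carrier_is_subring, of "2 * p"] by (simp add: var_def)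
    moreover have "poly_add (monom \<one> (length tail)) tail = \<one> # tail"
      by (rule poly_add_monom) (use tc in auto)
    moreover have "normalize tail = [e, h]"
      unfolding tail_def using normalize_replicate_zero[of "2 * p - 2" "[e, h]"] e by simp
    moreover have "poly_add (monom \<one> (2 * p)) tail = poly_add (monom \<one> (2 * p)) (normalize tail)"
      by (rule poly_add_normalize(2)) (use tc in \<open>auto simp: monom_def\<close>)
    ultimately show ?thesis by (simp add: P_def lt univ_poly_add del: poly_add.simps)
  qed
  have "alg_mult P a \<le> 1" for a
  proof (rule ccontr)
    assume neg: "\<not> alg_mult P a \<le> 1"
    then have "alg_mult P a > 0" by simp
    then have root: "is_root P a" using alg_mult_gt_zero_iff_is_root[OF Pf(4)] by simp
    then have a: "a \<in> carrier R" by (simp add: is_root_def)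
    let ?A = "[\<one>, \<ominus> a]"
    have A: "?A \<in> carrier ?U" using a by (intro poly_ring_memI) auto
    have A0: "?A \<noteq> \<zero>\<^bsub>?U\<^esub>" by (simp add: univ_poly_zero)
    have "(?A [^]\<^bsub>?U\<^esub> (2::nat)) pdivides P"
      using neg by (intro le_alg_mult_imp_pdivides[OF a Pf(4)]) simp
    then obtain g where g: "g \<in> carrier ?U" "P = ?A \<otimes>\<^bsub>?U\<^esub> (?A \<otimes>\<^bsub>?U\<^esub> g)"
      using A unfolding pdivides_def factor_def by (auto simp: numeral_2_eq_2 UP.m_assoc)
    \<comment> \<open>The value of eX + h at a, which is -a^(2p) because a is a root.\<close>
    define k where "k = h \<oplus> e \<otimes> a"
    have kc: "k \<in> carrier R" unfolding k_def using ec a by simp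
    have "a [^] p \<otimes> a [^] p \<oplus> (e \<otimes> a \<oplus> h) = \<zero>"
      using root ev[OF a] by (simp add: is_root_def)
    then have k: "k = \<ominus> (a [^] p \<otimes> a [^] p)"
      unfolding k_def using a ec
      by (metis a_comm add.inv_equality add.m_closed m_closed nat_pow_closed)
    let ?E = "poly_of_const e"
    have Ee: "?E = [e]" using e by (simp add: poly_of_const_def)
    have eh: "[e, h] = ?E \<otimes>\<^bsub>?U\<^esub> ?A \<oplus>\<^bsub>?U\<^esub> poly_of_const k"
    proof -
      have 1: "?E \<otimes>\<^bsub>?U\<^esub> ?A = [e, \<ominus> (e \<otimes> a)]"
        unfolding Ee univ_poly_mult using ec e a by (simp add: r_minus)
      have "poly_add [e, \<ominus> (e \<otimes> a)] (poly_of_const k) = poly_add [e, \<ominus> (e \<otimes> a)] [k]"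
        unfolding poly_of_const_def
        by (rule poly_add_normalize(2)[symmetric]) (use ec a kc in auto)
      also have "\<dots> = [e, \<ominus> (e \<otimes> a) \<oplus> k]" using ec e a kc by simp
      also have "\<ominus> (e \<otimes> a) \<oplus> k = h" unfolding k_def using ec a by algebra
      finally show ?thesis unfolding 1 univ_poly_add by (rule sym)
    qed
    have XA: "?X = ?A \<oplus>\<^bsub>?U\<^esub> poly_of_const a"
    proof -
      have "poly_add ?A (poly_of_const a) = poly_add ?A [a]"
        unfolding poly_of_const_def by (rule poly_add_normalize(2)[symmetric]) (use a in auto)
      also have "\<dots> = ?X" using a by (simp add: l_neg)
      finally show ?thesis unfolding univ_poly_add by (rule sym)
    qed
    let ?B = "poly_of_const (a [^] p)"
    have cl: "?B \<in> carrier ?U" "?E \<in> carrier ?U" "poly_of_const a \<in> carrier ?U" using a ec by auto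
    have "add_pow ?U p \<one>\<^bsub>?U\<^esub> = \<zero>\<^bsub>?U\<^esub>"
      using C.hom_nat_mult[of \<one> p] p(2) by simp
    then have "?X [^]\<^bsub>?U\<^esub> p = ?A [^]\<^bsub>?U\<^esub> p \<oplus>\<^bsub>?U\<^esub> poly_of_const a [^]\<^bsub>?U\<^esub> p"
      unfolding XA by (intro UP.frobenius_add[OF p(1)]) (use A cl in auto)
    then have Xp: "?X [^]\<^bsub>?U\<^esub> p = ?A [^]\<^bsub>?U\<^esub> p \<oplus>\<^bsub>?U\<^esub> ?B"
      using a by (simp add: C.hom_nat_pow)
    have "p = Suc (Suc (p - 2))" using p2 by simp
    then obtain m where m: "p = Suc (Suc m)" by blast
    let ?M = "?A [^]\<^bsub>?U\<^esub> m"
    have Ap: "?A [^]\<^bsub>?U\<^esub> p = ?M \<otimes>\<^bsub>?U\<^esub> ?A \<otimes>\<^bsub>?U\<^esub> ?A" by (simp add: m)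
    have Ck: "poly_of_const k = \<ominus>\<^bsub>?U\<^esub> (?B \<otimes>\<^bsub>?U\<^esub> ?B)"
      unfolding k using a by (simp add: C.hom_a_inv)
    have X2: "?X [^]\<^bsub>?U\<^esub> (2 * p) = ?X [^]\<^bsub>?U\<^esub> p \<otimes>\<^bsub>?U\<^esub> ?X [^]\<^bsub>?U\<^esub> p"
      using Xc by (simp add: UP.nat_pow_mult mult_2)
    \<comment> \<open>\<open>G\<close> is the cofactor of (X - a)^2 in (X - a)^(2p) + 2 a^p (X -
      a)^p, so that P = (X - a) ((X - a) G + e).\<close>
    define G where "G = ?M \<otimes>\<^bsub>?U\<^esub> (?M \<otimes>\<^bsub>?U\<^esub> ?A \<otimes>\<^bsub>?U\<^esub> ?A \<oplus>\<^bsub>?U\<^esub> (?B \<oplus>\<^bsub>?U\<^esub> ?B))"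
    have Mc: "?M \<in> carrier ?U" using A by simp
    have Gc: "G \<in> carrier ?U" unfolding G_def using A cl Mc by simp
    have "P = ?A \<otimes>\<^bsub>?U\<^esub> (?A \<otimes>\<^bsub>?U\<^esub> G \<oplus>\<^bsub>?U\<^esub> ?E)"
    proof -
      have "(M \<otimes>\<^bsub>?U\<^esub> A \<otimes>\<^bsub>?U\<^esub> A \<oplus>\<^bsub>?U\<^esub> B) \<otimes>\<^bsub>?U\<^esub> (M \<otimes>\<^bsub>?U\<^esub> A \<otimes>\<^bsub>?U\<^esub> A \<oplus>\<^bsub>?U\<^esub> B) \<oplus>\<^bsub>?U\<^esub>
          (E \<otimes>\<^bsub>?U\<^esub> A \<oplus>\<^bsub>?U\<^esub> \<ominus>\<^bsub>?U\<^esub> (B \<otimes>\<^bsub>?U\<^esub> B)) =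
          A \<otimes>\<^bsub>?U\<^esub> (A \<otimes>\<^bsub>?U\<^esub> (M \<otimes>\<^bsub>?U\<^esub> (M \<otimes>\<^bsub>?U\<^esub> A \<otimes>\<^bsub>?U\<^esub> A \<oplus>\<^bsub>?U\<^esub> (B \<oplus>\<^bsub>?U\<^esub> B))) \<oplus>\<^bsub>?U\<^esub> E)"
        if "M \<in> carrier ?U" "A \<in> carrier ?U" "B \<in> carrier ?U" "E \<in> carrier ?U" for M A B E
        using that by algebra
      from this[OF Mc A cl(1,2)] show ?thesis
        unfolding PX X2 Xp Ap eh Ck G_def .
    qed
    then have "?A \<otimes>\<^bsub>?U\<^esub> g = ?A \<otimes>\<^bsub>?U\<^esub> G \<oplus>\<^bsub>?U\<^esub> ?E"
      using g UP.m_lcancel[OF A0 A, of "?A \<otimes>\<^bsub>?U\<^esub> g" "?A \<otimes>\<^bsub>?U\<^esub> G \<oplus>\<^bsub>?U\<^esub> ?E"] A Gc cl by simp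
    then have eq: "eval (?A \<otimes>\<^bsub>?U\<^esub> g) a = eval (?A \<otimes>\<^bsub>?U\<^esub> G \<oplus>\<^bsub>?U\<^esub> ?E) a" by simp
    have Aa: "eval ?A a = \<zero>" using a by (simp add: r_neg)
    have gc: "eval g a \<in> carrier R" "eval G a \<in> carrier R"
      using ring_hom_closed[OF poly_eval_hom[OF a]] g(1) Gc by auto
    have "eval (?A \<otimes>\<^bsub>?U\<^esub> g) a = \<zero>"
      using ring_hom_mult[OF poly_eval_hom[OF a] A g(1)] gc Aa by (simp del: eval.simps)
    moreover have "eval (?A \<otimes>\<^bsub>?U\<^esub> G \<oplus>\<^bsub>?U\<^esub> ?E) a = eval ?E a"
      using ring_hom_add[OF poly_eval_hom[OF a] UP.m_closed[OF A Gc] cl(2)]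
        ring_hom_mult[OF poly_eval_hom[OF a] A Gc] gc Aa ring_hom_closed[OF poly_eval_hom[OF a] cl(2)]
      by (simp del: eval.simps)
    moreover have "eval ?E a = e" unfolding Ee using ec a by simp
    ultimately show False using eq e by simp
  qed
  then have "\<forall>\<beta>. count (roots P) \<beta> \<le> 1" using alg_mult_eq_count_roots[OF Pf(4)] by simp
  moreover have "stable (roots P)" "size (roots P) = 2 * p"
    using stable_roots[OF PM] by (auto simp: stable_of_size_def)
  moreover have "\<forall>x\<in>carrier R. mprod (\<lambda>\<beta>. x \<ominus> \<beta>) (roots P) = x [^] p \<otimes> x [^] p \<oplus> (e \<otimes> x \<oplus> h)"
    using eval_monic_split[OF Pf(1)] ev by simp
  ultimately show ?thesis by blast
qed


lemma exists_root_avoiding: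
  assumes "size W > card A" "finite A" "\<And>\<beta>. count W \<beta> \<le> 1"
  shows "\<exists>\<beta>\<in>#W. \<beta> \<notin> A"
proof (rule ccontr)
  assume "\<not> ?thesis"
  then have "set_mset W \<subseteq> A" by blast
  then have "card (set_mset W) \<le> card A" using assms(2) by (rule card_mono[rotated])
  moreover have "size W \<le> card (set_mset W)"
    unfolding size_multiset_overloaded_eq using assms(3) sum_mono[of "set_mset W" "count W" "\<lambda>_. 1"] by simp
  ultimately show False using assms(1) by simp
qed

text \<open>The quotient d/c does not change when both are multiplied by 4, so up to the squares of
  c and 4c the two polynomials of degree 2p are X^(2p) + eX + h with the same e and different h.
  Hence they share no root, and the other possible coincidences of roots can be checked by
  hand.\<close>

lemma infinite_nonsquare_points:
  fixes p :: nat
  assumes p: "Factorial_Ring.prime p" "add_pow R p \<one> = \<zero>"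
    and c: "c \<in> fixed" "c \<noteq> \<zero>" and d: "d \<in> fixed" "d \<noteq> \<zero>"
    and c4: "c4 = (c \<oplus> c) \<oplus> (c \<oplus> c)" and d4: "d4 = (d \<oplus> d) \<oplus> (d \<oplus> d)"
  shows "infinite {x \<in> carrier R. \<exists>j\<ge>1. x \<in> fixpts j \<and>
    biquadratic_nonsquares (fixpts j) p c d \<zero> x \<and> biquadratic_nonsquares (fixpts j) p c4 d4 \<one> x}"
proof -
  have cc: "c \<in> carrier R" "d \<in> carrier R" using c d by (auto simp: fixed_iff)
  have fix_add: "x \<oplus> y \<in> fixed" if "x \<in> fixed" "y \<in> fixed" for x y
    using that by (simp add: fixed_iff)
  have fix_inv: "inv x \<in> fixed" if x: "x \<in> fixed" "x \<noteq> \<zero>" for x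
  proof -
    have xc: "x \<in> carrier R" "frob x = x" using x(1) by (auto simp: fixed_iff)
    then have i: "inv x \<in> carrier R" "x \<otimes> inv x = \<one>" using x(2) field_Units by auto
    then have "x \<otimes> frob (inv x) = \<one>"
      using ring_hom_mult[OF frob_hom xc(1) i(1)] xc(2) by simp
    then show ?thesis using i xc m_lcancel[OF x(2) xc(1), of "frob (inv x)" "inv x"]
      by (simp add: fixed_iff)
  qed
  have dbl: "x \<oplus> x \<in> fixed - {\<zero>}" if "x \<in> fixed - {\<zero>}" for x
  proof -
    have x: "x \<in> carrier R" using that by (simp add: fixed_iff)
    then have "x \<oplus> x = (\<one> \<oplus> \<one>) \<otimes> x" by algebra
    then show ?thesis using that two_nonzero x fix_add integral by fastforce
  qed
  have four: "c4 \<in> fixed - {\<zero>}" "d4 \<in> fixed - {\<zero>}" using dbl c d c4 d4 by auto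
  have p2: "p > 2"
  proof -
    have "p \<noteq> 2" using p(2) two_nonzero by (auto simp: numeral_2_eq_2)
    then show ?thesis using prime_ge_2_nat[OF p(1)] by simp
  qed
  \<comment> \<open>The Boolean k is True for \<open>Pi1\<close> and False for \<open>Pi2\<close>;
    the second Boolean in \<open>l\<close> and \<open>V\<close> is True for the linear polynomial
    and False for the one of degree 2p.\<close>
  define C where "C k = (if k then c else c4)" for k
  define D where "D k = (if k then d else d4)" for k
  define m where "m k = (if k then \<zero> else \<one>)" for k
  have CD: "C k \<in> fixed - {\<zero>}" "D k \<in> fixed - {\<zero>}" "m k \<in> fixed" for k
    using c d four by (auto simp: C_def D_def m_def fixed_iff)
  then have CDc: "C k \<in> carrier R" "D k \<in> carrier R" "m k \<in> carrier R" for k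
    by (auto simp: fixed_iff)
  define e where "e = d \<otimes> inv c"
  have ic: "inv c \<in> carrier R" "inv c \<otimes> c = \<one>" using c cc field_Units by auto
  have e: "e \<in> fixed" "e \<in> carrier R" "c \<otimes> e = d"
    unfolding e_def using c d cc ic fix_inv fixed_mult m_assoc[of d "inv c" c] m_comm[of c "d \<otimes> inv c"]
    by auto
  have e0: "e \<noteq> \<zero>" using e(3) d(2) cc by auto
  have De: "D k = C k \<otimes> e" for k
  proof (cases k)
    case False
    have "c4 \<otimes> e = (c \<otimes> e \<oplus> c \<otimes> e) \<oplus> (c \<otimes> e \<oplus> c \<otimes> e)" unfolding c4 using cc e(2) by algebra
    then show ?thesis using False e(3) d4 by (simp add: C_def D_def)
  qed (use e in \<open>simp add: C_def D_def\<close>)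
  have iC: "inv (C k) \<in> carrier R" "C k \<otimes> inv (C k) = \<one>" for k
    using CD(1)[of k] CDc(1)[of k] field_Units by auto
  have iD: "inv (D k) \<in> carrier R" "D k \<otimes> inv (D k) = \<one>" for k
    using CD(2)[of k] CDc(2)[of k] field_Units by auto
  define h where "h k = m k \<otimes> inv (C k)" for k
  have h: "h k \<in> fixed" "h k \<in> carrier R" "C k \<otimes> h k = m k" for k
    unfolding h_def using CD[of k] CDc[of k] iC[of k] fix_inv fixed_mult m_lcomm[of "C k" "m k" "inv (C k)"] by auto
  have h_cases: "h True = \<zero>" "h False \<noteq> \<zero>"
    using h(3)[of False] iC(1)[of True] CDc(1)[of False] by (auto simp: h_def m_def)
  define z where "z k = \<ominus> (m k \<otimes> inv (D k))" for k
  have z: "z k \<in> fixed" "z k \<in> carrier R" "D k \<otimes> z k = \<ominus> m k" for k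
  proof -
    have "m k \<otimes> inv (D k) \<in> fixed" using CD[of k] fix_inv fixed_mult by auto
    then show "z k \<in> fixed" "z k \<in> carrier R" by (auto simp: z_def fixed_iff frob.hom_a_inv)
    show "D k \<otimes> z k = \<ominus> m k"
      unfolding z_def using CDc[of k] iD[of k] m_lcomm[of "D k" "m k" "inv (D k)"] by (simp add: r_minus)
  qed
  \<comment> \<open>At the zero of the linear polynomial the part eX + h of the trinomial vanishes
    too, leaving z^(2p).\<close>
  have ez: "e \<otimes> z k = \<ominus> h k" for k
  proof -
    have "C k \<otimes> (e \<otimes> z k) = C k \<otimes> (\<ominus> h k)"
      using z(3)[of k] h[of k] De[of k] CDc[of k] e(2) z(2)[of k] by (simp add: m_assoc r_minus)
    then show ?thesis
      using m_lcancel[of "C k" "e \<otimes> z k" "\<ominus> h k"] CD(1)[of k] CDc(1)[of k] e(2) z(2)[of k] h(2)[of k]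
      by simp
  qed
  have "\<zero> \<noteq> \<ominus> \<one>" by (metis minus_minus minus_zero one_closed zero_not_one)
  then have z_cases: "z True = \<zero>" "z False \<noteq> \<zero>"
    using z(3)[of False] iD(1)[of True] CDc(2)[of False] by (auto simp: z_def m_def)
  have "\<exists>W. \<forall>k. stable (W k) \<and> size (W k) = 2 * p \<and> (\<forall>\<beta>. count (W k) \<beta> \<le> 1) \<and>
    (\<forall>x\<in>carrier R. mprod (\<lambda>\<beta>. x \<ominus> \<beta>) (W k) = x [^] p \<otimes> x [^] p \<oplus> (e \<otimes> x \<oplus> h k))"
    by (rule choice, rule allI, rule separable_trinomial[OF p e(1) e0 h(1)])
  then obtain W where W: "\<And>k. stable (W k)" "\<And>k. size (W k) = 2 * p" "\<And>k \<beta>. count (W k) \<beta> \<le> 1"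
    "\<And>k x. x \<in> carrier R \<Longrightarrow> mprod (\<lambda>\<beta>. x \<ominus> \<beta>) (W k) = x [^] p \<otimes> x [^] p \<oplus> (e \<otimes> x \<oplus> h k)"
    by blast
  have Wc: "\<beta> \<in> carrier R" if "\<beta> \<in># W k" for \<beta> k using W(1)[of k] that by (auto simp: stable_def)
  have Wroot: "\<beta> \<in># W k \<longleftrightarrow> \<beta> [^] p \<otimes> \<beta> [^] p \<oplus> (e \<otimes> \<beta> \<oplus> h k) = \<zero>" if \<beta>: "\<beta> \<in> carrier R" for \<beta> k
  proof -
    have "(\<lambda>b. \<beta> \<ominus> b) \<in> set_mset (W k) \<rightarrow> carrier R" using \<beta> Wc by auto
    then have "mprod (\<lambda>b. \<beta> \<ominus> b) (W k) = \<zero> \<longleftrightarrow> (\<exists>b\<in>#W k. \<beta> \<ominus> b = \<zero>)"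
      by (rule mprod_eq_zero_iff)
    also have "\<dots> \<longleftrightarrow> \<beta> \<in># W k" using \<beta> Wc by auto
    finally show ?thesis using W(4)[OF \<beta>] by simp
  qed
  \<comment> \<open>The leading coefficients of -C (D x + m) and C (C x^(2p) + D x + m).\<close>
  define l where "l = (\<lambda>(k, t). if t then \<ominus> (C k \<otimes> D k) else C k \<otimes> C k)"
  define V where "V = (\<lambda>(k, t). if t then {#z k#} else W k)"
  have odd_mult: "\<exists>\<beta>\<in>carrier R. odd (\<Sum>i\<in>S. count (V i) \<beta>)" if S: "S \<noteq> {}" for S
  proof -
    have crit: "odd (\<Sum>i\<in>S. count (V i) \<beta>)"
      if "i0 \<in> S" "count (V i0) \<beta> = 1" "\<And>i. i \<in> S \<Longrightarrow> i \<noteq> i0 \<Longrightarrow> \<beta> \<notin># V i" for \<beta> i0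
    proof -
      have "(\<Sum>i\<in>S - {i0}. count (V i) \<beta>) = 0"
        by (rule sum.neutral) (use that(3) in \<open>auto simp: not_in_iff\<close>)
      then show ?thesis using sum.remove[of S i0 "\<lambda>i. count (V i) \<beta>"] that(1,2) by simp
    qed
    have W1: "count (W k) \<beta> = 1" if "\<beta> \<in># W k" for k \<beta>
      using W(3)[of k \<beta>] that count_greater_zero_iff[of "W k" \<beta>] by linarith
    have pow0: "\<zero> [^] p = \<zero>" using p2 by (simp add: nat_pow_zero)
    have nz: "z k \<notin># W False" for k
    proof (cases k)
      case True
      then show ?thesis using z_cases h_cases Wroot[of \<zero> False] e(2) h(2)[of False] pow0 by simp
    next
      case False
      have t: "z False [^] p \<in> carrier R" using z(2) by simp
      have "z False [^] p \<otimes> z False [^] p \<noteq> \<zero>"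
        using nat_pow_nonzero[OF z(2) z_cases(2), of p] t integral by blast
      then show ?thesis
        using False Wroot[OF z(2), of False False] ez[of False] h(2)[of False] t by (simp add: l_neg)
    qed
    \<comment> \<open>Priority goes to the trinomial of \<open>Pi2\<close>, whose roots avoid all
      others. The trinomial of \<open>Pi1\<close> does meet a linear zero, as 0 is both a root of it
      and \<open>z True\<close>, but only two of its 2p distinct roots can be lost in this way. For
      linear polynomials alone, \<open>z True\<close> and \<open>z False\<close> differ.\<close>
    consider "(False, False) \<in> S" | "(False, False) \<notin> S" "(True, False) \<in> S"
      | "(False, False) \<notin> S" "(True, False) \<notin> S" by blast
    then show ?thesis
    proof cases
      case 1
      obtain \<beta> where b: "\<beta> \<in># W False"
        using exists_root_avoiding[of "{}" "W False"] W(2,3)[of False] p2 by auto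
      have "\<beta> \<notin># W True"
      proof
        assume "\<beta> \<in># W True"
        then have 1: "\<beta> [^] p \<otimes> \<beta> [^] p \<oplus> (e \<otimes> \<beta> \<oplus> h True) = \<zero>"
          and 2: "\<beta> [^] p \<otimes> \<beta> [^] p \<oplus> (e \<otimes> \<beta> \<oplus> h False) = \<zero>"
          using Wroot Wc b by auto
        have "e \<otimes> \<beta> \<in> carrier R" "\<beta> [^] p \<otimes> \<beta> [^] p \<in> carrier R" using e Wc[OF b] by auto
        then show False using 1 2 h_cases h(2) by (metis a_assoc add.m_closed l_zero r_zero)
      qed
      then have "odd (\<Sum>i\<in>S. count (V i) \<beta>)"
        by (intro crit[OF 1]) (use b nz W1 in \<open>auto simp: V_def split: if_splits\<close>)
      then show ?thesis using Wc[OF b] by blast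
    next
      case 2
      obtain \<beta> where b: "\<beta> \<in># W True" "\<beta> \<notin> {z True, z False}"
      proof -
        have "card {z True, z False} \<le> 2" by (simp add: card_insert_if)
        then show thesis
          using exists_root_avoiding[of "{z True, z False}" "W True"] W(2,3)[of True] p2 that by auto
      qed
      have "odd (\<Sum>i\<in>S. count (V i) \<beta>)"
      proof (rule crit[OF 2(2)])
        fix i assume "i \<in> S" "i \<noteq> (True, False)"
        then show "\<beta> \<notin># V i" using b 2(1) by (cases i; cases "fst i"; cases "snd i") (auto simp: V_def)
      qed (use b W1 in \<open>auto simp: V_def\<close>)
      then show ?thesis using Wc[OF b(1)] by blast
    next
      case 3
      then obtain k where k: "(k, True) \<in> S" using S by (metis (full_types) ex_in_conv prod.exhaust)
      have "odd (\<Sum>i\<in>S. count (V i) (z k))"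
      proof (rule crit[OF k])
        fix i assume i: "i \<in> S" "i \<noteq> (k, True)"
        obtain k' t where it: "i = (k', t)" by (cases i)
        have "t" using i 3 it by (cases k'; cases t) auto
        then have "k' = (\<not> k)" using i it by auto
        then show "z k \<notin># V i" using it \<open>t\<close> z_cases by (cases k) (auto simp: V_def)
      qed (simp add: V_def)
      then show ?thesis using z(2) by blast
    qed
  qed
  interpret Q: quadratic_symbols R q UNIV l V
  proof
    show "finite (UNIV :: (bool \<times> bool) set)" by simp
    fix i :: "bool \<times> bool"
    obtain k t where i: "i = (k, t)" by (cases i)
    have "C k \<otimes> D k \<in> fixed" "C k \<otimes> C k \<in> fixed" using CD[of k] fixed_mult by auto
    moreover have "C k \<otimes> D k \<noteq> \<zero>" "C k \<otimes> C k \<noteq> \<zero>" using CD[of k] CDc[of k] integral by auto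
    ultimately show "l i \<in> fixed - {\<zero>}"
      unfolding i l_def by (auto simp: fixed_iff frob.hom_a_inv)
    show "stable (V i)" unfolding i V_def using W(1)[of k] z[of k] by (simp add: stable_def fixed_iff)
  qed (use odd_mult in auto)
  have lV: "l (k, True) = \<ominus> (C k \<otimes> D k)" "V (k, True) = {#z k#}"
    "l (k, False) = C k \<otimes> C k" "V (k, False) = W k" for k
    by (simp_all add: l_def V_def)
  have valT: "Q.val (k, True) x = \<ominus> (C k \<otimes> (D k \<otimes> x \<oplus> m k))" if x: "x \<in> carrier R" for k x
  proof -
    have "mprod (\<lambda>\<beta>. x \<ominus> \<beta>) {#z k#} = x \<ominus> z k"
      using mprod_add_mset[of "\<lambda>\<beta>. x \<ominus> \<beta>" "z k" "{#}"] x z(2)[of k] by simp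
    then have "Q.val (k, True) x = \<ominus> (C k \<otimes> D k) \<otimes> (x \<ominus> z k)" by (simp add: Q.val_def lV)
    also have "\<dots> = \<ominus> (C k \<otimes> (D k \<otimes> x \<ominus> D k \<otimes> z k))"
      using CDc[of k] x z(2)[of k] by algebra
    also have "\<dots> = \<ominus> (C k \<otimes> (D k \<otimes> x \<oplus> m k))"
      unfolding z(3) using CDc[of k] x by algebra
    finally show ?thesis .
  qed
  have valF: "Q.val (k, False) x = C k \<otimes> (C k \<otimes> (x [^] p \<otimes> x [^] p) \<oplus> (D k \<otimes> x \<oplus> m k))"
    if x: "x \<in> carrier R" for k x
  proof -
    have y: "x [^] p \<in> carrier R" using x by simp
    have "Q.val (k, False) x = (C k \<otimes> C k) \<otimes> (x [^] p \<otimes> x [^] p \<oplus> (e \<otimes> x \<oplus> h k))"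
      using W(4)[OF x, of k] by (simp add: Q.val_def lV)
    also have "\<dots> = C k \<otimes> (C k \<otimes> (x [^] p \<otimes> x [^] p) \<oplus> ((C k \<otimes> e) \<otimes> x \<oplus> C k \<otimes> h k))"
      using CDc[of k] x y e(2) h(2)[of k] by algebra
    finally show ?thesis unfolding h(3) De[symmetric] .
  qed
  show ?thesis
  proof (rule infinite_super[OF _ Q.infinite_all_symb_minus_one], rule subsetI)
    fix x assume "x \<in> {x \<in> carrier R. \<exists>j\<ge>1. x \<in> fixpts j \<and> (\<forall>i\<in>UNIV. Q.symb i (orbit_mset j x) = - 1)}"
    then obtain j where j: "x \<in> carrier R" "j \<ge> 1" "x \<in> fixpts j" "\<And>i. Q.symb i (orbit_mset j x) = -1"
      by auto
    have nsq: "y \<otimes> y \<noteq> Q.val i x" if "y \<in> fixpts j" for y i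
      using Q.symb_square_neq_minus_one[of i x j y] j that by auto
    have "biquadratic_nonsquares (fixpts j) p (C k) (D k) (m k) x" for k
      unfolding biquadratic_nonsquares_def
      using nsq[of _ "(k, True)"] nsq[of _ "(k, False)"] valT[OF j(1)] valF[OF j(1)] by auto
    from this[of True] this[of False]
    show "x \<in> {x \<in> carrier R. \<exists>j\<ge>1. x \<in> fixpts j \<and>
        biquadratic_nonsquares (fixpts j) p c d \<zero> x \<and> biquadratic_nonsquares (fixpts j) p c4 d4 \<one> x}"
      using j(1-3) by (auto simp: C_def D_def m_def)
  qed
qed

end

section \<open>Specialization of biquadratic polynomials\<close>

text \<open>The coefficients of T^3 and T vanish, which leaves two kinds of factorization into
  quadratics. Either both factors are polynomials in T^2, and -k/c is a square; or T -> -T exchanges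
  them up to scaling, and a^2 + k/c is the square of their common normalized constant term.
  Multiplying by c^2 gives the two nonsquare conditions. A linear factor would again make -k/c a
  square.\<close>

lemma (in field) biquadratic_pirreducible:
  assumes c: "c \<in> carrier R" "c \<noteq> \<zero>" and a: "a \<in> carrier R" and k: "k \<in> carrier R"
    and nsq1: "\<And>y. y \<in> carrier R \<Longrightarrow> y \<otimes> y \<noteq> \<ominus> (c \<otimes> k)"
    and nsq2: "\<And>y. y \<in> carrier R \<Longrightarrow> y \<otimes> y \<noteq> c \<otimes> (c \<otimes> (a \<otimes> a) \<oplus> k)"
  shows "pirreducible (carrier R) [c, \<zero>, c \<otimes> (a \<oplus> a), \<zero>, c \<otimes> (a \<otimes> a) \<oplus> k]"
proof -
  interpret UP: domain "poly_ring R" by (rule univ_poly_is_domain[OF carrier_is_subring])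
  let ?p = "[c, \<zero>, c \<otimes> (a \<oplus> a), \<zero>, c \<otimes> (a \<otimes> a) \<oplus> k]"
  have pc: "?p \<in> carrier (poly_ring R)" using c a k by (intro poly_ring_memI) auto
  have units: "Units (poly_ring R) = {[u] | u. u \<in> carrier R - {\<zero>}}"
    by (rule univ_poly_units[OF carrier_is_subfield])
  have no_root: "eval ?p x \<noteq> \<zero>" if x: "x \<in> carrier R" for x
  proof
    assume "eval ?p x = \<zero>"
    moreover have "eval ?p x = c \<otimes> (x \<otimes> x \<otimes> x \<otimes> x) \<oplus> (c \<otimes> (a \<oplus> a) \<otimes> (x \<otimes> x) \<oplus> (c \<otimes> (a \<otimes> a) \<oplus> k))"
      using c a k x by (simp add: numeral_eq_Suc m_assoc)
    ultimately have 0: "c \<otimes> (x \<otimes> x \<otimes> x \<otimes> x) \<oplus> (c \<otimes> (a \<oplus> a) \<otimes> (x \<otimes> x) \<oplus> (c \<otimes> (a \<otimes> a) \<oplus> k)) = \<zero>"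
      by simp
    \<comment> \<open>c times the value of the quartic at x is y^2 + c k, so a root x makes y a
      square root of -c k.\<close>
    let ?y = "c \<otimes> (x \<otimes> x \<oplus> a)"
    have "?y \<otimes> ?y = c \<otimes> (c \<otimes> (x \<otimes> x \<otimes> x \<otimes> x) \<oplus> (c \<otimes> (a \<oplus> a) \<otimes> (x \<otimes> x) \<oplus> (c \<otimes> (a \<otimes> a) \<oplus> k))) \<ominus> c \<otimes> k"
      using c(1) a k x by algebra
    then have "?y \<otimes> ?y = \<ominus> (c \<otimes> k)" unfolding 0 using c(1) k by (simp add: a_minus_def)
    then show False using nsq1[of ?y] c(1) a x by simp
  qed
  have lin: "\<not> length r = 2" if r: "r \<in> carrier (poly_ring R)" "s \<in> carrier (poly_ring R)"
    "?p = r \<otimes>\<^bsub>poly_ring R\<^esub> s" for r s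
  proof
    assume "length r = 2"
    then have "eval r (\<ominus> (inv (hd r) \<otimes> const_term r)) = \<zero>" "inv (hd r) \<otimes> const_term r \<in> carrier R"
      using degree_one_root[OF carrier_is_subfield r(1)] by auto
    then obtain x where x: "x \<in> carrier R" "eval r x = \<zero>" by blast
    have "eval s x \<in> carrier R" using ring_hom_closed[OF poly_eval_hom[OF x(1)] r(2)] .
    then have "eval ?p x = \<zero>"
      unfolding r(3) using ring_hom_mult[OF poly_eval_hom[OF x(1)] r(1,2)] x(2) by simp
    then show False using no_root[OF x(1)] by simp
  qed
  show ?thesis
  proof (rule pirreducibleI[OF carrier_is_subring pc])
    show "?p \<notin> Units (poly_ring R)" unfolding units by auto
    fix r s assume rs: "r \<in> carrier (poly_ring R)" "s \<in> carrier (poly_ring R)"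
      and p: "?p = r \<otimes>\<^bsub>poly_ring R\<^esub> s"
    have ne: "r \<noteq> []" "s \<noteq> []"
      using p UP.l_null[OF rs(2)] UP.r_null[OF rs(1)] by (auto simp: univ_poly_zero)
    have pol: "polynomial (carrier R) r" "polynomial (carrier R) s" using rs univ_poly_carrier by blast+
    have "length ?p - 1 = (length r - 1) + (length s - 1)"
      unfolding p univ_poly_mult using poly_mult_degree_eq[OF carrier_is_subring pol] ne by simp
    then have len: "length r + length s = 6" using ne by (cases r; cases s) auto
    have p': "?p = s \<otimes>\<^bsub>poly_ring R\<^esub> r" using p UP.m_comm[OF rs] by simp
    have unit: "u \<in> Units (poly_ring R)" if "u \<in> carrier (poly_ring R)" "length u = 1" for u
    proof -
      obtain b where "u = [b]" using \<open>length u = 1\<close> by (metis One_nat_def length_0_conv length_Suc_conv)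
      then show ?thesis using that(1) unfolding units univ_poly_carrier[symmetric] polynomial_def by auto
    qed
    have "length r = 1 \<or> length s = 1"
    proof (rule ccontr)
      assume "\<not> ?thesis"
      moreover have "length r \<noteq> 0" "length s \<noteq> 0" using ne by auto
      moreover have "length r \<noteq> 2" "length s \<noteq> 2" using lin[OF rs p] lin[OF rs(2,1) p'] by auto
      ultimately have "length r = 3" "length s = 3" using len by linarith+
      then obtain r2 r1 r0 s2 s1 s0 where rl: "r = [r2, r1, r0]" and sl: "s = [s2, s1, s0]"
        by (auto simp: numeral_3_eq_3 length_Suc_conv)
      have rc: "r2 \<in> carrier R" "r1 \<in> carrier R" "r0 \<in> carrier R" "r2 \<noteq> \<zero>"
        and sc: "s2 \<in> carrier R" "s1 \<in> carrier R" "s0 \<in> carrier R" "s2 \<noteq> \<zero>"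
        using pol unfolding rl sl polynomial_def by auto
      have cf: "coeff ?p i = (\<Oplus>j\<in>{..i}. coeff r j \<otimes> coeff s (i - j))" for i
        unfolding p univ_poly_mult using poly_mult_coeff[of r s] rs[THEN set_poly_subset] by simp
      note expand = rl sl numeral_eq_Suc Pi_def
      have e4: "c = r2 \<otimes> s2" using cf[of 4] rc sc c by (simp add: expand)
      have e3: "\<zero> = r2 \<otimes> s1 \<oplus> r1 \<otimes> s2" using cf[of 3] rc sc by (simp add: expand)
      have e2: "c \<otimes> (a \<oplus> a) = r2 \<otimes> s0 \<oplus> (r1 \<otimes> s1 \<oplus> r0 \<otimes> s2)"
        using cf[of 2] rc sc c a by (simp add: expand)
      have e1: "\<zero> = r1 \<otimes> s0 \<oplus> r0 \<otimes> s1" using cf[of 1] rc sc by (simp add: expand)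
      have e0: "c \<otimes> (a \<otimes> a) \<oplus> k = r0 \<otimes> s0" using cf[of 0] rc sc c a k by (simp add: expand)
      \<comment> \<open>A combination of the vanishing coefficients of T and T^3; its two factors
        separate the two kinds of factorization.\<close>
      have "r1 \<otimes> (r2 \<otimes> s0 \<ominus> r0 \<otimes> s2) = r2 \<otimes> (r1 \<otimes> s0 \<oplus> r0 \<otimes> s1) \<ominus> r0 \<otimes> (r2 \<otimes> s1 \<oplus> r1 \<otimes> s2)"
        using rc(1-3) sc(1-3) by algebra
      also have "\<dots> = \<zero>" unfolding e1[symmetric] e3[symmetric] using rc by (simp add: a_minus_def)
      finally have "r1 = \<zero> \<or> r2 \<otimes> s0 \<ominus> r0 \<otimes> s2 = \<zero>"
        using rc sc integral[of r1 "r2 \<otimes> s0 \<ominus> r0 \<otimes> s2"] by simp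
      then show False
      proof
        assume r1: "r1 = \<zero>"
        \<comment> \<open>r0 s2 and r2 s0 have sum 2ca and product c (c a^2 + k), so they are ca + y
          and ca - y with y^2 = -c k.\<close>
        let ?y = "r0 \<otimes> s2 \<ominus> c \<otimes> a"
        have "c \<otimes> (a \<oplus> a) = r2 \<otimes> s0 \<oplus> r0 \<otimes> s2" using e2 r1 rc sc by simp
        then have sum: "c \<otimes> (a \<oplus> a) \<ominus> r0 \<otimes> s2 = r2 \<otimes> s0"
          using rc sc c(1) a by algebra
        have "?y \<otimes> ?y = c \<otimes> a \<otimes> (c \<otimes> a) \<ominus> (c \<otimes> (a \<oplus> a) \<ominus> r0 \<otimes> s2) \<otimes> (r0 \<otimes> s2)"
          using rc(1-3) sc(1-3) c(1) a by algebra
        also have "\<dots> = c \<otimes> a \<otimes> (c \<otimes> a) \<ominus> (r2 \<otimes> s2) \<otimes> (r0 \<otimes> s0)"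
          unfolding sum using rc(1-3) sc(1-3) c(1) a by algebra
        also have "\<dots> = c \<otimes> a \<otimes> (c \<otimes> a) \<ominus> c \<otimes> (c \<otimes> (a \<otimes> a) \<oplus> k)" by (simp only: e4[symmetric] e0)
        also have "\<dots> = \<ominus> (c \<otimes> k)" using c(1) a k by algebra
        finally show False using nsq1[of ?y] rc sc c a by simp
      next
        assume "r2 \<otimes> s0 \<ominus> r0 \<otimes> s2 = \<zero>"
        then have eq: "r2 \<otimes> s0 = r0 \<otimes> s2" using rc sc by simp
        let ?y = "r0 \<otimes> s2"
        have "?y \<otimes> ?y = (r2 \<otimes> s0) \<otimes> (r0 \<otimes> s2)" using eq by simp
        also have "\<dots> = (r2 \<otimes> s2) \<otimes> (r0 \<otimes> s0)" using rc(1-3) sc(1-3) by algebra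
        also have "\<dots> = c \<otimes> (c \<otimes> (a \<otimes> a) \<oplus> k)" by (simp only: e4[symmetric] e0)
        finally show False using nsq2[of ?y] rc sc by simp
      qed
    qed
    then show "r \<in> Units (poly_ring R) \<or> s \<in> Units (poly_ring R)" using unit rs by auto
  qed simp
qed

section \<open>Coefficient lists of the two polynomials over K[u]\<close>

context domain
begin

lemma biquadratic_list:
  assumes c: "c \<in> carrier R" "c \<noteq> \<zero>" and s: "s \<in> carrier R" and k: "k \<in> carrier R"
  shows "poly_of_const c \<otimes>\<^bsub>poly_ring R\<^esub> ((var R [^]\<^bsub>poly_ring R\<^esub> (2::nat) \<oplus>\<^bsub>poly_ring R\<^esub> poly_of_const s)
      [^]\<^bsub>poly_ring R\<^esub> (2::nat)) \<oplus>\<^bsub>poly_ring R\<^esub> poly_of_const k =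
    [c, \<zero>, c \<otimes> (s \<oplus> s), \<zero>, c \<otimes> (s \<otimes> s) \<oplus> k]"
proof -
  interpret UP: domain "poly_ring R" by (rule univ_poly_is_domain[OF carrier_is_subring])
  have sq: "x [^]\<^bsub>poly_ring R\<^esub> (2::nat) = poly_mult x x" if "x \<in> carrier (poly_ring R)" for x
    using that by (simp add: numeral_2_eq_2) (simp add: univ_poly_mult)
  have norm: "poly_add l (poly_of_const y) = poly_add l [y]" if "set l \<subseteq> carrier R" "y \<in> carrier R" for l y
    unfolding poly_of_const_def by (rule poly_add_normalize(2)[symmetric]) (use that in auto)
  have cc: "poly_of_const c = [c]" using c by (simp add: poly_of_const_def)
  have "var R [^]\<^bsub>poly_ring R\<^esub> (2::nat) = [\<one>, \<zero>, \<zero>]"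
    using unitary_monom_eq_var_pow[OF carrier_is_subring, of 2] by (simp add: monom_def numeral_2_eq_2)
  moreover have "poly_add [\<one>, \<zero>, \<zero>] (poly_of_const s) = [\<one>, \<zero>, s]"
    using s by (subst norm) auto
  moreover have "[\<one>, \<zero>, s] \<in> carrier (poly_ring R)"
    using s unfolding univ_poly_carrier[symmetric] polynomial_def by auto
  moreover have "poly_mult [\<one>, \<zero>, s] [\<one>, \<zero>, s] = [\<one>, \<zero>, s \<oplus> s, \<zero>, s \<otimes> s]"
    using s by simp
  moreover have "poly_mult [c] [\<one>, \<zero>, s \<oplus> s, \<zero>, s \<otimes> s] = [c, \<zero>, c \<otimes> (s \<oplus> s), \<zero>, c \<otimes> (s \<otimes> s)]"
    using c s by simp
  moreover have "poly_add [c, \<zero>, c \<otimes> (s \<oplus> s), \<zero>, c \<otimes> (s \<otimes> s)] (poly_of_const k) =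
      [c, \<zero>, c \<otimes> (s \<oplus> s), \<zero>, c \<otimes> (s \<otimes> s) \<oplus> k]"
    using c s k by (subst norm) auto
  ultimately show ?thesis by (simp add: univ_poly_add univ_poly_mult sq cc del: poly_add.simps poly_mult.simps)
qed

lemma one_plus_four_times_list:
  assumes c: "c \<in> carrier R" "(c \<oplus> c) \<oplus> (c \<oplus> c) \<noteq> \<zero>" and b: "b \<in> carrier R" and e: "e \<in> carrier R"
  shows "\<one>\<^bsub>poly_ring R\<^esub> \<oplus>\<^bsub>poly_ring R\<^esub> add_pow (poly_ring R) (4::nat) [c, \<zero>, b, \<zero>, e] =
    [(c \<oplus> c) \<oplus> (c \<oplus> c), \<zero>, (b \<oplus> b) \<oplus> (b \<oplus> b), \<zero>, \<one> \<oplus> ((e \<oplus> e) \<oplus> (e \<oplus> e))]"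
proof -
  interpret UP: domain "poly_ring R" by (rule univ_poly_is_domain[OF carrier_is_subring])
  have c0: "c \<noteq> \<zero>" "c \<oplus> c \<noteq> \<zero>" using c by auto
  let ?l = "[c, \<zero>, b, \<zero>, e]"
  have l: "?l \<in> carrier (poly_ring R)"
    using c c0 b e unfolding univ_poly_carrier[symmetric] polynomial_def by auto
  have "add_pow (poly_ring R) (4::nat) ?l = (?l \<oplus>\<^bsub>poly_ring R\<^esub> ?l) \<oplus>\<^bsub>poly_ring R\<^esub> (?l \<oplus>\<^bsub>poly_ring R\<^esub> ?l)"
    using l by (simp add: numeral_eq_Suc UP.a_assoc)
  also have "?l \<oplus>\<^bsub>poly_ring R\<^esub> ?l = [c \<oplus> c, \<zero>, b \<oplus> b, \<zero>, e \<oplus> e]"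
    unfolding univ_poly_add using c0 by simp
  also have "[c \<oplus> c, \<zero>, b \<oplus> b, \<zero>, e \<oplus> e] \<oplus>\<^bsub>poly_ring R\<^esub> [c \<oplus> c, \<zero>, b \<oplus> b, \<zero>, e \<oplus> e]
      = [(c \<oplus> c) \<oplus> (c \<oplus> c), \<zero>, (b \<oplus> b) \<oplus> (b \<oplus> b), \<zero>, (e \<oplus> e) \<oplus> (e \<oplus> e)]"
    unfolding univ_poly_add using c by simp
  finally have 4: "add_pow (poly_ring R) (4::nat) ?l =
      [(c \<oplus> c) \<oplus> (c \<oplus> c), \<zero>, (b \<oplus> b) \<oplus> (b \<oplus> b), \<zero>, (e \<oplus> e) \<oplus> (e \<oplus> e)]" .
  show ?thesis
    unfolding 4 univ_poly_add univ_poly_one using c b e by (simp add: a_comm)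
qed

end

lemma Pi1_eq:
  fixes p :: nat
  assumes "field K" "c \<in> carrier K" "c \<noteq> \<zero>\<^bsub>K\<^esub>" "d \<in> carrier K"
  defines "P \<equiv> poly_ring K"
  defines "C \<equiv> ring.poly_of_const K c" and "s \<equiv> var K [^]\<^bsub>P\<^esub> p"
    and "k \<equiv> ring.poly_of_const K d \<otimes>\<^bsub>P\<^esub> var K"
  shows "Pi1 K p c d = [C, \<zero>\<^bsub>P\<^esub>, C \<otimes>\<^bsub>P\<^esub> (s \<oplus>\<^bsub>P\<^esub> s), \<zero>\<^bsub>P\<^esub>, C \<otimes>\<^bsub>P\<^esub> (s \<otimes>\<^bsub>P\<^esub> s) \<oplus>\<^bsub>P\<^esub> k]"
proof -
  interpret K: field K by fact
  interpret P: domain P unfolding P_def by (rule K.univ_poly_is_domain[OF K.carrier_is_subring])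
  have vc: "var K \<in> carrier P" unfolding P_def by (rule K.var_closed(1)[OF K.carrier_is_subring])
  have "C \<in> carrier P" "ring.poly_of_const K d \<in> carrier P"
    unfolding C_def P_def using ring_hom_closed[OF K.poly_of_const_hom] assms(2,4) by blast+
  moreover have "C \<noteq> \<zero>\<^bsub>P\<^esub>"
    unfolding C_def P_def using assms(3) by (simp add: K.poly_of_const_def univ_poly_zero)
  moreover have "s \<in> carrier P" "k \<in> carrier P"
    unfolding s_def k_def using vc \<open>ring.poly_of_const K d \<in> carrier P\<close> by auto
  ultimately show ?thesis
    using P.biquadratic_list[of C s k]
    unfolding Pi1_def Let_def C_def s_def k_def P_def by blast
qed

text \<open>1 + 4 (c (T^2 + s)^2 + d u) has the shape of \<open>Pi1\<close> again, with 4c for c and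
  4d u + 1 for d u, so one criterion covers both polynomials.\<close>

lemma Pi2_eq:
  fixes p :: nat
  assumes "field K" "c \<in> carrier K" "(c \<oplus>\<^bsub>K\<^esub> c) \<oplus>\<^bsub>K\<^esub> (c \<oplus>\<^bsub>K\<^esub> c) \<noteq> \<zero>\<^bsub>K\<^esub>" "d \<in> carrier K"
  defines "P \<equiv> poly_ring K"
  defines "C \<equiv> ring.poly_of_const K ((c \<oplus>\<^bsub>K\<^esub> c) \<oplus>\<^bsub>K\<^esub> (c \<oplus>\<^bsub>K\<^esub> c))" and "s \<equiv> var K [^]\<^bsub>P\<^esub> p"
    and "k \<equiv> ring.poly_of_const K ((d \<oplus>\<^bsub>K\<^esub> d) \<oplus>\<^bsub>K\<^esub> (d \<oplus>\<^bsub>K\<^esub> d)) \<otimes>\<^bsub>P\<^esub> var K \<oplus>\<^bsub>P\<^esub> \<one>\<^bsub>P\<^esub>"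
  shows "Pi2 K p c d = [C, \<zero>\<^bsub>P\<^esub>, C \<otimes>\<^bsub>P\<^esub> (s \<oplus>\<^bsub>P\<^esub> s), \<zero>\<^bsub>P\<^esub>, C \<otimes>\<^bsub>P\<^esub> (s \<otimes>\<^bsub>P\<^esub> s) \<oplus>\<^bsub>P\<^esub> k]"
proof -
  interpret K: field K by fact
  interpret P: domain P unfolding P_def by (rule K.univ_poly_is_domain[OF K.carrier_is_subring])
  interpret h: ring_hom_ring K P K.poly_of_const
    unfolding P_def by (rule ring_hom_ringI2[OF K.ring_axioms P.ring_axioms[unfolded P_def] K.poly_of_const_hom])
  have vc: "var K \<in> carrier P" unfolding P_def by (rule K.var_closed(1)[OF K.carrier_is_subring])
  have c0: "c \<noteq> \<zero>\<^bsub>K\<^esub>" using assms(3) by auto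
  let ?c = "K.poly_of_const c" and ?d = "K.poly_of_const d"
  have cd: "?c \<in> carrier P" "?d \<in> carrier P" "s \<in> carrier P" using assms(2,4) vc by (auto simp: s_def)
  have C: "C = (?c \<oplus>\<^bsub>P\<^esub> ?c) \<oplus>\<^bsub>P\<^esub> (?c \<oplus>\<^bsub>P\<^esub> ?c)" unfolding C_def using assms(2) by simp
  have C0: "C \<noteq> \<zero>\<^bsub>P\<^esub>"
    unfolding C_def P_def using assms(3) by (simp add: K.poly_of_const_def univ_poly_zero)
  have k: "k = ((?d \<oplus>\<^bsub>P\<^esub> ?d) \<oplus>\<^bsub>P\<^esub> (?d \<oplus>\<^bsub>P\<^esub> ?d)) \<otimes>\<^bsub>P\<^esub> var K \<oplus>\<^bsub>P\<^esub> \<one>\<^bsub>P\<^esub>"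
    unfolding k_def using assms(4) by simp
  have "Pi2 K p c d = \<one>\<^bsub>poly_ring P\<^esub> \<oplus>\<^bsub>poly_ring P\<^esub> add_pow (poly_ring P) (4::nat)
      [?c, \<zero>\<^bsub>P\<^esub>, ?c \<otimes>\<^bsub>P\<^esub> (s \<oplus>\<^bsub>P\<^esub> s), \<zero>\<^bsub>P\<^esub>, ?c \<otimes>\<^bsub>P\<^esub> (s \<otimes>\<^bsub>P\<^esub> s) \<oplus>\<^bsub>P\<^esub> ?d \<otimes>\<^bsub>P\<^esub> var K]"
    unfolding Pi2_def Let_def Pi1_eq[OF assms(1,2) c0 assms(4)] s_def P_def ..
  also have "\<dots> = [C, \<zero>\<^bsub>P\<^esub>, C \<otimes>\<^bsub>P\<^esub> (s \<oplus>\<^bsub>P\<^esub> s), \<zero>\<^bsub>P\<^esub>, C \<otimes>\<^bsub>P\<^esub> (s \<otimes>\<^bsub>P\<^esub> s) \<oplus>\<^bsub>P\<^esub> k]"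
  proof (subst P.one_plus_four_times_list)
    have 1: "(b \<oplus>\<^bsub>P\<^esub> b) \<oplus>\<^bsub>P\<^esub> (b \<oplus>\<^bsub>P\<^esub> b) = C \<otimes>\<^bsub>P\<^esub> t" if "b = ?c \<otimes>\<^bsub>P\<^esub> t" "t \<in> carrier P" for b t
      unfolding that(1) C using cd that(2) by algebra
    have 2: "\<one>\<^bsub>P\<^esub> \<oplus>\<^bsub>P\<^esub> ((e \<oplus>\<^bsub>P\<^esub> e) \<oplus>\<^bsub>P\<^esub> (e \<oplus>\<^bsub>P\<^esub> e)) = ((y \<oplus>\<^bsub>P\<^esub> y) \<oplus>\<^bsub>P\<^esub> (y \<oplus>\<^bsub>P\<^esub> y)) \<oplus>\<^bsub>P\<^esub> (((D \<oplus>\<^bsub>P\<^esub> D) \<oplus>\<^bsub>P\<^esub> (D \<oplus>\<^bsub>P\<^esub> D)) \<otimes>\<^bsub>P\<^esub> v \<oplus>\<^bsub>P\<^esub> \<one>\<^bsub>P\<^esub>)"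
      if "e = y \<oplus>\<^bsub>P\<^esub> D \<otimes>\<^bsub>P\<^esub> v" "y \<in> carrier P" "D \<in> carrier P" "v \<in> carrier P" for e y D v
      unfolding that(1) using that(2-) by algebra
    let ?b = "?c \<otimes>\<^bsub>P\<^esub> (s \<oplus>\<^bsub>P\<^esub> s)" and ?e = "?c \<otimes>\<^bsub>P\<^esub> (s \<otimes>\<^bsub>P\<^esub> s) \<oplus>\<^bsub>P\<^esub> ?d \<otimes>\<^bsub>P\<^esub> var K"
    show "[?c \<oplus>\<^bsub>P\<^esub> ?c \<oplus>\<^bsub>P\<^esub> (?c \<oplus>\<^bsub>P\<^esub> ?c), \<zero>\<^bsub>P\<^esub>, ?b \<oplus>\<^bsub>P\<^esub> ?b \<oplus>\<^bsub>P\<^esub> (?b \<oplus>\<^bsub>P\<^esub> ?b), \<zero>\<^bsub>P\<^esub>, \<one>\<^bsub>P\<^esub> \<oplus>\<^bsub>P\<^esub> (?e \<oplus>\<^bsub>P\<^esub> ?e \<oplus>\<^bsub>P\<^esub> (?e \<oplus>\<^bsub>P\<^esub> ?e))] =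
        [C, \<zero>\<^bsub>P\<^esub>, C \<otimes>\<^bsub>P\<^esub> (s \<oplus>\<^bsub>P\<^esub> s), \<zero>\<^bsub>P\<^esub>, C \<otimes>\<^bsub>P\<^esub> (s \<otimes>\<^bsub>P\<^esub> s) \<oplus>\<^bsub>P\<^esub> k]"
      using cd vc 1[OF refl, of "s \<oplus>\<^bsub>P\<^esub> s"] 1[OF refl, of "s \<otimes>\<^bsub>P\<^esub> s"] 2[OF refl, of "?c \<otimes>\<^bsub>P\<^esub> (s \<otimes>\<^bsub>P\<^esub> s)" ?d "var K"]
      by (simp only: C[symmetric] k P.m_closed P.a_closed simp_thms)
  qed (use cd vc C C0 in auto)
  finally show ?thesis .
qed

text \<open>The kernel of a homomorphism from K[u] to a field is prime, and it is nonzero because it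
  contains A, so its monic generator is irreducible. For evaluation at a point of the closure this
  is the closed point below it.\<close>

lemma exists_closed_point_of_hom:
  assumes "field K" "field L" and \<theta>: "\<theta> \<in> ring_hom (poly_ring K) L"
    and A: "A \<in> carrier (poly_ring K)" "A \<noteq> []" "\<theta> A = \<zero>\<^bsub>L\<^esub>"
  shows "\<exists>f. closed_point K f \<and>
    (\<forall>B\<in>carrier (poly_ring K). \<theta> B = \<zero>\<^bsub>L\<^esub> \<longleftrightarrow> B \<in> PIdl\<^bsub>poly_ring K\<^esub> f)"
proof -
  let ?P = "poly_ring K"
  interpret K: field K by fact
  interpret L: field L by fact
  interpret P: domain ?P by (rule K.univ_poly_is_domain[OF K.carrier_is_subring])
  interpret h: ring_hom_ring ?P L \<theta> by (rule ring_hom_ringI2[OF P.ring_axioms L.ring_axioms \<theta>])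
  have "a_kernel ?P L \<theta> \<noteq> {[]}" using A unfolding a_kernel_def' by auto
  then obtain f where f: "f \<in> carrier ?P" "hd f = \<one>\<^bsub>K\<^esub>" "a_kernel ?P L \<theta> = PIdl\<^bsub>?P\<^esub> f"
    using K.exists_unique_gen[OF K.carrier_is_subfield h.kernel_is_ideal] by blast
  have mem: "B \<in> PIdl\<^bsub>?P\<^esub> f \<longleftrightarrow> \<theta> B = \<zero>\<^bsub>L\<^esub>" if "B \<in> carrier ?P" for B
    unfolding f(3)[symmetric] a_kernel_def' using that by auto
  have f0: "\<theta> f = \<zero>\<^bsub>L\<^esub>" using mem[OF f(1)] P.cgenideal_self[OF f(1)] by simp
  have fne: "f \<noteq> []"
  proof
    assume "f = []"
    then have "f = \<zero>\<^bsub>?P\<^esub>" by (simp add: univ_poly_zero)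
    moreover obtain w where "w \<in> carrier ?P" "A = w \<otimes>\<^bsub>?P\<^esub> f"
      using mem[OF A(1)] A(3) unfolding cgenideal_def by auto
    ultimately have "A = \<zero>\<^bsub>?P\<^esub>" by simp
    then show False using A(2) by (simp add: univ_poly_zero)
  qed
  have "pirreducible\<^bsub>K\<^esub> (carrier K) f"
  proof (rule K.pirreducibleI[OF K.carrier_is_subring f(1) fne])
    show "f \<notin> Units ?P"
    proof
      assume u: "f \<in> Units ?P"
      have "\<one>\<^bsub>L\<^esub> = \<theta> (f \<otimes>\<^bsub>?P\<^esub> inv\<^bsub>?P\<^esub> f)" using P.Units_r_inv[OF u] by simp
      also have "\<dots> = \<theta> f \<otimes>\<^bsub>L\<^esub> \<theta> (inv\<^bsub>?P\<^esub> f)"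
        by (rule h.hom_mult[OF f(1) P.Units_inv_closed[OF u]])
      also have "\<dots> = \<zero>\<^bsub>L\<^esub>" using f0 P.Units_inv_closed[OF u] by simp
      finally show False by simp
    qed
    fix r s assume rs: "r \<in> carrier ?P" "s \<in> carrier ?P" "f = r \<otimes>\<^bsub>?P\<^esub> s"
    have half: "v \<in> Units ?P" if uv: "u \<in> carrier ?P" "v \<in> carrier ?P" "f = u \<otimes>\<^bsub>?P\<^esub> v" "\<theta> u = \<zero>\<^bsub>L\<^esub>" for u v
    proof -
      obtain w where w: "w \<in> carrier ?P" "u = w \<otimes>\<^bsub>?P\<^esub> f"
        using mem[OF uv(1)] uv(4) unfolding cgenideal_def by auto
      have "f \<otimes>\<^bsub>?P\<^esub> (w \<otimes>\<^bsub>?P\<^esub> v) = (w \<otimes>\<^bsub>?P\<^esub> f) \<otimes>\<^bsub>?P\<^esub> v"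
        using w(1) f(1) uv(2) by (simp add: P.m_ac)
      also have "\<dots> = f \<otimes>\<^bsub>?P\<^esub> \<one>\<^bsub>?P\<^esub>"
        using f(1) by (simp only: w(2)[symmetric] uv(3)[symmetric] P.r_one)
      finally have "w \<otimes>\<^bsub>?P\<^esub> v = \<one>\<^bsub>?P\<^esub>"
        using P.m_lcancel[of f "w \<otimes>\<^bsub>?P\<^esub> v" "\<one>\<^bsub>?P\<^esub>"] fne f(1) w(1) uv(2) by (simp add: univ_poly_zero)
      then show ?thesis using w(1) uv(2) P.m_comm[of w v] by (auto simp: Units_def)
    qed
    have "\<theta> r \<otimes>\<^bsub>L\<^esub> \<theta> s = \<zero>\<^bsub>L\<^esub>" using f0 rs by simp
    then have "\<theta> r = \<zero>\<^bsub>L\<^esub> \<or> \<theta> s = \<zero>\<^bsub>L\<^esub>" using L.integral rs by simp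
    then show "r \<in> Units ?P \<or> s \<in> Units ?P"
      using half[of r s] half[of s r] rs P.m_comm by auto
  qed
  then show ?thesis using f mem by (auto simp: closed_point_def)
qed

text \<open>The leading coefficient is a nonzero constant of K and survives in the residue field
  because K embeds there. Coefficientwise reduction thus gives an already normalized list, to which
  \<open>biquadratic_pirreducible\<close> applies.\<close>

lemma specialize_biquadratic_pirreducible:
  assumes "field K" and f: "closed_point K f"
  defines "P \<equiv> poly_ring K" and "F \<equiv> residue_field K f"
  defines "h \<equiv> (\<lambda>q. PIdl\<^bsub>P\<^esub> f +>\<^bsub>P\<^esub> q)"
  assumes C: "C \<in> carrier K" "C \<noteq> \<zero>\<^bsub>K\<^esub>" and s: "s \<in> carrier P" and k: "k \<in> carrier P"
  defines "c \<equiv> ring.poly_of_const K C"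
  assumes nsq: "\<And>y. y \<in> carrier F \<Longrightarrow> y \<otimes>\<^bsub>F\<^esub> y \<noteq> h (\<ominus>\<^bsub>P\<^esub> (c \<otimes>\<^bsub>P\<^esub> k))"
    "\<And>y. y \<in> carrier F \<Longrightarrow> y \<otimes>\<^bsub>F\<^esub> y \<noteq> h (c \<otimes>\<^bsub>P\<^esub> (c \<otimes>\<^bsub>P\<^esub> (s \<otimes>\<^bsub>P\<^esub> s) \<oplus>\<^bsub>P\<^esub> k))"
  shows "pirreducible\<^bsub>F\<^esub> (carrier F)
    (specialize K f [c, \<zero>\<^bsub>P\<^esub>, c \<otimes>\<^bsub>P\<^esub> (s \<oplus>\<^bsub>P\<^esub> s), \<zero>\<^bsub>P\<^esub>, c \<otimes>\<^bsub>P\<^esub> (s \<otimes>\<^bsub>P\<^esub> s) \<oplus>\<^bsub>P\<^esub> k])"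
proof -
  interpret K: field K by fact
  interpret P: domain P unfolding P_def by (rule K.univ_poly_is_domain[OF K.carrier_is_subring])
  have fc: "f \<in> carrier P" "pirreducible\<^bsub>K\<^esub> (carrier K) f"
    using f by (auto simp: closed_point_def P_def)
  interpret F: field F
    unfolding F_def using K.rupture_is_field_iff_pirreducible[OF K.carrier_is_subfield] fc
    by (simp add: P_def)
  interpret h: ring_hom_ring P F h
    unfolding h_def P_def F_def
    by (rule K.rupture_surj_hom(2)[OF K.carrier_is_subring fc(1)[unfolded P_def]])
  have cc: "c \<in> carrier P"
    unfolding c_def P_def using ring_hom_closed[OF K.poly_of_const_hom C(1)] .
  have "(\<lambda>x. h (K.poly_of_const x)) \<in> ring_hom K F"
    using K.rupture_surj_norm_is_hom[OF K.carrier_is_subring fc(1)[unfolded P_def]]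
    by (simp add: h_def P_def F_def comp_def)
  then have inj: "inj_on (\<lambda>x. h (K.poly_of_const x)) (carrier K)" and
    zero: "h (K.poly_of_const \<zero>\<^bsub>K\<^esub>) = \<zero>\<^bsub>F\<^esub>"
    using non_trivial_field_hom_is_inj[OF _ K.field_axioms F.field_axioms]
      ring_hom_zero[OF _ K.ring_axioms F.ring_axioms] by auto
  have hc0: "h c \<noteq> \<zero>\<^bsub>F\<^esub>"
    using inj_onD[OF inj, of C "\<zero>\<^bsub>K\<^esub>"] zero C by (auto simp: c_def)
  have "specialize K f [c, \<zero>\<^bsub>P\<^esub>, c \<otimes>\<^bsub>P\<^esub> (s \<oplus>\<^bsub>P\<^esub> s), \<zero>\<^bsub>P\<^esub>, c \<otimes>\<^bsub>P\<^esub> (s \<otimes>\<^bsub>P\<^esub> s) \<oplus>\<^bsub>P\<^esub> k]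
      = F.normalize [h c, h \<zero>\<^bsub>P\<^esub>, h (c \<otimes>\<^bsub>P\<^esub> (s \<oplus>\<^bsub>P\<^esub> s)), h \<zero>\<^bsub>P\<^esub>, h (c \<otimes>\<^bsub>P\<^esub> (s \<otimes>\<^bsub>P\<^esub> s) \<oplus>\<^bsub>P\<^esub> k)]"
    by (simp add: specialize_def F_def h_def P_def del: F.normalize.simps)
  also have "\<dots> = [h c, \<zero>\<^bsub>F\<^esub>, h c \<otimes>\<^bsub>F\<^esub> (h s \<oplus>\<^bsub>F\<^esub> h s), \<zero>\<^bsub>F\<^esub>, h c \<otimes>\<^bsub>F\<^esub> (h s \<otimes>\<^bsub>F\<^esub> h s) \<oplus>\<^bsub>F\<^esub> h k]"
    using hc0 cc s k by simp
  finally have eq: "specialize K f [c, \<zero>\<^bsub>P\<^esub>, c \<otimes>\<^bsub>P\<^esub> (s \<oplus>\<^bsub>P\<^esub> s), \<zero>\<^bsub>P\<^esub>, c \<otimes>\<^bsub>P\<^esub> (s \<otimes>\<^bsub>P\<^esub> s) \<oplus>\<^bsub>P\<^esub> k] =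
      [h c, \<zero>\<^bsub>F\<^esub>, h c \<otimes>\<^bsub>F\<^esub> (h s \<oplus>\<^bsub>F\<^esub> h s), \<zero>\<^bsub>F\<^esub>, h c \<otimes>\<^bsub>F\<^esub> (h s \<otimes>\<^bsub>F\<^esub> h s) \<oplus>\<^bsub>F\<^esub> h k]" .
  show ?thesis
    unfolding eq
  proof (rule F.biquadratic_pirreducible)
    fix y assume y: "y \<in> carrier F"
    show "y \<otimes>\<^bsub>F\<^esub> y \<noteq> \<ominus>\<^bsub>F\<^esub> (h c \<otimes>\<^bsub>F\<^esub> h k)"
      using nsq(1)[OF y] cc s k by (simp add: h.hom_a_inv)
    show "y \<otimes>\<^bsub>F\<^esub> y \<noteq> h c \<otimes>\<^bsub>F\<^esub> (h c \<otimes>\<^bsub>F\<^esub> (h s \<otimes>\<^bsub>F\<^esub> h s) \<oplus>\<^bsub>F\<^esub> h k)"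
      using nsq(2)[OF y] cc s k by simp
  qed (use hc0 cc s k in auto)
qed

section \<open>Infinitely many closed points\<close>

lemma eval_map_hom:
  assumes "field K" "field L" "h \<in> ring_hom K L" "x \<in> carrier L"
  shows "(\<lambda>A. ring.eval L (map h A) x) \<in> ring_hom (poly_ring K) L"
proof -
  interpret K: field K by fact
  interpret L: field L by fact
  interpret h: ring_hom_ring K L h by (rule ring_hom_ringI2[OF K.ring_axioms L.ring_axioms assms(3)])
  have mapc: "set (map h A) \<subseteq> carrier L" if "A \<in> carrier (poly_ring K)" for A
    using K.set_poly_subset[OF that] by auto
  show ?thesis
  proof (rule ring_hom_memI)
    fix A assume A: "A \<in> carrier (poly_ring K)"
    show "L.eval (map h A) x \<in> carrier L" using L.eval_in_carrier[OF mapc[OF A] assms(4)] .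
    fix B assume B: "B \<in> carrier (poly_ring K)"
    note c = K.set_poly_subset[OF A] K.set_poly_subset[OF B]
    have "L.eval (map h (K.poly_mult A B)) x = L.eval (L.normalize (map h (K.poly_mult A B))) x"
      by (rule L.eval_normalize[symmetric]) (use K.poly_mult_in_carrier[OF c] assms(4) in auto)
    also have "\<dots> = L.eval (map h A) x \<otimes>\<^bsub>L\<^esub> L.eval (map h B) x"
      unfolding h.poly_mult_hom'[OF c] by (rule L.eval_poly_mult[OF mapc[OF A] mapc[OF B] assms(4)])
    finally show "L.eval (map h (A \<otimes>\<^bsub>poly_ring K\<^esub> B)) x = L.eval (map h A) x \<otimes>\<^bsub>L\<^esub> L.eval (map h B) x"
      by (simp add: univ_poly_mult)
    have "L.eval (map h (K.poly_add A B)) x = L.eval (L.normalize (map h (K.poly_add A B))) x"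
      by (rule L.eval_normalize[symmetric])
        (use K.poly_add_in_carrier[OF c] assms(4) in \<open>auto simp del: K.poly_add.simps\<close>)
    also have "\<dots> = L.eval (map h A) x \<oplus>\<^bsub>L\<^esub> L.eval (map h B) x"
      unfolding h.poly_add_hom'[OF c] by (rule L.eval_poly_add[OF mapc[OF A] mapc[OF B] assms(4)])
    finally show "L.eval (map h (A \<oplus>\<^bsub>poly_ring K\<^esub> B)) x = L.eval (map h A) x \<oplus>\<^bsub>L\<^esub> L.eval (map h B) x"
      by (simp add: univ_poly_add del: K.poly_add.simps)
  qed (use assms(4) in \<open>simp add: univ_poly_one\<close>)
qed

lemma frobenius_field_alg_closure:
  fixes K :: "('a, 'b) ring_scheme"
  assumes "field K" "finite (carrier K)" "alg_char K \<noteq> 2"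
  defines "L \<equiv> field.alg_closure K"
  shows "frobenius_field L (card (carrier K))"
    and "frobenius_field.fixed L (card (carrier K)) = ring.indexed_const K ` carrier K"
    and "add_pow L (alg_char K) \<one>\<^bsub>L\<^esub> = \<zero>\<^bsub>L\<^esub>"
proof -
  interpret K: field K by fact
  let ?\<iota> = "K.indexed_const :: 'a \<Rightarrow> ('a list \<times> nat) multiset \<Rightarrow> 'a" and ?q = "card (carrier K)" and ?p = "alg_char K"
  interpret L: algebraic_closure L "?\<iota> ` carrier K" unfolding L_def by (rule K.alg_closureE(1))
  have hom: "?\<iota> \<in> ring_hom K L" unfolding L_def by (rule K.alg_closureE(2))
  interpret h: ring_hom_ring K L ?\<iota> by (rule ring_hom_ringI2[OF K.ring_axioms L.ring_axioms hom])
  have p: "Factorial_Ring.prime ?p" by (rule K.prime_alg_char[OF assms(2)])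
  have p0: "add_pow K ?p \<one>\<^bsub>K\<^esub> = \<zero>\<^bsub>K\<^esub>" using K.nat_mult_one_eq_zero_iff[OF assms(2)] by simp
  show pL: "add_pow L ?p \<one>\<^bsub>L\<^esub> = \<zero>\<^bsub>L\<^esub>" using h.hom_nat_mult[of "\<one>\<^bsub>K\<^esub>" ?p] p0 by simp
  obtain m where m: "?q = ?p ^ m" using K.card_eq_alg_char_power[OF assms(2)] by blast
  have "card {\<zero>\<^bsub>K\<^esub>, \<one>\<^bsub>K\<^esub>} \<le> ?q" by (rule card_mono[OF assms(2)]) auto
  then have q1: "?q > 1" by simp
  have odd_p: "odd ?p" using p assms(3) prime_odd_nat prime_ge_2_nat[OF p] by fastforce
  \<comment> \<open>The image of K consists of q solutions of x^q = x, and there are at most q of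
    them: 0 and the roots of unity of order dividing q - 1.\<close>
  have fixL: "{x \<in> carrier L. x [^]\<^bsub>L\<^esub> ?q = x} = ?\<iota> ` carrier K"
  proof -
    let ?S = "{x \<in> carrier L. x [^]\<^bsub>L\<^esub> ?q = x}"
    have sub: "?\<iota> ` carrier K \<subseteq> ?S"
    proof
      fix y assume "y \<in> ?\<iota> ` carrier K"
      then obtain x where x: "x \<in> carrier K" "y = ?\<iota> x" by blast
      then have "y [^]\<^bsub>L\<^esub> ?q = ?\<iota> (x [^]\<^bsub>K\<^esub> ?q)" by (simp add: h.hom_nat_pow)
      then show "y \<in> ?S" using K.pow_card_eq_self[OF assms(2) x(1)] x by simp
    qed
    have "x [^]\<^bsub>L\<^esub> (?q - 1) = \<one>\<^bsub>L\<^esub>" if x: "x \<in> ?S" "x \<noteq> \<zero>\<^bsub>L\<^esub>" for x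
    proof -
      have "x [^]\<^bsub>L\<^esub> (?q - 1) \<otimes>\<^bsub>L\<^esub> x = x [^]\<^bsub>L\<^esub> Suc (?q - 1)" by simp
      also have "Suc (?q - 1) = ?q" using q1 by simp
      finally have "x [^]\<^bsub>L\<^esub> (?q - 1) \<otimes>\<^bsub>L\<^esub> x = \<one>\<^bsub>L\<^esub> \<otimes>\<^bsub>L\<^esub> x" using x by simp
      then show ?thesis using x L.m_rcancel[of x "x [^]\<^bsub>L\<^esub> (?q - 1)" "\<one>\<^bsub>L\<^esub>"] by simp
    qed
    then have sup: "?S \<subseteq> insert \<zero>\<^bsub>L\<^esub> {x \<in> carrier L. x [^]\<^bsub>L\<^esub> (?q - 1) = \<one>\<^bsub>L\<^esub>}" by auto
    have roots: "finite {x \<in> carrier L. x [^]\<^bsub>L\<^esub> (?q - 1) = \<one>\<^bsub>L\<^esub>}"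
      "card {x \<in> carrier L. x [^]\<^bsub>L\<^esub> (?q - 1) = \<one>\<^bsub>L\<^esub>} \<le> ?q - 1"
      using L.card_roots_of_unity[of "?q - 1"] q1 by auto
    then have "finite ?S" using sup finite_subset by blast
    moreover have "card ?S \<le> card (?\<iota> ` carrier K)"
    proof -
      have "card ?S \<le> card (insert \<zero>\<^bsub>L\<^esub> {x \<in> carrier L. x [^]\<^bsub>L\<^esub> (?q - 1) = \<one>\<^bsub>L\<^esub>})"
        using sup roots(1) by (intro card_mono) auto
      also have "\<dots> \<le> ?q" by (rule card_insert_le_m1) (use roots(2) q1 in auto)
      also have "\<dots> = card (?\<iota> ` carrier K)"
        by (rule card_image[OF K.indexed_const_inj_on, symmetric])
      finally show ?thesis .
    qed
    ultimately show ?thesis using sub card_seteq by blast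
  qed
  show ff: "frobenius_field L ?q"
  proof
    show "(x \<oplus>\<^bsub>L\<^esub> y) [^]\<^bsub>L\<^esub> ?q = x [^]\<^bsub>L\<^esub> ?q \<oplus>\<^bsub>L\<^esub> y [^]\<^bsub>L\<^esub> ?q"
      if "x \<in> carrier L" "y \<in> carrier L" for x y
      unfolding m using L.frobenius_pow_add[OF p pL that] .
    show "odd ?q" unfolding m using odd_p by simp
    show "1 < ?q" by (rule q1)
    show "\<one>\<^bsub>L\<^esub> \<oplus>\<^bsub>L\<^esub> \<one>\<^bsub>L\<^esub> \<noteq> \<zero>\<^bsub>L\<^esub>"
    proof
      assume "\<one>\<^bsub>L\<^esub> \<oplus>\<^bsub>L\<^esub> \<one>\<^bsub>L\<^esub> = \<zero>\<^bsub>L\<^esub>"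
      then have "?\<iota> (\<one>\<^bsub>K\<^esub> \<oplus>\<^bsub>K\<^esub> \<one>\<^bsub>K\<^esub>) = ?\<iota> \<zero>\<^bsub>K\<^esub>" by simp
      then have "\<one>\<^bsub>K\<^esub> \<oplus>\<^bsub>K\<^esub> \<one>\<^bsub>K\<^esub> = \<zero>\<^bsub>K\<^esub>"
        by (rule inj_onD[OF K.indexed_const_inj_on]) auto
      then have "add_pow K (2::nat) \<one>\<^bsub>K\<^esub> = \<zero>\<^bsub>K\<^esub>" by (simp add: numeral_2_eq_2)
      then have "?p dvd 2" using K.nat_mult_one_eq_zero_iff[OF assms(2)] by blast
      then show False using p assms(3) primes_dvd_imp_eq two_is_prime_nat by blast
    qed
    show "card {x \<in> carrier L. x [^]\<^bsub>L\<^esub> ?q = x} = ?q"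
      unfolding fixL by (rule card_image[OF K.indexed_const_inj_on])
    show "L.splitted r" if "r \<in> carrier ({x \<in> carrier L. x [^]\<^bsub>L\<^esub> ?q = x}[X]\<^bsub>L\<^esub>)" for r
      using that L.roots_over_subfield unfolding fixL by blast
  qed
  show "frobenius_field.fixed L ?q = ?\<iota> ` carrier K"
    unfolding frobenius_field.fixed_def[OF ff] frobenius_field.frob_def[OF ff] by (rule fixL)
qed

theorem theorem5p8:
  fixes K :: "('a, 'b) ring_scheme" and c d :: 'a
  assumes "field K" and "finite (carrier K)" and "alg_char K \<noteq> 2"
    and "c \<in> carrier K" and "c \<noteq> \<zero>\<^bsub>K\<^esub>"
    and "d \<in> carrier K" and "d \<noteq> \<zero>\<^bsub>K\<^esub>"
  shows "infinite {f. closed_point K f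
            \<and> pirreducible\<^bsub>residue_field K f\<^esub> (carrier (residue_field K f))
                (specialize K f (Pi1 K (alg_char K) c d))
            \<and> pirreducible\<^bsub>residue_field K f\<^esub> (carrier (residue_field K f))
                (specialize K f (Pi2 K (alg_char K) c d))}"
proof
  let ?p = "alg_char K"
  let ?T = "{f. closed_point K f
            \<and> pirreducible\<^bsub>residue_field K f\<^esub> (carrier (residue_field K f)) (specialize K f (Pi1 K ?p c d))
            \<and> pirreducible\<^bsub>residue_field K f\<^esub> (carrier (residue_field K f)) (specialize K f (Pi2 K ?p c d))}"
  assume finT: "finite ?T"
  interpret K: field K by fact
  define L where "L = K.alg_closure"
  define \<iota> :: "'a \<Rightarrow> ('a list \<times> nat) multiset \<Rightarrow> 'a" where "\<iota> = K.indexed_const"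
  define q where "q = card (carrier K)"
  note closure = frobenius_field_alg_closure[OF assms(1-3), folded L_def q_def \<iota>_def]
  interpret L: frobenius_field L q by (rule closure(1))
  have hom: "\<iota> \<in> ring_hom K L" unfolding \<iota>_def L_def by (rule K.alg_closureE(2))
  interpret h: ring_hom_ring K L \<iota> by (rule ring_hom_ringI2[OF K.ring_axioms L.ring_axioms hom])
  have inj: "inj_on \<iota> (carrier K)" unfolding \<iota>_def by (rule K.indexed_const_inj_on)
  have p: "Factorial_Ring.prime ?p" by (rule K.prime_alg_char[OF assms(2)])
  have nz: "\<iota> y \<noteq> \<zero>\<^bsub>L\<^esub>" if "y \<in> carrier K" "y \<noteq> \<zero>\<^bsub>K\<^esub>" for y
    using inj_onD[OF inj, of y "\<zero>\<^bsub>K\<^esub>"] that by auto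
  have fixed: "\<iota> y \<in> L.fixed" if "y \<in> carrier K" for y using closure(2) that by auto
  let ?P = "poly_ring K"
  interpret P: domain ?P by (rule K.univ_poly_is_domain[OF K.carrier_is_subring])
  define c4 where "c4 = (c \<oplus>\<^bsub>K\<^esub> c) \<oplus>\<^bsub>K\<^esub> (c \<oplus>\<^bsub>K\<^esub> c)"
  define d4 where "d4 = (d \<oplus>\<^bsub>K\<^esub> d) \<oplus>\<^bsub>K\<^esub> (d \<oplus>\<^bsub>K\<^esub> d)"
  have c4: "c4 \<in> carrier K" "d4 \<in> carrier K" "c4 \<noteq> \<zero>\<^bsub>K\<^esub>"
  proof -
    show "c4 \<in> carrier K" "d4 \<in> carrier K" using assms by (auto simp: c4_def d4_def)
    have "\<iota> c4 = (\<one>\<^bsub>L\<^esub> \<oplus>\<^bsub>L\<^esub> \<one>\<^bsub>L\<^esub>) \<otimes>\<^bsub>L\<^esub> (\<one>\<^bsub>L\<^esub> \<oplus>\<^bsub>L\<^esub> \<one>\<^bsub>L\<^esub>) \<otimes>\<^bsub>L\<^esub> \<iota> c"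
      unfolding c4_def using assms(4) by (simp add: L.l_distr L.r_distr L.a_assoc)
    then have "\<iota> c4 \<noteq> \<zero>\<^bsub>L\<^esub>" using nz[OF assms(4,5)] L.two_nonzero assms(4) by (simp add: L.integral_iff)
    then show "c4 \<noteq> \<zero>\<^bsub>K\<^esub>" by auto
  qed
  define G where "G = {x \<in> carrier L. \<exists>j\<ge>1. x \<in> L.fixpts j \<and>
    L.biquadratic_nonsquares (L.fixpts j) ?p (\<iota> c) (\<iota> d) \<zero>\<^bsub>L\<^esub> x \<and>
    L.biquadratic_nonsquares (L.fixpts j) ?p (\<iota> c4) (\<iota> d4) \<one>\<^bsub>L\<^esub> x}"
  have infG: "infinite G"
    unfolding G_def
    by (rule L.infinite_nonsquare_points[OF p closure(3)])
      (use assms fixed nz in \<open>auto simp: c4_def d4_def\<close>)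
  have "\<exists>f\<in>?T. L.is_root (map \<iota> f) x" if x: "x \<in> G" for x
  proof -
    obtain j where j: "x \<in> carrier L" "j \<ge> 1" "x \<in> L.fixpts j"
      and nsq: "L.biquadratic_nonsquares (L.fixpts j) ?p (\<iota> c) (\<iota> d) \<zero>\<^bsub>L\<^esub> x"
        "L.biquadratic_nonsquares (L.fixpts j) ?p (\<iota> c4) (\<iota> d4) \<one>\<^bsub>L\<^esub> x"
      using x unfolding G_def by blast
    \<comment> \<open>Evaluation at x: the kernel gives the closed point below x, and the image is
      its residue field inside the closure.\<close>
    define \<theta> where "\<theta> A = L.eval (map \<iota> A) x" for A
    have \<theta>: "\<theta> \<in> ring_hom ?P L"
      unfolding \<theta>_def[abs_def] by (rule eval_map_hom[OF assms(1) L.field_axioms hom j(1)])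
    interpret \<theta>: ring_hom_ring ?P L \<theta> by (rule ring_hom_ringI2[OF P.ring_axioms L.ring_axioms \<theta>])
    have \<theta>_const: "\<theta> (K.poly_of_const y) = \<iota> y" if "y \<in> carrier K" for y
      using that j(1) by (auto simp: \<theta>_def K.poly_of_const_def)
    have \<theta>_var: "\<theta> (var K) = x" using j(1) by (simp add: \<theta>_def var_def)
    \<comment> \<open>The coefficients are fixed by Frobenius, so j applications move only the
      argument x, which returns to itself: the image of \<theta> lies in the field with q^j
      elements.\<close>
    have \<theta>_fix: "\<theta> A \<in> L.fixpts j" if A: "A \<in> carrier ?P" for A
    proof -
      have step: "L.frob (L.eval (map \<iota> A) z) = L.eval (map \<iota> A) (L.frob z)" if z: "z \<in> carrier L" for z
      proof -
        have eq: "map L.frob (map \<iota> A) = map \<iota> A"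
          using K.set_poly_subset[OF A] fixed by (auto simp: L.fixed_iff)
        have "set (map \<iota> A) \<subseteq> carrier L" using K.set_poly_subset[OF A] by auto
        then show ?thesis using L.frob.eval_hom'[OF z, of "map \<iota> A"] unfolding eq by simp
      qed
      have "(L.frob ^^ k) (\<theta> A) = L.eval (map \<iota> A) ((L.frob ^^ k) x)" for k
        by (induction k) (use step j(1) L.funpow_closed in \<open>auto simp: \<theta>_def\<close>)
      then show ?thesis using j(3) A by (simp add: L.fixpts_def) (simp add: \<theta>_def)
    qed
    \<comment> \<open>The polynomial u^(q^j) - u, a nonzero element of the kernel of
      \<theta>.\<close>
    define A where "A = \<one>\<^bsub>K\<^esub> # replicate (q ^ j - 2) \<zero>\<^bsub>K\<^esub> @ [\<ominus>\<^bsub>K\<^esub> \<one>\<^bsub>K\<^esub>, \<zero>\<^bsub>K\<^esub>]"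
    have qj: "q ^ j \<ge> 2" using one_less_power[OF L.q_gt_1, of j] j(2) by simp
    have "A \<in> carrier ?P" unfolding A_def by (rule K.poly_ring_memI) auto
    moreover have "\<theta> A = \<zero>\<^bsub>L\<^esub>"
    proof -
      have "x [^]\<^bsub>L\<^esub> (q ^ j) = x" using j L.funpow_frob[OF j(1), of j] by (simp add: L.fixpts_def)
      moreover have "q ^ j = Suc (Suc (q ^ j - 2))" using qj by simp
      ultimately have "x [^]\<^bsub>L\<^esub> (q ^ j - 2) \<otimes>\<^bsub>L\<^esub> x \<otimes>\<^bsub>L\<^esub> x = x" by (metis L.nat_pow_Suc)
      moreover have "map \<iota> A = \<one>\<^bsub>L\<^esub> # replicate (q ^ j - 2) \<zero>\<^bsub>L\<^esub> @ [\<ominus>\<^bsub>L\<^esub> \<one>\<^bsub>L\<^esub>, \<zero>\<^bsub>L\<^esub>]"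
        by (simp add: A_def h.hom_a_inv)
      ultimately show ?thesis
        using j(1) qj L.eval_replicate[of "[\<ominus>\<^bsub>L\<^esub> \<one>\<^bsub>L\<^esub>, \<zero>\<^bsub>L\<^esub>]" x "q ^ j - 2"]
        by (simp add: \<theta>_def L.l_minus L.r_neg)
    qed
    ultimately obtain f where f: "closed_point K f"
      "\<And>B. B \<in> carrier ?P \<Longrightarrow> \<theta> B = \<zero>\<^bsub>L\<^esub> \<longleftrightarrow> B \<in> PIdl\<^bsub>?P\<^esub> f"
      using exists_closed_point_of_hom[OF assms(1) L.field_axioms \<theta>, of A] by (auto simp: A_def)
    have fc: "f \<in> carrier ?P" "f \<noteq> []"
      using f(1) K.pirreducibleE(1)[OF K.carrier_is_subring] by (auto simp: closed_point_def)
    let ?F = "residue_field K f" and ?r = "\<lambda>B. PIdl\<^bsub>?P\<^esub> f +>\<^bsub>?P\<^esub> B"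
    \<comment> \<open>A square root of the class of B, represented by D, is sent by \<theta> to a
      square root of \<theta> B in \<open>fixpts j\<close>.\<close>
    have nonsquare: "Y \<otimes>\<^bsub>?F\<^esub> Y \<noteq> ?r B"
      if Y: "Y \<in> carrier ?F" and B: "B \<in> carrier ?P" "\<And>y. y \<in> L.fixpts j \<Longrightarrow> y \<otimes>\<^bsub>L\<^esub> y \<noteq> \<theta> B" for Y B
    proof
      assume eq: "Y \<otimes>\<^bsub>?F\<^esub> Y = ?r B"
      obtain D where D: "D \<in> carrier ?P" "Y = ?r D"
        using Y unfolding rupture_def FactRing_def A_RCOSETS_def' by auto
      have "?r (D \<otimes>\<^bsub>?P\<^esub> D) = ?r B"
        using ring_hom_mult[OF K.rupture_surj_hom(1)[OF K.carrier_is_subring fc(1)] D(1) D(1)] eq D(2) by simp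
      then have "D \<otimes>\<^bsub>?P\<^esub> D \<ominus>\<^bsub>?P\<^esub> B \<in> PIdl\<^bsub>?P\<^esub> f"
        using P.quotient_eq_iff_same_a_r_cos[OF P.cgenideal_ideal[OF fc(1)], of "D \<otimes>\<^bsub>?P\<^esub> D" B] D(1) B(1) by simp
      then have "\<theta> (D \<otimes>\<^bsub>?P\<^esub> D \<ominus>\<^bsub>?P\<^esub> B) = \<zero>\<^bsub>L\<^esub>" using f(2) D(1) B(1) by simp
      then have "\<theta> D \<otimes>\<^bsub>L\<^esub> \<theta> D \<ominus>\<^bsub>L\<^esub> \<theta> B = \<zero>\<^bsub>L\<^esub>"
        using D(1) B(1) by (simp add: a_minus_def \<theta>.hom_a_inv)
      then have "\<theta> D \<otimes>\<^bsub>L\<^esub> \<theta> D = \<theta> B" using D(1) B(1) by simp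
      then show False using B(2)[OF \<theta>_fix[OF D(1)]] by simp
    qed
    have vc: "var K \<in> carrier ?P" by (rule K.var_closed(1)[OF K.carrier_is_subring])
    define s where "s = var K [^]\<^bsub>?P\<^esub> ?p"
    have s: "s \<in> carrier ?P" "\<theta> s = x [^]\<^bsub>L\<^esub> ?p"
      using vc \<theta>_var by (auto simp: s_def \<theta>.hom_nat_pow)
    have irr: "pirreducible\<^bsub>?F\<^esub> (carrier ?F) (specialize K f [K.poly_of_const C, \<zero>\<^bsub>?P\<^esub>,
        K.poly_of_const C \<otimes>\<^bsub>?P\<^esub> (s \<oplus>\<^bsub>?P\<^esub> s), \<zero>\<^bsub>?P\<^esub>, K.poly_of_const C \<otimes>\<^bsub>?P\<^esub> (s \<otimes>\<^bsub>?P\<^esub> s) \<oplus>\<^bsub>?P\<^esub> k])"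
      if C: "C \<in> carrier K" "C \<noteq> \<zero>\<^bsub>K\<^esub>" and k: "k \<in> carrier ?P" "\<theta> k = \<iota> D \<otimes>\<^bsub>L\<^esub> x \<oplus>\<^bsub>L\<^esub> m"
        and ns: "L.biquadratic_nonsquares (L.fixpts j) ?p (\<iota> C) (\<iota> D) m x" for C D m k
    proof (rule specialize_biquadratic_pirreducible[OF assms(1) f(1) C s(1) k(1)])
      let ?c = "K.poly_of_const C"
      have cc: "?c \<in> carrier ?P" using ring_hom_closed[OF K.poly_of_const_hom C(1)] .
      fix Y assume Y: "Y \<in> carrier ?F"
      show "Y \<otimes>\<^bsub>?F\<^esub> Y \<noteq> ?r (\<ominus>\<^bsub>?P\<^esub> (?c \<otimes>\<^bsub>?P\<^esub> k))"
        by (rule nonsquare[OF Y])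
          (use cc k s ns[unfolded L.biquadratic_nonsquares_def] \<theta>_const[OF C(1)] in \<open>auto simp: \<theta>.hom_a_inv\<close>)
      show "Y \<otimes>\<^bsub>?F\<^esub> Y \<noteq> ?r (?c \<otimes>\<^bsub>?P\<^esub> (?c \<otimes>\<^bsub>?P\<^esub> (s \<otimes>\<^bsub>?P\<^esub> s) \<oplus>\<^bsub>?P\<^esub> k))"
        by (rule nonsquare[OF Y]) (use cc k s ns[unfolded L.biquadratic_nonsquares_def] \<theta>_const[OF C(1)] in auto)
    qed
    have const: "K.poly_of_const y \<in> carrier ?P" if "y \<in> carrier K" for y
      using ring_hom_closed[OF K.poly_of_const_hom that] .
    have "pirreducible\<^bsub>?F\<^esub> (carrier ?F) (specialize K f (Pi1 K ?p c d))"
      unfolding Pi1_eq[OF assms(1,4,5,6)] s_def[symmetric]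
      by (rule irr[of c _ d "\<zero>\<^bsub>L\<^esub>"])
        (use nsq assms vc const \<theta>_const \<theta>_var j(1) in auto)
    moreover have "pirreducible\<^bsub>?F\<^esub> (carrier ?F) (specialize K f (Pi2 K ?p c d))"
      unfolding Pi2_eq[OF assms(1,4) c4(3)[unfolded c4_def] assms(6)] s_def[symmetric]
        c4_def[symmetric] d4_def[symmetric]
      by (rule irr[of c4 _ d4 "\<one>\<^bsub>L\<^esub>"])
        (use nsq c4 vc const \<theta>_const \<theta>_var j(1) in auto)
    moreover have "L.is_root (map \<iota> f) x"
      using f(2)[OF fc(1)] P.cgenideal_self[OF fc(1)] fc(2) j(1) by (simp add: L.is_root_def \<theta>_def)
    ultimately show ?thesis using f(1) by blast
  qed
  \<comment> \<open>Each f has finitely many roots in the closure, so finitely many f could not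
    account for the infinite set \<open>G\<close>.\<close>
  then have "G \<subseteq> (\<Union>f\<in>?T. {x. L.is_root (map \<iota> f) x})" by auto
  moreover have "finite (\<Union>f\<in>?T. {x. L.is_root (map \<iota> f) x})"
  proof (rule finite_UN_I[OF finT])
    fix f assume "f \<in> ?T"
    then have "f \<in> carrier ?P" by (simp add: closed_point_def)
    then show "finite {x. L.is_root (map \<iota> f) x}"
      using L.finite_number_of_roots polynomial_hom[OF hom assms(1) L.field_axioms] by blast
  qed
  ultimately show False using infG finite_subset by blast
qed

end
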